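(* Let $\alpha>1$, let $(M,g)$ be a compact, orientable Riemannian manifold without boundary, let $(N,h)$ be a Riemannian manifold, and let $\psi:(M,g)\to(N,h)$ be an $\alpha$-harmonic map. Suppose that $(N,h)$ admits a conformal vector field $X$ with potential function $\lambda>0$. Then $\psi$ is constant.
   Context: For a smooth map $\psi:(M,g)\to(N,h)$, $|d\psi|^2$ is the squared Hilbert-Schmidt norm of $d\psi$ and $\tau(\psi)=\mathrm{Tr}_g\nabla d\psi$ is the tension field. For $\alpha>1$ the $\alpha$-energy is $E_\alpha(\psi)=\int_M(1+|d\psi|^2)^\alpha\,dV_g$; $\psi$ is $\alpha$-harmonic if it is a critical point of $E_\alpha$, equivalently if $$\tau_\alpha(\psi)=2\alpha(1+|d\psi|^2)^{\alpha-1}\tau(\psi)+d\psi\left(\mathrm{grad}\left(2\alpha(1+|d\psi|^2)^{\alpha-1}\right)\right)=0.$$ A smooth vector field $X$ on $(N,h)$ is conformal with potential function $\lambda\in C^\infty(N)$ if $\mathcal L_Xh=2\lambda h$, where $\mathcal L_X$ is the Lie derivative.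
   Formalization: M is additionally assumed connected (otherwise a map constant on each component with different values is α-harmonic but not constant), and M and N have dimension at least 1. *)

theory Defs
  imports "HOL-Analysis.Analysis"
begin

section \<open>Smooth functions on open subsets of Euclidean space\<close>

text \<open>Only meaningful for open \<open>S\<close>: the derivatives are taken in the full space.\<close>

fun Ck_on :: "nat \<Rightarrow> 'a::euclidean_space set \<Rightarrow> ('a \<Rightarrow> 'b::real_normed_vector) \<Rightarrow> bool" where
  "Ck_on 0 S f \<longleftrightarrow> continuous_on S f"
| "Ck_on (Suc k) S f \<longleftrightarrow> (\<forall>x\<in>S. f differentiable (at x)) \<and>
     (\<forall>v. Ck_on k S (\<lambda>x. frechet_derivative f (at x) v))"

definition smooth_on :: "'a::euclidean_space set \<Rightarrow> ('a \<Rightarrow> 'b::real_normed_vector) \<Rightarrow> bool" where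
  "smooth_on S f \<longleftrightarrow> (\<forall>k. Ck_on k S f)"


section \<open>Smooth manifolds and smooth maps\<close>

text \<open>A manifold is a topological type together with a smooth atlas on the whole type. A chart
  is a pair \<open>(U, \<phi>)\<close>; only the values of \<open>\<phi>\<close> on its domain \<open>U\<close> matter.\<close>

type_synonym ('p, 'e) chart = "'p set \<times> ('p \<Rightarrow> 'e)"

definition chart_inv :: "('p, 'e) chart \<Rightarrow> 'e \<Rightarrow> 'p" where
  "chart_inv c = inv_into (fst c) (snd c)"

definition chart_rep :: "('p, 'd) chart \<Rightarrow> ('q, 'e) chart \<Rightarrow> ('p \<Rightarrow> 'q) \<Rightarrow> 'd \<Rightarrow> 'e" where
  "chart_rep c d f = snd d \<circ> f \<circ> chart_inv c"

definition is_chart :: "('p::topological_space, 'e::euclidean_space) chart \<Rightarrow> bool" where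
  "is_chart c \<longleftrightarrow> open (fst c) \<and> open (snd c ` fst c) \<and>
     homeomorphism (fst c) (snd c ` fst c) (snd c) (chart_inv c)"

definition smooth_atlas :: "('p::topological_space, 'e::euclidean_space) chart set \<Rightarrow> bool" where
  "smooth_atlas A \<longleftrightarrow> (\<forall>c\<in>A. is_chart c) \<and> \<Union> (fst ` A) = UNIV \<and>
     (\<forall>c\<in>A. \<forall>d\<in>A. smooth_on (snd c ` (fst c \<inter> fst d)) (chart_rep c d id))"

definition smooth_map ::
  "('p::topological_space, 'd::euclidean_space) chart set \<Rightarrow>
   ('q::topological_space, 'e::euclidean_space) chart set \<Rightarrow> ('p \<Rightarrow> 'q) \<Rightarrow> bool" where
  "smooth_map A B f \<longleftrightarrow> continuous_on (\<Union> (fst ` A)) f \<and>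
     (\<forall>c\<in>A. \<forall>d\<in>B. smooth_on (snd c ` (fst c \<inter> f -` fst d)) (chart_rep c d f))"

definition real_atlas :: "(real, real) chart set" where
  "real_atlas = {(UNIV, id)}"

definition cylinder_atlas :: "real \<Rightarrow> ('p, 'e) chart set \<Rightarrow> (real \<times> 'p, real \<times> 'e) chart set" where
  "cylinder_atlas \<epsilon> A = (\<lambda>c. ({-\<epsilon><..<\<epsilon>} \<times> fst c, \<lambda>(t, p). (t, snd c p))) ` A"

definition jacobian ::
  "('p, real^'m) chart \<Rightarrow> ('q, real^'n) chart \<Rightarrow> ('p \<Rightarrow> 'q) \<Rightarrow> 'p \<Rightarrow> real^'m^'n" where
  "jacobian c d f p = matrix (frechet_derivative (chart_rep c d f) (at (snd c p)))"

text \<open>Orientability: some atlas compatible with \<open>A\<close> has orientation-preserving transition maps.\<close>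

definition orientable :: "('p::topological_space, real^'m) chart set \<Rightarrow> bool" where
  "orientable A \<longleftrightarrow> (\<exists>C. smooth_atlas (A \<union> C) \<and> \<Union> (fst ` C) = UNIV \<and>
     (\<forall>c\<in>C. \<forall>d\<in>C. \<forall>p\<in>fst c \<inter> fst d. det (jacobian c d id p) > 0))"


section \<open>Tensor fields\<close>

text \<open>A tensor field is the family of its components: for each chart of the atlas and each point
  of the chart domain, the components with respect to the coordinate frame of that chart. The
  families belonging to different charts are related by the tensor transformation law.\<close>

definition smooth_components ::
  "('p, 'e::euclidean_space) chart set \<Rightarrow> (('p, 'e) chart \<Rightarrow> 'p \<Rightarrow> 'b::real_normed_vector) \<Rightarrow> bool" where
  "smooth_components A T \<longleftrightarrow> (\<forall>c\<in>A. smooth_on (snd c ` fst c) (T c \<circ> chart_inv c))"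

definition riemannian_metric ::
  "('p, real^'m) chart set \<Rightarrow> (('p, real^'m) chart \<Rightarrow> 'p \<Rightarrow> real^'m^'m) \<Rightarrow> bool" where
  "riemannian_metric A g \<longleftrightarrow> smooth_components A g \<and>
     (\<forall>c\<in>A. \<forall>p\<in>fst c. transpose (g c p) = g c p \<and> (\<forall>v. v \<noteq> 0 \<longrightarrow> v \<bullet> (g c p *v v) > 0)) \<and>
     (\<forall>c\<in>A. \<forall>d\<in>A. \<forall>p\<in>fst c \<inter> fst d.
        g c p = transpose (jacobian c d id p) ** g d p ** jacobian c d id p)"

definition vector_field ::
  "('p, real^'m) chart set \<Rightarrow> (('p, real^'m) chart \<Rightarrow> 'p \<Rightarrow> real^'m) \<Rightarrow> bool" where
  "vector_field A X \<longleftrightarrow> smooth_components A X \<and>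
     (\<forall>c\<in>A. \<forall>d\<in>A. \<forall>p\<in>fst c \<inter> fst d. X d p = jacobian c d id p *v X c p)"

definition riemannian_manifold ::
  "('p::{t2_space, second_countable_topology}, real^'m) chart set \<Rightarrow>
   (('p, real^'m) chart \<Rightarrow> 'p \<Rightarrow> real^'m^'m) \<Rightarrow> bool" where
  "riemannian_manifold A g \<longleftrightarrow> smooth_atlas A \<and> riemannian_metric A g"

text \<open>In components,
  \<open>(L\<^sub>X h)\<^sub>a\<^sub>b = X\<^sup>k \<partial>\<^sub>k h\<^sub>a\<^sub>b + (\<partial>\<^sub>a X\<^sup>k) h\<^sub>k\<^sub>b + h\<^sub>a\<^sub>k (\<partial>\<^sub>b X\<^sup>k)\<close>; the matrix \<open>D\<close> has entries
  \<open>D $ k $ a = \<partial>\<^sub>a X\<^sup>k\<close>.\<close>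

definition lie_derivative ::
  "(('p, real^'m) chart \<Rightarrow> 'p \<Rightarrow> real^'m) \<Rightarrow> (('p, real^'m) chart \<Rightarrow> 'p \<Rightarrow> real^'m^'m) \<Rightarrow>
   ('p, real^'m) chart \<Rightarrow> 'p \<Rightarrow> real^'m^'m" where
  "lie_derivative X h c p =
     (let D = matrix (frechet_derivative (X c \<circ> chart_inv c) (at (snd c p))) in
      frechet_derivative (h c \<circ> chart_inv c) (at (snd c p)) (X c p)
        + transpose D ** h c p + h c p ** D)"

definition conformal_field ::
  "('p::topological_space, real^'m) chart set \<Rightarrow> (('p, real^'m) chart \<Rightarrow> 'p \<Rightarrow> real^'m^'m) \<Rightarrow>
   (('p, real^'m) chart \<Rightarrow> 'p \<Rightarrow> real^'m) \<Rightarrow> ('p \<Rightarrow> real) \<Rightarrow> bool" where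
  "conformal_field A h X l \<longleftrightarrow> vector_field A X \<and> smooth_map A real_atlas l \<and>
     (\<forall>c\<in>A. \<forall>p\<in>fst c. lie_derivative X h c p = (2 * l p) *\<^sub>R h c p)"


section \<open>The \<open>\<alpha>\<close>-energy and \<open>\<alpha>\<close>-harmonic maps\<close>

text \<open>The Riemannian volume: the unique Borel measure which in each chart has density
  \<open>sqrt (det g)\<close> with respect to Lebesgue measure. It exists and is unique on every
  (second countable) Riemannian manifold.\<close>

definition is_riemannian_volume ::
  "('p::topological_space, real^'m) chart set \<Rightarrow> (('p, real^'m) chart \<Rightarrow> 'p \<Rightarrow> real^'m^'m) \<Rightarrow>
   'p measure \<Rightarrow> bool" where
  "is_riemannian_volume A g V \<longleftrightarrow> sets V = sets borel \<and>
     (\<forall>c\<in>A. \<forall>S\<in>sets borel. S \<subseteq> fst c \<longrightarrow>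
        emeasure V S =
          (\<integral>\<^sup>+x. ennreal (sqrt (det (g c (chart_inv c x)))) * indicator (snd c ` S) x \<partial>lborel))"

definition riemannian_volume ::
  "('p::topological_space, real^'m) chart set \<Rightarrow> (('p, real^'m) chart \<Rightarrow> 'p \<Rightarrow> real^'m^'m) \<Rightarrow>
   'p measure" where
  "riemannian_volume A g = (THE V. is_riemannian_volume A g V)"

definition chart_at :: "('p, 'e) chart set \<Rightarrow> 'p \<Rightarrow> ('p, 'e) chart" where
  "chart_at A p = (SOME c. c \<in> A \<and> p \<in> fst c)"

text \<open>\<open>|df|\<^sup>2 = g\<^sup>i\<^sup>j h\<^sub>a\<^sub>b \<partial>\<^sub>i f\<^sup>a \<partial>\<^sub>j f\<^sup>b\<close>, the trace with respect to \<open>g\<close> of the pullback of \<open>h\<close>. The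
  value does not depend on the charts in which it is computed.\<close>

definition diff_norm_sq ::
  "('p, real^'m) chart set \<Rightarrow> (('p, real^'m) chart \<Rightarrow> 'p \<Rightarrow> real^'m^'m) \<Rightarrow>
   ('q, real^'n) chart set \<Rightarrow> (('q, real^'n) chart \<Rightarrow> 'q \<Rightarrow> real^'n^'n) \<Rightarrow>
   ('p \<Rightarrow> 'q) \<Rightarrow> 'p \<Rightarrow> real" where
  "diff_norm_sq A g B h f p =
     (let c = chart_at A p; d = chart_at B (f p); J = jacobian c d f p in
      trace (matrix_inv (g c p) ** (transpose J ** h d (f p) ** J)))"

definition alpha_energy ::
  "real \<Rightarrow> ('p::topological_space, real^'m) chart set \<Rightarrow>
   (('p, real^'m) chart \<Rightarrow> 'p \<Rightarrow> real^'m^'m) \<Rightarrow>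
   ('q, real^'n) chart set \<Rightarrow> (('q, real^'n) chart \<Rightarrow> 'q \<Rightarrow> real^'n^'n) \<Rightarrow>
   ('p \<Rightarrow> 'q) \<Rightarrow> real" where
  "alpha_energy \<alpha> A g B h f =
     (LINT p|riemannian_volume A g. (1 + diff_norm_sq A g B h f p) powr \<alpha>)"

text \<open>For a compact domain, where the energy is finite and every variation has compact support:
  critical points with respect to all smooth variations.\<close>

definition alpha_harmonic ::
  "real \<Rightarrow> ('p::topological_space, real^'m) chart set \<Rightarrow>
   (('p, real^'m) chart \<Rightarrow> 'p \<Rightarrow> real^'m^'m) \<Rightarrow>
   ('q::topological_space, real^'n) chart set \<Rightarrow>
   (('q, real^'n) chart \<Rightarrow> 'q \<Rightarrow> real^'n^'n) \<Rightarrow> ('p \<Rightarrow> 'q) \<Rightarrow> bool" where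
  "alpha_harmonic \<alpha> A g B h f \<longleftrightarrow> smooth_map A B f \<and>
     (\<forall>\<epsilon>>0. \<forall>F :: real \<Rightarrow> 'p \<Rightarrow> 'q.
        smooth_map (cylinder_atlas \<epsilon> A) B (\<lambda>(t, p). F t p) \<and> F 0 = f \<longrightarrow>
        ((\<lambda>t. alpha_energy \<alpha> A g B h (F t)) has_real_derivative 0) (at 0))"

end

(* Along a variation of \<psi> with variation field V = \<rho> (X o \<psi>), \<rho> a function on M, the derivative of
   |d\<psi>|^2 at t = 0 is 2 \<lambda> \<rho> |d\<psi>|^2 plus a term linear in d\<rho>, because X is conformal. If \<rho> is
   supported in the preimage of one chart domain of N, such a variation is the straight line
   t \<mapsto> \<psi> + t V in that chart, so neither the flow of X nor an integration by parts is needed. Adding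
   up over a finite partition of unity kills the terms in d\<rho>, and criticality of the energy gives
   \<integral> \<alpha> (1 + |d\<psi>|^2)^(\<alpha> - 1) 2 \<lambda> |d\<psi>|^2 dV = 0, hence d\<psi> = 0. *)

theory Submission
  imports Defs
begin

section \<open>Smooth functions on Euclidean space\<close>

text \<open>Only the velocity of a variation at t = 0 enters the first variation, so any curve with
  velocity V will do. What limits the straight line is that it must stay inside the chart range,
  which forces the compact support of \<rho> and a uniform bound on t. The variations themselves are
  never combined: each lives in its own chart of N, and only their rates of energy at t = 0 are
  summed. For this the rates must be written without reference to the carrying chart: the term
  linear in d\<rho> is the g-pairing of d\<rho> with the pullback of the 1-form h(X, -), which is
  intrinsic. Two choices in the definitions shape the rest. |d\<psi>|^2 is evaluated in arbitrarily
  picked charts, so independence of the charts precedes even its continuity. The volume is a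
  definite description, so it must be constructed and shown unique, then finite, and positive on
  nonempty open sets; positivity turns vanishing almost everywhere into vanishing
  everywhere.\<close>

lemma Ck_on_cong:
  assumes "open S" "\<And>x. x \<in> S \<Longrightarrow> f x = g x"
  shows "Ck_on k S f \<longleftrightarrow> Ck_on k S g"
proof -
  have *: "Ck_on k S g" if "Ck_on k S f" "\<And>x. x \<in> S \<Longrightarrow> f x = g x" for f g :: "'a \<Rightarrow> 'b"
    using that
  proof (induction k arbitrary: f g)
    case 0
    then show ?case using continuous_on_eq by fastforce
  next
    case (Suc k)
    have d: "(g has_derivative frechet_derivative f (at x)) (at x)" if "x \<in> S" for x
      using Suc.prems that \<open>open S\<close>
      by (auto intro: has_derivative_transform_within_open simp: frechet_derivative_works)
    have e: "frechet_derivative g (at x) = frechet_derivative f (at x)" if "x \<in> S" for x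
      using d[OF that] frechet_derivative_at by metis
    have "Ck_on k S (\<lambda>x. frechet_derivative g (at x) v)" for v
      by (rule Suc.IH[of "\<lambda>x. frechet_derivative f (at x) v"]) (use Suc.prems e in auto)
    then show ?case
      using d by (auto simp: differentiable_def)
  qed
  show ?thesis using *[of f g] *[of g f] assms(2) by metis
qed

lemma Ck_on_subset: "Ck_on k S f \<Longrightarrow> T \<subseteq> S \<Longrightarrow> Ck_on k T f"
  by (induction k arbitrary: f) (auto intro: continuous_on_subset)

text \<open>Allows smoothness to be checked piecewise, as for cutoff functions and variations, whose
  formulas differ from region to region.\<close>

lemma Ck_on_local:
  assumes "\<And>x. x \<in> S \<Longrightarrow> \<exists>T. open T \<and> x \<in> T \<and> Ck_on k T f"
  shows "Ck_on k S f"
  using assms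
proof (induction k arbitrary: f)
  case 0
  then show ?case
    by (metis Ck_on.simps(1) continuous_at_imp_continuous_on continuous_on_eq_continuous_at)
next
  case (Suc k)
  have "f differentiable (at x)" if "x \<in> S" for x
    using Suc.prems[OF that] by auto
  moreover have "Ck_on k S (\<lambda>x. frechet_derivative f (at x) v)" for v
    using Suc.prems by (intro Suc.IH) fastforce
  ultimately show ?case by simp
qed

text \<open>\<open>frechet_derivative\<close> is a choice operator; uniqueness of derivatives lets
  an explicit candidate \<open>f'\<close> take its place, which every closure property below relies
  on.\<close>

lemma Ck_on_SucI:
  assumes "open S" "\<And>x. x \<in> S \<Longrightarrow> (f has_derivative f' x) (at x)"
    and "\<And>v. Ck_on k S (\<lambda>x. f' x v)"
  shows "Ck_on (Suc k) S f"
proof -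
  have e: "frechet_derivative f (at x) = f' x" if "x \<in> S" for x
    using assms(2)[OF that] frechet_derivative_at by metis
  have "Ck_on k S (\<lambda>x. frechet_derivative f (at x) v)" for v
    using assms(3)[of v] e Ck_on_cong[OF assms(1), of "\<lambda>x. frechet_derivative f (at x) v" "\<lambda>x. f' x v"]
    by auto
  then show ?thesis using assms(2) by (auto simp: differentiable_def)
qed

lemma Ck_on_SucD:
  assumes "Ck_on (Suc k) S f" "x \<in> S"
  shows "(f has_derivative frechet_derivative f (at x)) (at x)"
  using assms by (auto simp: frechet_derivative_works)

lemma Ck_on_pred: "Ck_on (Suc k) S f \<Longrightarrow> Ck_on k S f"
proof (induction k arbitrary: f)
  case 0
  then show ?case
    by (auto intro!: continuous_at_imp_continuous_on differentiable_imp_continuous_within)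
qed auto

lemma Ck_on_const [simp]: "Ck_on k S (\<lambda>x. c)"
  by (induction k arbitrary: c) auto

lemma Ck_on_add:
  assumes "open S" "Ck_on k S f" "Ck_on k S g"
  shows "Ck_on k S (\<lambda>x. f x + g x)"
  using assms(2,3)
proof (induction k arbitrary: f g)
  case 0
  then show ?case by (auto intro: continuous_intros)
next
  case (Suc k)
  show ?case
    by (rule Ck_on_SucI[OF \<open>open S\<close> has_derivative_add[OF Ck_on_SucD Ck_on_SucD]])
       (use Suc in auto)
qed

lemma Ck_on_sum:
  assumes "open S" "\<And>i. i \<in> I \<Longrightarrow> Ck_on k S (f i)"
  shows "Ck_on k S (\<lambda>x. \<Sum>i\<in>I. f i x)"
  using assms(2) by (induction I rule: infinite_finite_induct) (auto intro: Ck_on_add[OF \<open>open S\<close>])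

lemma Ck_on_bounded_linear:
  assumes "open S" "bounded_linear L" "Ck_on k S f"
  shows "Ck_on k S (\<lambda>x. L (f x))"
  using assms(3)
proof (induction k arbitrary: f)
  case 0
  then show ?case by (auto intro: bounded_linear.continuous_on[OF assms(2)])
next
  case (Suc k)
  show ?case
    by (rule Ck_on_SucI[OF \<open>open S\<close> bounded_linear.has_derivative[OF assms(2) Ck_on_SucD]])
       (use Suc in auto)
qed

lemma Ck_on_ident [simp]: "open S \<Longrightarrow> Ck_on k S (\<lambda>x. x)"
  by (cases k) (auto intro!: Ck_on_SucI[OF _ has_derivative_ident])

text \<open>One product rule for scalar, inner and matrix products. Each term of the derivative
  keeps one undifferentiated factor, which \<open>Ck_on_pred\<close> lowers to the order of the
  induction hypothesis.\<close>

lemma Ck_on_bilinear: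
  assumes "open S" "bounded_bilinear b" "Ck_on k S f" "Ck_on k S g"
  shows "Ck_on k S (\<lambda>x. b (f x) (g x))"
  using assms(3,4)
proof (induction k arbitrary: f g)
  case 0
  then show ?case by (auto intro: bounded_bilinear.continuous_on[OF assms(2)])
next
  case (Suc k)
  have "Ck_on k S (\<lambda>x. b (f x) (frechet_derivative g (at x) v) + b (frechet_derivative f (at x) v) (g x))" for v
    using Suc.prems Ck_on_pred[OF Suc.prems(1)] Ck_on_pred[OF Suc.prems(2)]
    by (intro Ck_on_add[OF \<open>open S\<close>] Suc.IH) auto
  then show ?case
    by (intro Ck_on_SucI[OF \<open>open S\<close> bounded_bilinear.FDERIV[OF assms(2)
          Ck_on_SucD[OF Suc.prems(1)] Ck_on_SucD[OF Suc.prems(2)]]])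
qed

text \<open>\<open>Ck_on\<close> controls derivatives in fixed directions only; this expansion
  reduces directions that vary with the point to the fixed basis directions.\<close>

lemma linear_expand_Basis:
  fixes v :: "'a::euclidean_space"
  assumes "linear D"
  shows "D v = (\<Sum>b\<in>Basis. (v \<bullet> b) *\<^sub>R D b)"
  by (metis (no_types, lifting) assms euclidean_representation linear_scale linear_sum sum.cong)

lemma Ck_on_compose:
  assumes "open S" "open T" "g ` S \<subseteq> T" "Ck_on k T f" "Ck_on k S g"
  shows "Ck_on k S (\<lambda>x. f (g x))"
  using assms(4,5)
proof (induction k arbitrary: f)
  case 0
  then show ?case using assms(3) by (auto intro: continuous_on_compose2)
next
  case (Suc k)
  have gx: "g x \<in> T" if "x \<in> S" for x using assms(3) that by auto
  let ?D = "\<lambda>x v. frechet_derivative f (at (g x)) (frechet_derivative g (at x) v)"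
  have d: "((\<lambda>x. f (g x)) has_derivative ?D x) (at x)" if "x \<in> S" for x
    using has_derivative_compose[OF Ck_on_SucD[OF Suc.prems(2) that] Ck_on_SucD[OF Suc.prems(1) gx[OF that]]] .
  \<comment> \<open>In the chain rule the outer derivative is taken in a direction depending on
    \<open>x\<close>. Expanded in the basis it becomes a sum of products of functions known to be of
    order \<open>k\<close>.\<close>
  let ?E = "\<lambda>x v. \<Sum>b\<in>Basis. (frechet_derivative g (at x) v \<bullet> b) *\<^sub>R frechet_derivative f (at (g x)) b"
  have e: "?D x v = ?E x v" if "x \<in> S" for x v
    by (rule linear_expand_Basis[OF has_derivative_linear[OF Ck_on_SucD[OF Suc.prems(1) gx[OF that]]]])
  have "Ck_on k S (\<lambda>x. ?E x v)" for v
  proof (intro Ck_on_sum[OF \<open>open S\<close>] Ck_on_bilinear[OF \<open>open S\<close> bounded_bilinear_scaleR])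
    fix b
    show "Ck_on k S (\<lambda>x. frechet_derivative g (at x) v \<bullet> b)"
      using Suc.prems by (intro Ck_on_bounded_linear[OF \<open>open S\<close> bounded_linear_inner_left]) auto
    show "Ck_on k S (\<lambda>x. frechet_derivative f (at (g x)) b)"
      using Suc.IH[of "\<lambda>y. frechet_derivative f (at y) b"] Suc.prems Ck_on_pred[OF Suc.prems(2)]
      by simp
  qed
  moreover have "((\<lambda>x. f (g x)) has_derivative ?E x) (at x)" if "x \<in> S" for x
    using d[OF that] unfolding e[OF that] .
  ultimately show ?case by (intro Ck_on_SucI[OF \<open>open S\<close>, where f' = ?E])
qed

lemma Ck_on_Pair:
  assumes "open S" "Ck_on k S f" "Ck_on k S g"
  shows "Ck_on k S (\<lambda>x. (f x, g x))"
  using assms(2,3)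
proof (induction k arbitrary: f g)
  case 0
  then show ?case by (auto intro: continuous_intros)
next
  case (Suc k)
  show ?case
    by (rule Ck_on_SucI[OF \<open>open S\<close> has_derivative_Pair[OF Ck_on_SucD Ck_on_SucD]])
       (use Suc in auto)
qed

text \<open>The induction closes because the derivative of 1/x is a polynomial in 1/x
  itself.\<close>

lemma Ck_on_inverse: "Ck_on k (- {0}) (inverse :: real \<Rightarrow> real)"
proof (induction k)
  case 0
  then show ?case by (auto intro!: continuous_intros)
next
  case (Suc k)
  have "Ck_on k (- {0::real}) (\<lambda>x. (- v) * (inverse x * inverse x))" for v
    by (intro Ck_on_bilinear[OF _ bounded_bilinear_mult] Suc Ck_on_const) auto
  then show ?case
    by (intro Ck_on_SucI[where f' = "\<lambda>x v. (- v) * (inverse x * inverse x)"])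
       (auto intro!: derivative_eq_intros simp: field_simps)
qed

lemma smooth_on_cong:
  "open S \<Longrightarrow> (\<And>x. x \<in> S \<Longrightarrow> f x = g x) \<Longrightarrow> smooth_on S f \<longleftrightarrow> smooth_on S g"
  unfolding smooth_on_def using Ck_on_cong by blast

lemma smooth_on_transform:
  "open S \<Longrightarrow> smooth_on S f \<Longrightarrow> (\<And>x. x \<in> S \<Longrightarrow> f x = g x) \<Longrightarrow> smooth_on S g"
  by (subst smooth_on_cong[of S g f]) auto

lemma smooth_on_subset: "smooth_on S f \<Longrightarrow> T \<subseteq> S \<Longrightarrow> smooth_on T f"
  by (auto simp: smooth_on_def intro: Ck_on_subset)

lemma smooth_on_local:
  assumes "\<And>x. x \<in> S \<Longrightarrow> \<exists>T. open T \<and> x \<in> T \<and> smooth_on T f"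
  shows "smooth_on S f"
  unfolding smooth_on_def
proof
  fix k
  show "Ck_on k S f"
  proof (rule Ck_on_local)
    fix x assume "x \<in> S"
    then obtain T where "open T" "x \<in> T" "smooth_on T f" using assms by blast
    then show "\<exists>T. open T \<and> x \<in> T \<and> Ck_on k T f" by (auto simp only: smooth_on_def)
  qed
qed

lemma smooth_on_const: "smooth_on S (\<lambda>x. c)"
  by (simp add: smooth_on_def)

lemma smooth_on_ident: "open S \<Longrightarrow> smooth_on S (\<lambda>x. x)"
  by (simp add: smooth_on_def)

lemma smooth_on_add: "open S \<Longrightarrow> smooth_on S f \<Longrightarrow> smooth_on S g \<Longrightarrow> smooth_on S (\<lambda>x. f x + g x)"
  by (simp add: smooth_on_def Ck_on_add)

lemma smooth_on_sum:
  "open S \<Longrightarrow> (\<And>i. i \<in> I \<Longrightarrow> smooth_on S (f i)) \<Longrightarrow> smooth_on S (\<lambda>x. \<Sum>i\<in>I. f i x)"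
  by (simp add: smooth_on_def Ck_on_sum)

lemma smooth_on_bounded_linear:
  "open S \<Longrightarrow> bounded_linear L \<Longrightarrow> smooth_on S f \<Longrightarrow> smooth_on S (\<lambda>x. L (f x))"
  by (simp add: smooth_on_def Ck_on_bounded_linear)

lemma smooth_on_bilinear:
  "open S \<Longrightarrow> bounded_bilinear b \<Longrightarrow> smooth_on S f \<Longrightarrow> smooth_on S g \<Longrightarrow> smooth_on S (\<lambda>x. b (f x) (g x))"
  by (simp add: smooth_on_def Ck_on_bilinear)

lemma smooth_on_Pair:
  "open S \<Longrightarrow> smooth_on S f \<Longrightarrow> smooth_on S g \<Longrightarrow> smooth_on S (\<lambda>x. (f x, g x))"
  by (simp add: smooth_on_def Ck_on_Pair)

lemma smooth_on_compose:
  "open S \<Longrightarrow> open T \<Longrightarrow> g ` S \<subseteq> T \<Longrightarrow> smooth_on T f \<Longrightarrow> smooth_on S g \<Longrightarrow> smooth_on S (\<lambda>x. f (g x))"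
  by (simp add: smooth_on_def Ck_on_compose)

lemma smooth_on_divide:
  fixes f g :: "'a::euclidean_space \<Rightarrow> real"
  assumes "open S" "smooth_on S f" "smooth_on S g" "\<And>x. x \<in> S \<Longrightarrow> g x \<noteq> 0"
  shows "smooth_on S (\<lambda>x. f x / g x)"
proof -
  have "smooth_on S (\<lambda>x. inverse (g x))"
    by (rule smooth_on_compose[where T = "- {0}"])
       (use assms Ck_on_inverse in \<open>auto simp: smooth_on_def\<close>)
  then show ?thesis
    using smooth_on_bilinear[OF \<open>open S\<close> bounded_bilinear_mult assms(2)] by (simp add: divide_inverse)
qed

lemma smooth_on_imp_continuous_on: "smooth_on S f \<Longrightarrow> continuous_on S f"
  unfolding smooth_on_def using Ck_on.simps(1) by blast

lemma smooth_on_has_derivative: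
  "smooth_on S f \<Longrightarrow> x \<in> S \<Longrightarrow> (f has_derivative frechet_derivative f (at x)) (at x)"
  unfolding smooth_on_def using Ck_on_SucD by blast

lemma smooth_on_frechet_derivative:
  "smooth_on S f \<Longrightarrow> smooth_on S (\<lambda>x. frechet_derivative f (at x) v)"
  unfolding smooth_on_def using Ck_on.simps(2) by blast

text \<open>Joint continuity in base point and direction, again by expanding the direction in the
  basis.\<close>

lemma continuous_on_frechet_derivative:
  assumes "smooth_on S f" "continuous_on T y" "y ` T \<subseteq> S" "continuous_on T v"
  shows "continuous_on T (\<lambda>t. frechet_derivative f (at (y t)) (v t))"
proof -
  have "continuous_on T (\<lambda>t. \<Sum>b\<in>Basis. (v t \<bullet> b) *\<^sub>R frechet_derivative f (at (y t)) b)"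
    using assms
    by (intro continuous_intros continuous_on_compose2[OF smooth_on_imp_continuous_on[OF smooth_on_frechet_derivative[OF assms(1)]]])
       auto
  moreover have "frechet_derivative f (at (y t)) (v t) = (\<Sum>b\<in>Basis. (v t \<bullet> b) *\<^sub>R frechet_derivative f (at (y t)) b)"
    if "t \<in> T" for t
    by (rule linear_expand_Basis[OF has_derivative_linear[OF smooth_on_has_derivative[OF assms(1)]]])
       (use assms(3) that in auto)
  ultimately show ?thesis by (simp cong: continuous_on_cong)
qed

section \<open>A smooth function that is flat at the origin\<close>

text \<open>The family is closed under differentiation, which makes each member smooth at \<open>0\<close>.\<close>

definition flat_exp :: "nat \<Rightarrow> real \<Rightarrow> real" where
  "flat_exp k x = (if x \<le> 0 then 0 else exp (- (1 / x)) / x ^ k)"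

lemma flat_exp_has_derivative:
  "(flat_exp k has_real_derivative flat_exp (k + 2) x - real k * flat_exp (Suc k) x) (at x)"
proof (cases x "0 :: real" rule: linorder_cases)
  case less
  have "((\<lambda>x. 0) has_real_derivative 0) (at x)" by simp
  then have "(flat_exp k has_real_derivative 0) (at x)"
    by (rule has_field_derivative_transform_within_open[where S = "{..<0}"])
       (use less in \<open>auto simp: flat_exp_def\<close>)
  then show ?thesis using less by (simp add: flat_exp_def)
next
  case greater
  have "((\<lambda>x. exp (- (1 / x)) / x ^ k) has_real_derivative
      (exp (- (1 / x)) * (1 / x\<^sup>2) * x ^ k - exp (- (1 / x)) * (real k * x ^ (k - 1))) / (x ^ k * x ^ k)) (at x)"
    using greater by (auto intro!: derivative_eq_intros simp: field_simps power2_eq_square)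
  moreover have "(exp (- (1 / x)) * (1 / x\<^sup>2) * x ^ k - exp (- (1 / x)) * (real k * x ^ (k - 1))) / (x ^ k * x ^ k)
      = flat_exp (k + 2) x - real k * flat_exp (Suc k) x"
    using greater by (cases k) (auto simp: flat_exp_def field_simps power2_eq_square)
  ultimately have "((\<lambda>x. exp (- (1 / x)) / x ^ k) has_real_derivative
      flat_exp (k + 2) x - real k * flat_exp (Suc k) x) (at x)"
    by simp
  then show ?thesis
    by (rule has_field_derivative_transform_within_open[where S = "{0<..}"])
       (use greater in \<open>auto simp: flat_exp_def\<close>)
next
  case equal
  have "((\<lambda>y. flat_exp k y / y) \<longlongrightarrow> 0) (at 0)"
  proof (rule filterlim_split_at)
    have "((\<lambda>y::real. 0::real) \<longlongrightarrow> 0) (at_left 0)" by simp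
    then show "((\<lambda>y. flat_exp k y / y) \<longlongrightarrow> 0) (at_left 0)"
      by (rule Lim_transform_eventually) (auto simp: flat_exp_def eventually_at intro!: exI[of _ 1])
    \<comment> \<open>With u = 1/y the right-hand difference quotient at 0 becomes u^(k+1) / exp u,
      and u tends to infinity.\<close>
    have "((\<lambda>u::real. u ^ Suc k / exp u) \<longlongrightarrow> 0) at_top" by (rule tendsto_power_div_exp_0)
    then have "((\<lambda>y::real. inverse y ^ Suc k / exp (inverse y)) \<longlongrightarrow> 0) (at_right 0)"
      by (rule filterlim_compose[OF _ filterlim_inverse_at_top_right])
    then show "((\<lambda>y. flat_exp k y / y) \<longlongrightarrow> 0) (at_right 0)"
      by (rule Lim_transform_eventually)
         (auto simp: flat_exp_def eventually_at exp_minus field_simps intro!: exI[of _ 1])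
  qed
  then show ?thesis using equal by (simp add: has_field_derivative_iff flat_exp_def)
qed

text \<open>The index \<open>k\<close> stays free in the induction, since differentiating shifts it
  to \<open>k + 1\<close> and \<open>k + 2\<close>.\<close>

lemma smooth_on_flat_exp: "smooth_on UNIV (flat_exp k)"
proof -
  have "Ck_on n UNIV (flat_exp k)" for n
  proof (induction n arbitrary: k)
    case 0
    then show ?case
      using flat_exp_has_derivative
      by (auto intro!: continuous_at_imp_continuous_on DERIV_isCont)
  next
    case (Suc n)
    show ?case
    proof (rule Ck_on_SucI)
      show "(flat_exp k has_derivative (\<lambda>v. v * (flat_exp (k + 2) x + (- real k) * flat_exp (Suc k) x))) (at x)" for x
        using flat_exp_has_derivative[of k x]
        by (simp add: has_field_derivative_def mult.commute[of _ "_ - _"])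
      show "Ck_on n UNIV (\<lambda>x. v * (flat_exp (k + 2) x + (- real k) * flat_exp (Suc k) x))" for v
        by (intro Ck_on_bilinear[OF _ bounded_bilinear_mult] Ck_on_add Ck_on_const Suc) auto
    qed simp
  qed
  then show ?thesis by (simp add: smooth_on_def)
qed

section \<open>Positive definite matrices\<close>

definition pos_def_mat :: "real^'n^'n \<Rightarrow> bool" where
  "pos_def_mat P \<longleftrightarrow> transpose P = P \<and> (\<forall>v. v \<noteq> 0 \<longrightarrow> v \<bullet> (P *v v) > 0)"

definition pos_semidef_mat :: "real^'n^'n \<Rightarrow> bool" where
  "pos_semidef_mat P \<longleftrightarrow> transpose P = P \<and> (\<forall>v. v \<bullet> (P *v v) \<ge> 0)"

text \<open>The rank-one matrix v w^T. It serves both for decomposing a metric into squares and for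
  the term X d\<rho> in the derivative of \<rho> X.\<close>

definition outer :: "real^'m \<Rightarrow> real^'n \<Rightarrow> real^'n^'m" where
  "outer v w = (\<chi> i j. v $ i * w $ j)"

lemma outer_mult_vec: "outer v w *v x = (w \<bullet> x) *\<^sub>R v"
  by (simp add: outer_def matrix_vector_mult_def vec_eq_iff inner_vec_def sum_distrib_right
      sum_distrib_left mult_ac)

lemma matrix_mult_outer: "M ** outer v w = outer (M *v v) w"
  by (simp add: outer_def matrix_matrix_mult_def matrix_vector_mult_def vec_eq_iff sum_distrib_right
      sum_distrib_left mult_ac)

lemma outer_matrix_mult: "outer v w ** M = outer v (transpose M *v w)"
  by (simp add: outer_def matrix_matrix_mult_def matrix_vector_mult_def transpose_def vec_eq_iff
      sum_distrib_left mult_ac)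

lemma transpose_outer: "transpose (outer v w) = outer w v"
  by (simp add: outer_def transpose_def vec_eq_iff mult_ac)

lemma trace_outer: "trace (outer v w) = v \<bullet> w"
  by (simp add: outer_def trace_def inner_vec_def)

lemma symmetric_mat_inner: "transpose P = P \<Longrightarrow> x \<bullet> (P *v y) = y \<bullet> (P *v x)"
  for P :: "real^'n^'n"
  by (metis dot_lmul_matrix inner_commute transpose_matrix_vector)

text \<open>The quadratic form along the line x + t y is a nonnegative polynomial in
  \<open>t\<close>. For merely semidefinite \<open>P\<close> the leading coefficient may vanish, so
  that case is treated apart.\<close>

lemma pos_semidef_mat_Cauchy_Schwarz:
  assumes "pos_semidef_mat P"
  shows "(x \<bullet> (P *v y))\<^sup>2 \<le> (x \<bullet> (P *v x)) * (y \<bullet> (P *v y))"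
proof -
  have sym: "y \<bullet> (P *v x) = x \<bullet> (P *v y)"
    using assms symmetric_mat_inner unfolding pos_semidef_mat_def by metis
  have q: "0 \<le> x \<bullet> (P *v x) + 2 * t * (x \<bullet> (P *v y)) + t\<^sup>2 * (y \<bullet> (P *v y))" for t
  proof -
    have "0 \<le> (x + t *\<^sub>R y) \<bullet> (P *v (x + t *\<^sub>R y))"
      using assms unfolding pos_semidef_mat_def by blast
    also have "\<dots> = x \<bullet> (P *v x) + 2 * t * (x \<bullet> (P *v y)) + t\<^sup>2 * (y \<bullet> (P *v y))"
      using sym by (simp add: matrix_vector_right_distrib matrix_vector_mult_scaleR inner_add_left inner_add_right
          algebra_simps power2_eq_square)
    finally show ?thesis .
  qed
  show ?thesis
  proof (cases "y \<bullet> (P *v y) = 0")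
    case True
    have "x \<bullet> (P *v y) = 0"
    proof (rule ccontr)
      assume n: "x \<bullet> (P *v y) \<noteq> 0"
      show False
        \<comment> \<open>With vanishing leading coefficient the polynomial is affine in
          \<open>t\<close>; at this \<open>t\<close> it equals -1.\<close>
        using q[of "- (x \<bullet> (P *v x) + 1) / (2 * (x \<bullet> (P *v y)))"] n True by (simp add: field_simps)
    qed
    then show ?thesis using True by simp
  next
    case False
    then have p: "y \<bullet> (P *v y) > 0"
      using assms unfolding pos_semidef_mat_def by (metis less_eq_real_def)
    have "0 \<le> (x \<bullet> (P *v x)) - (x \<bullet> (P *v y))\<^sup>2 / (y \<bullet> (P *v y))"
      \<comment> \<open>The minimiser of the quadratic polynomial.\<close>
      using q[of "- (x \<bullet> (P *v y)) / (y \<bullet> (P *v y))"] p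
      by (simp add: field_simps power2_eq_square)
    then show ?thesis using p by (simp add: field_simps)
  qed
qed

lemma axis_inner: "axis i 1 \<bullet> (x :: real^'n) = x $ i"
  by (simp add: inner_axis inner_commute)

lemma matrix_vector_axis_nth: "(P *v axis j (1::real)) $ i = P $ i $ j"
  by (simp add: matrix_vector_mult_basis column_def)

text \<open>One step of the Cholesky decomposition clears a row and a column.\<close>

lemma pos_semidef_mat_eq_sum_outer:
  fixes P :: "real^'n^'n"
  assumes "pos_semidef_mat P"
  shows "\<exists>vs. P = (\<Sum>v\<leftarrow>vs. outer v v)"
  using assms
proof (induction "card {i. P $ i \<noteq> 0}" arbitrary: P rule: less_induct)
  case less
  have tr: "transpose P = P" and pos: "v \<bullet> (P *v v) \<ge> 0" for v
    using less.prems unfolding pos_semidef_mat_def by blast+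
  show ?case
  proof (cases "\<exists>i. P $ i \<noteq> 0")
    case False
    then have "P = (\<Sum>v\<leftarrow>[]. outer v v)" by (simp add: vec_eq_iff)
    then show ?thesis by blast
  next
    case True
    then obtain i where i: "P $ i \<noteq> 0" by blast
    define d where "d = P $ i $ i"
    have quad: "axis a 1 \<bullet> (P *v axis b 1) = P $ a $ b" for a b
      by (simp add: axis_inner matrix_vector_axis_nth)
    have symP: "P $ a $ b = P $ b $ a" for a b
      using tr by (metis transpose_def vec_lambda_beta)
    \<comment> \<open>By Cauchy-Schwarz a zero diagonal entry would force its whole row to vanish,
      so a nonzero row always offers a pivot.\<close>
    have "d \<noteq> 0"
    proof
      assume "d = 0"
      then have "(P $ i $ j)\<^sup>2 \<le> 0" for j
        using pos_semidef_mat_Cauchy_Schwarz[OF less.prems, of "axis i 1" "axis j 1"]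
        by (simp add: quad d_def)
      then show False using i by (simp add: vec_eq_iff)
    qed
    then have d: "d > 0" using pos[of "axis i 1"] by (simp add: quad d_def)
    \<comment> \<open>The pivot column, scaled so that \<open>outer v v\<close> agrees with
      \<open>P\<close> in row and column \<open>i\<close>; \<open>P'\<close> is then the Schur
      complement bordered by zeros.\<close>
    define v where "v = (1 / sqrt d) *\<^sub>R (P *v axis i 1)"
    define P' where "P' = P - outer v v"
    have vn: "v $ j = P $ j $ i / sqrt d" for j
      by (simp add: v_def matrix_vector_axis_nth)
    have "pos_semidef_mat P'"
      unfolding pos_semidef_mat_def
    proof (intro conjI allI)
      show "transpose P' = P'"
        using tr by (simp add: P'_def transpose_def outer_def vec_eq_iff mult_ac)
      fix x
      have "x \<bullet> (P' *v x) = x \<bullet> (P *v x) - (x \<bullet> v)\<^sup>2"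
        by (simp add: P'_def matrix_vector_mult_diff_rdistrib outer_mult_vec inner_diff_right
            inner_commute power2_eq_square)
      moreover have "(x \<bullet> v)\<^sup>2 = (x \<bullet> (P *v axis i 1))\<^sup>2 / d"
        using d by (simp add: v_def power_divide)
      moreover have "\<dots> \<le> x \<bullet> (P *v x)"
        using pos_semidef_mat_Cauchy_Schwarz[OF less.prems, of x "axis i 1"] d
        by (simp add: quad d_def divide_le_eq)
      ultimately show "0 \<le> x \<bullet> (P' *v x)" by simp
    qed
    \<comment> \<open>The measure of the induction is the number of nonzero rows: zero rows stay
      zero and row \<open>i\<close> becomes zero.\<close>
    moreover have "card {j. P' $ j \<noteq> 0} < card {j. P $ j \<noteq> 0}"
    proof (rule psubset_card_mono)
      have "P' $ j = 0" if "P $ j = 0" for j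
        using that by (simp add: P'_def vec_eq_iff outer_def vn)
      moreover have "P' $ i = 0"
      proof -
        have "P' $ i $ j = P $ i $ j - d * P $ j $ i / d" for j
          using d by (simp add: P'_def outer_def vn flip: d_def)
        then show ?thesis using d symP[of i] by (simp add: vec_eq_iff)
      qed
      ultimately show "{j. P' $ j \<noteq> 0} \<subset> {j. P $ j \<noteq> 0}" using i by blast
    qed simp
    ultimately obtain vs where vs: "P' = (\<Sum>v\<leftarrow>vs. outer v v)" using less.hyps by blast
    then have "P = (\<Sum>v\<leftarrow>(v # vs). outer v v)" by (simp add: P'_def algebra_simps)
    then show ?thesis by blast
  qed
qed

lemma
  assumes "invertible (P :: real^'n^'n)"
  shows matrix_inv_right: "P ** matrix_inv P = mat 1"
    and matrix_inv_left: "matrix_inv P ** P = mat 1"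
  using someI_ex[OF assms[unfolded invertible_def]] unfolding matrix_inv_def by blast+

lemma matrix_inv_unique:
  fixes P :: "real^'n^'n"
  assumes "P ** Q = mat 1"
  shows "matrix_inv P = Q"
proof -
  have "Q ** P = mat 1" using assms matrix_left_right_inverse by blast
  have "invertible P" using assms invertible_right_inverse by blast
  then have "matrix_inv P ** P = mat 1" by (rule matrix_inv_left)
  then show ?thesis using assms by (metis matrix_mul_assoc matrix_mul_lid matrix_mul_rid)
qed

lemma pos_def_mat_invertible:
  assumes "pos_def_mat (P :: real^'n^'n)"
  shows "invertible P"
proof -
  have "P *v x = 0 \<Longrightarrow> x = 0" for x
    using assms unfolding pos_def_mat_def by (metis inner_zero_right less_irrefl)
  then show ?thesis
    using invertible_left_inverse matrix_left_invertible_ker by blast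
qed

lemma pos_def_mat_inv:
  assumes "pos_def_mat (P :: real^'n^'n)"
  shows "pos_def_mat (matrix_inv P)"
proof -
  let ?Q = "matrix_inv P"
  note inv = pos_def_mat_invertible[OF assms]
  have PQ: "P ** ?Q = mat 1" using matrix_inv_right[OF inv] .
  have "transpose ?Q = ?Q"
  proof (rule matrix_inv_unique[symmetric])
    have "transpose (?Q ** P) = mat 1" using matrix_inv_left[OF inv] by (simp add: transpose_mat)
    then show "P ** transpose ?Q = mat 1"
      using assms by (simp add: matrix_transpose_mul pos_def_mat_def)
  qed
  moreover have "v \<bullet> (?Q *v v) > 0" if "v \<noteq> 0" for v
  proof -
    have e: "P *v (?Q *v v) = v" using PQ by (simp add: matrix_vector_mul_assoc)
    then have "?Q *v v \<noteq> 0" using that by auto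
    then have "(?Q *v v) \<bullet> (P *v (?Q *v v)) > 0" using assms unfolding pos_def_mat_def by blast
    then show ?thesis using e by (simp add: inner_commute)
  qed
  ultimately show ?thesis unfolding pos_def_mat_def by blast
qed

lemma pos_def_imp_semidef: "pos_def_mat P \<Longrightarrow> pos_semidef_mat P"
  unfolding pos_def_mat_def pos_semidef_mat_def by (metis inner_zero_left less_eq_real_def)

lemma matrix_add_rdistrib: "(A + B) ** C = A ** C + B ** C"
  for A B :: "real^'n^'m"
  by (simp add: matrix_matrix_mult_def vec_eq_iff sum.distrib distrib_right)

lemma trace_sum_list: "trace (\<Sum>v\<leftarrow>vs. f v) = (\<Sum>v\<leftarrow>vs. trace (f v))"
  for f :: "'a \<Rightarrow> real^'n^'n"
  by (induction vs) (auto simp: trace_def sum.distrib)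

lemma sum_list_matrix_mult: "(\<Sum>v\<leftarrow>vs. f v) ** M = (\<Sum>v\<leftarrow>vs. f v ** M)"
  for f :: "'a \<Rightarrow> real^'n^'n"
  by (induction vs) (auto simp: matrix_add_rdistrib)

text \<open>Writing the inverse metric as a sum of squares v v^T turns the trace into a sum of
  \<open>H\<close>-norms of the vectors J v, from which nonnegativity and the case of equality can
  be read off. The list \<open>vs\<close> plays the part of an orthonormal frame.\<close>

lemma trace_pullback_expand:
  fixes P :: "real^'m^'m" and J :: "real^'m^'n"
  assumes "P = (\<Sum>v\<leftarrow>vs. outer v v)"
  shows "trace (P ** (transpose J ** H ** J)) = (\<Sum>v\<leftarrow>vs. (J *v v) \<bullet> (H *v (J *v v)))"
proof -
  have "trace (outer v v ** (transpose J ** H ** J)) = (J *v v) \<bullet> (H *v (J *v v))" for v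
  proof -
    have "trace (outer v v ** (transpose J ** H ** J)) = v \<bullet> (transpose J *v (transpose H *v (J *v v)))"
      by (simp add: outer_matrix_mult trace_outer matrix_transpose_mul matrix_vector_mul_assoc matrix_mul_assoc)
    also have "\<dots> = (J *v v) \<bullet> (H *v (J *v v))"
      by (metis dot_lmul_matrix inner_commute transpose_matrix_vector transpose_transpose)
    finally show ?thesis .
  qed
  then show ?thesis unfolding assms sum_list_matrix_mult trace_sum_list by simp
qed

lemma trace_pullback_nonneg:
  fixes P :: "real^'m^'m" and J :: "real^'m^'n"
  assumes "pos_def_mat P" "pos_def_mat H"
  shows "trace (P ** (transpose J ** H ** J)) \<ge> 0"
proof -
  obtain vs where vs: "P = (\<Sum>v\<leftarrow>vs. outer v v)"
    using pos_semidef_mat_eq_sum_outer pos_def_imp_semidef assms by metis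
  have "pos_semidef_mat H" using assms pos_def_imp_semidef by blast
  then show ?thesis
    unfolding trace_pullback_expand[OF vs] by (auto simp: pos_semidef_mat_def intro!: sum_list_nonneg)
qed

lemma trace_pullback_eq_0:
  fixes P :: "real^'m^'m" and J :: "real^'m^'n"
  assumes "pos_def_mat P" "pos_def_mat H" "trace (P ** (transpose J ** H ** J)) = 0"
  shows "J = 0"
proof -
  obtain vs where vs: "P = (\<Sum>v\<leftarrow>vs. outer v v)"
    using pos_semidef_mat_eq_sum_outer pos_def_imp_semidef assms by metis
  have H: "pos_semidef_mat H" using assms pos_def_imp_semidef by blast
  have "\<forall>x\<in>set (map (\<lambda>v. (J *v v) \<bullet> (H *v (J *v v))) vs). x = 0"
    using assms(3) H unfolding trace_pullback_expand[OF vs]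
    by (subst (asm) sum_list_nonneg_eq_0_iff) (auto simp: pos_semidef_mat_def)
  then have "J *v v = 0" if "v \<in> set vs" for v
    using that assms(2) unfolding pos_def_mat_def by fastforce
  \<comment> \<open>\<open>J\<close> kills every \<open>v\<close> in the list, hence the range of
    \<open>P\<close>, which is the whole space because \<open>P\<close> is invertible.\<close>
  then have "J *v (P *v x) = 0" for x
    unfolding vs
    by (induction vs) (auto simp: matrix_vector_mult_add_rdistrib outer_mult_vec matrix_vector_right_distrib
        matrix_vector_mult_scaleR)
  then have "J *v x = 0" for x
    using matrix_inv_right[OF pos_def_mat_invertible[OF assms(1)]]
    by (metis matrix_vector_mul_assoc matrix_vector_mul_lid)
  then show ?thesis by (simp add: matrix_eq)
qed

text \<open>The segment from the identity to \<open>P\<close> consists of positive definite, hence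
  invertible, matrices. The determinant starts at 1 and cannot change sign without
  vanishing.\<close>

lemma pos_def_mat_det_pos:
  fixes P :: "real^'n^'n"
  assumes "pos_def_mat P"
  shows "det P > 0"
proof (rule ccontr)
  assume "\<not> det P > 0"
  define M where "M s = mat (1 - s) + s *\<^sub>R P" for s :: real
  have pd: "pos_def_mat (M s)" if "s \<in> {0..1}" for s
    unfolding pos_def_mat_def
  proof (intro conjI allI impI)
    show "transpose (M s) = M s"
      using assms by (simp add: M_def pos_def_mat_def transpose_def vec_eq_iff mat_def)
    fix v :: "real^'n" assume v: "v \<noteq> 0"
    have "mat (1 - s) *v v = (1 - s) *\<^sub>R v"
      by (simp add: mat_def matrix_vector_mult_def vec_eq_iff if_distrib[of "\<lambda>x. x * _"] cong: if_cong)
    then have "v \<bullet> (M s *v v) = (1 - s) * (v \<bullet> v) + s * (v \<bullet> (P *v v))"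
      by (simp add: M_def matrix_vector_mult_add_rdistrib scaleR_matrix_vector_assoc[symmetric] inner_add_right)
    moreover have "v \<bullet> v > 0" "v \<bullet> (P *v v) > 0" using v assms by (auto simp: pos_def_mat_def)
    ultimately show "v \<bullet> (M s *v v) > 0"
      using that by (cases "s = 0") (auto intro!: add_nonneg_pos)
  qed
  have "continuous_on {0..1} (\<lambda>s. det (M s))"
  proof -
    have "continuous_on {0..1} (\<lambda>s. M s $ i $ j)" for i j
      by (cases "i = j") (auto simp: M_def mat_def intro!: continuous_intros)
    then show ?thesis
      unfolding det_def by (intro continuous_on_sum continuous_on_mult continuous_on_const continuous_on_prod)
  qed
  moreover have "det (M 1) \<le> 0" "det (M 0) = 1"
  proof -
    have "M 1 = P" "M 0 = mat 1" by (auto simp: M_def vec_eq_iff mat_def)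
    then show "det (M 1) \<le> 0" "det (M 0) = 1" using \<open>\<not> det P > 0\<close> by auto
  qed
  ultimately obtain s where "s \<in> {0..1}" "det (M s) = 0"
    using IVT2'[of "\<lambda>s. det (M s)" 1 0 0] by auto
  then show False
    using pos_def_mat_invertible[OF pd] invertible_det_nz by blast
qed

section \<open>Continuity of matrix operations\<close>

lemma continuous_on_det:
  fixes M :: "'a::topological_space \<Rightarrow> real^'n^'n"
  assumes "continuous_on S M"
  shows "continuous_on S (\<lambda>x. det (M x))"
  unfolding det_def by (intro continuous_intros assms)

lemma continuous_on_matrix_mult:
  fixes M :: "'a::topological_space \<Rightarrow> real^'n^'m" and N :: "'a \<Rightarrow> real^'k^'n"
  assumes "continuous_on S M" "continuous_on S N"
  shows "continuous_on S (\<lambda>x. M x ** N x)"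
  unfolding matrix_matrix_mult_def by (intro continuous_intros assms)

lemma continuous_on_transpose:
  fixes M :: "'a::topological_space \<Rightarrow> real^'n^'m"
  assumes "continuous_on S M"
  shows "continuous_on S (\<lambda>x. transpose (M x))"
  unfolding transpose_def by (intro continuous_intros assms)

lemma continuous_on_trace:
  fixes M :: "'a::topological_space \<Rightarrow> real^'n^'n"
  assumes "continuous_on S M"
  shows "continuous_on S (\<lambda>x. trace (M x))"
  unfolding trace_def by (intro continuous_intros assms)

text \<open>Cramer's rule expresses the entries of the inverse as quotients of determinants, which
  are continuous.\<close>

lemma continuous_on_matrix_inv:
  fixes M :: "'a::topological_space \<Rightarrow> real^'n^'n"
  assumes "continuous_on S M" "\<And>x. x \<in> S \<Longrightarrow> invertible (M x)"
  shows "continuous_on S (\<lambda>x. matrix_inv (M x))"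
proof -
  let ?C = "\<lambda>x. \<chi> k l. det (\<chi> i j. if j = k then (axis l 1 :: real^'n) $ i else M x $ i $ j) / det (M x)"
  have "matrix_inv (M x) = ?C x" if "x \<in> S" for x
  proof -
    have d: "det (M x) \<noteq> 0" using assms(2)[OF that] invertible_det_nz by blast
    have "M x *v (matrix_inv (M x) *v axis l 1) = axis l 1" for l
      using matrix_inv_right[OF assms(2)[OF that]] by (simp add: matrix_vector_mul_assoc)
    then have "matrix_inv (M x) *v axis l 1 =
        (\<chi> k. det (\<chi> i j. if j = k then (axis l 1 :: real^'n) $ i else M x $ i $ j) / det (M x))" for l
      using cramer[OF d] by blast
    then show ?thesis
      by (simp add: vec_eq_iff flip: matrix_vector_axis_nth)
  qed
  moreover have "continuous_on S ?C"
  proof (intro continuous_on_vec_lambda continuous_on_divide continuous_on_det assms(1))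
    show "continuous_on S (\<lambda>x. if j = k then (axis l 1 :: real^'n) $ i else M x $ i $ j)" for i j k l
      using assms(1) by (cases "j = k") (auto intro!: continuous_intros)
  qed (use assms(2) invertible_det_nz in auto)
  ultimately show ?thesis by (simp cong: continuous_on_cong)
qed

section \<open>Change of variables and the Riemannian volume\<close>

text \<open>The change of variables formula of the library needs a well-ordered index type; every
  finite type has a well-ordered copy.\<close>

typedef 'a wo_copy = "UNIV :: 'a set"
  morphisms of_wo to_wo by blast

lemma of_wo_to_wo [simp]: "of_wo (to_wo x) = x"
  by (simp add: to_wo_inverse)

lemma to_wo_of_wo [simp]: "to_wo (of_wo x) = x"
  by (rule of_wo_inverse)

lemma bij_to_wo: "bij to_wo"
  by (rule bij_betw_byWitness[where f' = of_wo]) auto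

instance wo_copy :: (finite) finite
proof
  have "range to_wo = (UNIV :: 'a wo_copy set)" by (rule bij_is_surj[OF bij_to_wo])
  moreover have "finite (range (to_wo :: 'a \<Rightarrow> 'a wo_copy))" by (rule finite_imageI) simp
  ultimately show "finite (UNIV :: 'a wo_copy set)" by simp
qed

instantiation wo_copy :: (finite) wellorder
begin

definition "x \<le> y \<longleftrightarrow> to_nat (of_wo x) \<le> to_nat (of_wo y)"
definition "x < y \<longleftrightarrow> to_nat (of_wo x) < to_nat (of_wo y)"

instance
proof
  fix x y :: "'a wo_copy"
  show "x \<le> y \<Longrightarrow> y \<le> x \<Longrightarrow> x = y"
    by (metis antisym less_eq_wo_copy_def of_wo_inverse injD inj_to_nat)
next
  fix P :: "'a wo_copy \<Rightarrow> bool" and a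
  assume "\<And>x. (\<And>y. y < x \<Longrightarrow> P y) \<Longrightarrow> P x"
  then show "P a"
    using measure_induct[of "\<lambda>x. to_nat (of_wo x)" P a] unfolding less_wo_copy_def by blast
qed (auto simp: less_eq_wo_copy_def less_wo_copy_def)

end

definition vec_to_wo :: "real^'m \<Rightarrow> real^('m wo_copy)" where
  "vec_to_wo x = (\<chi> i. x $ of_wo i)"

definition vec_of_wo :: "real^('m wo_copy) \<Rightarrow> real^'m" where
  "vec_of_wo x = (\<chi> i. x $ to_wo i)"

lemma vec_to_of_wo [simp]: "vec_to_wo (vec_of_wo x) = x" "vec_of_wo (vec_to_wo y) = y"
  by (simp_all add: vec_to_wo_def vec_of_wo_def)

lemma bounded_linear_vec_to_wo: "bounded_linear vec_to_wo"
  by (simp add: vec_to_wo_def linear_conv_bounded_linear[symmetric] linear_iff vec_eq_iff)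

lemma bounded_linear_vec_of_wo: "bounded_linear vec_of_wo"
  by (simp add: vec_of_wo_def linear_conv_bounded_linear[symmetric] linear_iff vec_eq_iff)

lemma measurable_vec_of_wo [measurable]: "vec_of_wo \<in> borel_measurable borel"
  by (intro borel_measurable_continuous_onI bounded_linear.continuous_on[OF bounded_linear_vec_of_wo]
      continuous_on_id)

lemma Basis_vec_real: "(Basis :: (real^'m) set) = range (\<lambda>i. axis i 1)"
  by (auto simp: Basis_vec_def)

lemma prod_Basis_vec: "(\<Prod>b\<in>Basis. (v :: real^'m) \<bullet> b) = (\<Prod>i\<in>UNIV. v $ i)"
  unfolding Basis_vec_real
  by (subst prod.reindex) (auto simp: inner_axis inj_on_def axis_eq_axis)

text \<open>Lebesgue measure is determined by its values on boxes, and renaming coordinates only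
  permutes the side lengths.\<close>

lemma distr_vec_of_wo: "distr lborel borel (vec_of_wo :: _ \<Rightarrow> real^'m) = lborel"
proof (rule lborel_eqI[symmetric])
  fix l u :: "real^'m" assume le: "\<And>b. b \<in> Basis \<Longrightarrow> l \<bullet> b \<le> u \<bullet> b"
  have lu: "l $ i \<le> u $ i" for i using le[of "axis i 1"] by (simp add: inner_axis)
  have v: "vec_of_wo -` box l u = box (vec_to_wo l) (vec_to_wo u)"
    by (auto simp: mem_box_cart vec_of_wo_def vec_to_wo_def) (metis of_wo_to_wo to_wo_of_wo)+
  have "emeasure lborel (box (vec_to_wo l) (vec_to_wo u)) = (\<Prod>b\<in>Basis. (vec_to_wo u - vec_to_wo l) \<bullet> b)"
    using lu by (intro emeasure_lborel_box) (auto simp: Basis_vec_real inner_axis vec_to_wo_def)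
  also have "(\<Prod>b\<in>Basis. (vec_to_wo u - vec_to_wo l) \<bullet> b) = (\<Prod>i\<in>UNIV. (u - l) $ of_wo i)"
    unfolding prod_Basis_vec by (simp add: vec_to_wo_def)
  also have "\<dots> = (\<Prod>i\<in>UNIV. (u - l) $ i)"
    by (rule prod.reindex_bij_witness[of _ to_wo of_wo]) auto
  finally show "emeasure (distr lborel borel vec_of_wo) (box l u) = (\<Prod>b\<in>Basis. (u - l) \<bullet> b)"
    by (simp add: emeasure_distr v prod_Basis_vec)
qed simp

text \<open>In the Leibniz formula, conjugation by \<open>to_wo\<close> is a sign-preserving
  bijection between the permutations of the two index types.\<close>

lemma det_to_wo: "det (\<chi> i j. (M :: real^'m^'m) $ of_wo i $ of_wo j) = det M"
proof -
  let ?f = "map_permutation UNIV (to_wo :: 'm \<Rightarrow> _)"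
  have f: "?f p = to_wo \<circ> p \<circ> of_wo" for p
  proof -
    have "inv_into UNIV (to_wo :: 'm \<Rightarrow> _) = of_wo"
      using bij_to_wo by (auto simp: fun_eq_iff bij_def intro!: inv_f_eq)
    then show ?thesis
      using bij_to_wo by (auto simp: map_permutation_def restrict_id_def fun_eq_iff bij_def)
  qed
  have bij: "bij_betw ?f {p. p permutes UNIV} {p. p permutes UNIV}"
  proof (rule bij_betw_byWitness[where f' = "map_permutation UNIV of_wo"])
    have g: "map_permutation UNIV of_wo p = of_wo \<circ> p \<circ> to_wo" for p :: "'m wo_copy \<Rightarrow> 'm wo_copy"
    proof -
      have "bij (of_wo :: 'm wo_copy \<Rightarrow> 'm)" by (rule bij_betw_byWitness[where f' = to_wo]) auto
      moreover have "inv_into UNIV (of_wo :: 'm wo_copy \<Rightarrow> 'm) = to_wo"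
        using calculation by (auto simp: fun_eq_iff bij_def intro!: inv_f_eq)
      ultimately show ?thesis
        by (auto simp: map_permutation_def restrict_id_def fun_eq_iff bij_def)
    qed
    show "\<forall>a\<in>{p. p permutes UNIV}. map_permutation UNIV of_wo (?f a) = a"
      "\<forall>a\<in>{p. p permutes UNIV}. ?f (map_permutation UNIV of_wo a) = a"
      by (auto simp: f g fun_eq_iff)
    show "?f ` {p. p permutes UNIV} \<subseteq> {p. p permutes UNIV}"
      using map_permutation_permutes[OF bij_to_wo] by auto
    show "map_permutation UNIV of_wo ` {p. p permutes UNIV} \<subseteq> {p. p permutes (UNIV :: 'm set)}"
      by (intro image_subsetI CollectI map_permutation_permutes)
         (auto intro: bij_betw_byWitness[where f' = to_wo])
  qed
  have inj: "inj (to_wo :: 'm \<Rightarrow> _)" by (rule bij_is_inj[OF bij_to_wo])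
  show ?thesis
    unfolding det_def
    by (subst sum.reindex_bij_betw[OF bij, symmetric], intro sum.cong refl arg_cong2[of _ _ _ _ "(*)"])
       (auto simp: sign_map_permutation[OF inj, unfolded f] f
         intro!: prod.reindex_bij_witness[of _ to_wo of_wo])
qed

text \<open>Bridge between the gauge integral, in which the change of variables is formulated, and
  the nonnegative Lebesgue integral, in which the volume is defined. It concerns finite values
  \<open>r\<close> only.\<close>

lemma absolutely_integrable_eq_iff_nn_integral:
  fixes u :: "'a::euclidean_space \<Rightarrow> real"
  assumes u: "\<And>x. x \<in> S \<Longrightarrow> 0 \<le> u x"
    and m: "(\<lambda>x. ennreal (u x) * indicator S x) \<in> borel_measurable borel" and r: "0 \<le> r"
  shows "u absolutely_integrable_on S \<and> integral S u = r \<longleftrightarrow>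
    (\<integral>\<^sup>+x. ennreal (u x) * indicator S x \<partial>lborel) = ennreal r"
proof -
  let ?v = "\<lambda>x. if x \<in> S then u x else 0"
  have v: "ennreal (?v x) = ennreal (u x) * indicator S x" for x by simp
  have "?v = (\<lambda>x. enn2real (ennreal (u x) * indicator S x))"
    using u by (auto simp: fun_eq_iff)
  then have vm: "?v \<in> borel_measurable borel" using m by simp
  have "u absolutely_integrable_on S \<and> integral S u = r \<longleftrightarrow> (u has_integral r) S"
    using nonnegative_absolutely_integrable_1[of u S] u
    by (metis has_integral_integrable integrable_integral integral_unique
        set_lebesgue_integral_eq_integral(1))
  also have "\<dots> \<longleftrightarrow> (?v has_integral r) UNIV" by (rule has_integral_restrict_UNIV[symmetric])
  also have "\<dots> \<longleftrightarrow> (\<integral>\<^sup>+x. ennreal (?v x) \<partial>lborel) = ennreal r"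
    using vm r u
    by (subst has_integral_iff_nn_integral_lebesgue) (auto simp: nn_integral_completion measurable_completion)
  finally show ?thesis unfolding v .
qed

lemma nn_integral_change_of_variables_wo:
  fixes T :: "real^'m::{finite,wellorder} \<Rightarrow> real^'m::_" and f :: "real^'m::_ \<Rightarrow> real"
  assumes S: "S \<in> sets borel"
    and der: "\<And>x. x \<in> S \<Longrightarrow> (T has_derivative T' x) (at x)" and inj: "inj_on T S"
    and nonneg: "\<And>y. y \<in> T ` S \<Longrightarrow> 0 \<le> f y"
    and m1: "(\<lambda>y. ennreal (f y) * indicator (T ` S) y) \<in> borel_measurable borel"
    and m2: "(\<lambda>x. ennreal (\<bar>det (matrix (T' x))\<bar> * f (T x)) * indicator S x) \<in> borel_measurable borel"
  shows "(\<integral>\<^sup>+x. ennreal (\<bar>det (matrix (T' x))\<bar> * f (T x)) * indicator S x \<partial>lborel) =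
    (\<integral>\<^sup>+y. ennreal (f y) * indicator (T ` S) y \<partial>lborel)" (is "?L = ?R")
proof -
  let ?a = "\<lambda>x. \<bar>det (matrix (T' x))\<bar> * f (T x)"
  have cov: "?a absolutely_integrable_on S \<and> integral S ?a = r \<longleftrightarrow>
      f absolutely_integrable_on (T ` S) \<and> integral (T ` S) f = r" for r
  proof -
    have "S \<in> sets lebesgue" using S by simp
    moreover have "(T has_derivative T' x) (at x within S)" if "x \<in> S" for x
      using der[OF that] has_derivative_at_withinI by blast
    \<comment> \<open>The formula concerns vector-valued integrands, so \<open>f\<close> enters as a
      map into \<open>real^1\<close>.\<close>
    ultimately show ?thesis
      using has_absolute_integral_change_of_variables[of S T T' "\<lambda>x. (\<chi> i. f x) :: real^1" "\<chi> i. r"] inj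
      by (simp add: absolutely_integrable_on_1_iff integral_on_1_eq vec_eq_iff)
  qed
  have "?L = ennreal r \<longleftrightarrow> ?R = ennreal r" if "0 \<le> r" for r
    using absolutely_integrable_eq_iff_nn_integral[OF _ m2 that]
      absolutely_integrable_eq_iff_nn_integral[OF nonneg m1 that] nonneg cov[of r] by auto
  \<comment> \<open>Both integrals attain the same finite values, so they agree as soon as one is
    finite; otherwise both are infinite.\<close>
  then have *: "?L = z \<longleftrightarrow> ?R = z" if "z < \<infinity>" for z
    using that by (cases z) auto
  show ?thesis
  proof (cases "?L < \<infinity> \<or> ?R < \<infinity>")
    case True
    then show ?thesis using *[of ?L] *[of ?R] by metis
  next
    case False
    then show ?thesis by (simp add: less_top[symmetric])
  qed
qed

text \<open>Conjugating \<open>T\<close> by the renaming of coordinates alters neither Lebesgue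
  measure nor the Jacobian determinant, so the well-ordered case carries over.\<close>

lemma nn_integral_change_of_variables:
  fixes T :: "real^'m \<Rightarrow> real^'m" and f :: "real^'m \<Rightarrow> real"
  assumes S: "S \<in> sets borel"
    and der: "\<And>x. x \<in> S \<Longrightarrow> (T has_derivative T' x) (at x)" and inj: "inj_on T S"
    and nonneg: "\<And>y. y \<in> T ` S \<Longrightarrow> 0 \<le> f y"
    and m1: "(\<lambda>y. ennreal (f y) * indicator (T ` S) y) \<in> borel_measurable borel"
    and m2: "(\<lambda>x. ennreal (\<bar>det (matrix (T' x))\<bar> * f (T x)) * indicator S x) \<in> borel_measurable borel"
  shows "(\<integral>\<^sup>+x. ennreal (\<bar>det (matrix (T' x))\<bar> * f (T x)) * indicator S x \<partial>lborel) =
    (\<integral>\<^sup>+y. ennreal (f y) * indicator (T ` S) y \<partial>lborel)"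
proof -
  define U where "U z = vec_to_wo (T (vec_of_wo z))" for z
  define U' where "U' z v = vec_to_wo (T' (vec_of_wo z) (vec_of_wo v))" for z v
  define f' where "f' z = f (vec_of_wo z)" for z
  define S' where "S' = vec_of_wo -` S"
  have tr: "(\<integral>\<^sup>+x. F x \<partial>lborel) = (\<integral>\<^sup>+z. F (vec_of_wo z) \<partial>lborel)"
    if "F \<in> borel_measurable borel" for F :: "real^'m \<Rightarrow> ennreal"
    using that by (subst distr_vec_of_wo[symmetric], subst nn_integral_distr) auto
  have det: "det (matrix (U' z)) = det (matrix (T' (vec_of_wo z)))" for z
  proof -
    have "vec_of_wo (axis j 1) = axis (of_wo j) 1" for j :: "'m wo_copy"
      by (auto simp: vec_of_wo_def axis_def vec_eq_iff)
    then have "matrix (U' z) = (\<chi> i j. matrix (T' (vec_of_wo z)) $ of_wo i $ of_wo j)"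
      by (simp add: matrix_def U'_def vec_to_wo_def)
    then show ?thesis by (simp add: det_to_wo)
  qed
  have TS: "indicator (U ` S') z = (indicator (T ` S) (vec_of_wo z) :: ennreal)" for z
  proof -
    have "z \<in> U ` S' \<longleftrightarrow> vec_of_wo z \<in> T ` S"
    proof
      assume "vec_of_wo z \<in> T ` S"
      then obtain x where x: "x \<in> S" "vec_of_wo z = T x" by blast
      then have "vec_to_wo x \<in> S'" "U (vec_to_wo x) = z"
        by (simp_all add: S'_def U_def flip: x(2))
      then show "z \<in> U ` S'" by blast
    qed (auto simp: U_def S'_def)
    then show ?thesis by (simp add: indicator_def)
  qed
  have SS: "indicator S' z = (indicator S (vec_of_wo z) :: ennreal)" for z
    by (simp add: S'_def indicator_def)
  have "(\<integral>\<^sup>+z. ennreal (\<bar>det (matrix (U' z))\<bar> * f' (U z)) * indicator S' z \<partial>lborel) =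
    (\<integral>\<^sup>+z. ennreal (f' z) * indicator (U ` S') z \<partial>lborel)"
  proof (rule nn_integral_change_of_variables_wo)
    show "S' \<in> sets borel"
      unfolding S'_def using measurable_sets_borel[OF measurable_vec_of_wo S] by simp
    show "(U has_derivative U' z) (at z)" if "z \<in> S'" for z
      unfolding U_def U'_def
      by (rule bounded_linear.has_derivative[OF bounded_linear_vec_to_wo
            has_derivative_compose[OF bounded_linear_imp_has_derivative[OF bounded_linear_vec_of_wo] der]])
         (use that in \<open>simp add: S'_def\<close>)
    show "inj_on U S'"
      using inj unfolding inj_on_def U_def S'_def by (metis vec_to_of_wo vimageE)
    show "0 \<le> f' y" if "y \<in> U ` S'" for y
      using nonneg that by (auto simp: f'_def U_def S'_def)
    show "(\<lambda>y. ennreal (f' y) * indicator (U ` S') y) \<in> borel_measurable borel"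
      unfolding TS f'_def using measurable_compose[OF measurable_vec_of_wo m1] .
    show "(\<lambda>x. ennreal (\<bar>det (matrix (U' x))\<bar> * f' (U x)) * indicator S' x) \<in> borel_measurable borel"
      unfolding SS f'_def U_def det using measurable_compose[OF measurable_vec_of_wo m2] by simp
  qed
  then show ?thesis
    unfolding tr[OF m1] tr[OF m2] SS TS det by (simp add: U_def f'_def)
qed

section \<open>Charts and their images of open and Borel sets\<close>

lemma chart_inv_chart: "is_chart c \<Longrightarrow> p \<in> fst c \<Longrightarrow> chart_inv c (snd c p) = p"
  unfolding is_chart_def homeomorphism_def by blast

lemma chart_chart_inv: "is_chart c \<Longrightarrow> x \<in> snd c ` fst c \<Longrightarrow> snd c (chart_inv c x) = x"
  unfolding is_chart_def homeomorphism_def by blast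

lemma chart_inv_mem: "is_chart c \<Longrightarrow> x \<in> snd c ` fst c \<Longrightarrow> chart_inv c x \<in> fst c"
  unfolding is_chart_def homeomorphism_def by blast

lemma open_chart_domain: "is_chart c \<Longrightarrow> open (fst c)"
  and open_chart_range: "is_chart c \<Longrightarrow> open (snd c ` fst c)"
  and continuous_on_chart: "is_chart c \<Longrightarrow> continuous_on (fst c) (snd c)"
  and continuous_on_chart_inv: "is_chart c \<Longrightarrow> continuous_on (snd c ` fst c) (chart_inv c)"
  unfolding is_chart_def homeomorphism_def by blast+

lemma chart_image_eq:
  "is_chart c \<Longrightarrow> S \<subseteq> fst c \<Longrightarrow> snd c ` S = chart_inv c -` S \<inter> snd c ` fst c"
  using chart_inv_chart chart_chart_inv by (fastforce simp: image_iff)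

lemma open_chart_image:
  assumes "is_chart c" "open S" "S \<subseteq> fst c"
  shows "open (snd c ` S)"
  unfolding chart_image_eq[OF assms(1,3)]
  using continuous_on_open_vimage[OF open_chart_range[OF assms(1)]] continuous_on_chart_inv[OF assms(1)] assms(2)
  by blast

lemma open_chart_inv_image:
  assumes "is_chart c" "open T" "T \<subseteq> snd c ` fst c"
  shows "open (chart_inv c ` T)"
proof -
  have "chart_inv c ` T = snd c -` T \<inter> fst c"
    using assms chart_inv_chart[OF assms(1)] chart_chart_inv[OF assms(1)] chart_inv_mem[OF assms(1)]
    by (fastforce simp: image_iff)
  then show ?thesis
    using continuous_on_open_vimage[OF open_chart_domain[OF assms(1)]] continuous_on_chart[OF assms(1)] assms(2)
    by metis
qed

lemma inj_on_chart: "is_chart c \<Longrightarrow> inj_on (snd c) (fst c)"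
  by (metis chart_inv_chart inj_on_inverseI)

lemma sets_borel_chart_image:
  assumes "is_chart c" "S \<in> sets borel" "S \<subseteq> fst c"
  shows "snd c ` S \<in> sets borel"
proof -
  have "chart_inv c \<in> borel_measurable (restrict_space borel (snd c ` fst c))"
    by (intro borel_measurable_continuous_on_restrict continuous_on_chart_inv assms(1))
  then have "chart_inv c -` S \<inter> (snd c ` fst c) \<in> sets (restrict_space borel (snd c ` fst c))"
    using measurable_sets[OF _ assms(2), of "chart_inv c" "restrict_space borel (snd c ` fst c)"]
    by (simp add: space_restrict_space)
  then show ?thesis
    unfolding chart_image_eq[OF assms(1,3)]
    using open_chart_range[OF assms(1)] by (simp add: sets_restrict_space_iff)
qed

lemma is_chart_atlas: "smooth_atlas A \<Longrightarrow> c \<in> A \<Longrightarrow> is_chart c"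
  unfolding smooth_atlas_def by blast

lemma smooth_atlas_cover: "smooth_atlas A \<Longrightarrow> \<exists>c\<in>A. p \<in> fst c"
  unfolding smooth_atlas_def by blast

lemma chart_at_works:
  assumes "smooth_atlas A"
  shows "chart_at A p \<in> A" "p \<in> fst (chart_at A p)"
  using someI_ex[of "\<lambda>c. c \<in> A \<and> p \<in> fst c"] smooth_atlas_cover[OF assms, of p]
  unfolding chart_at_def by blast+

lemma smooth_on_transition:
  "smooth_atlas A \<Longrightarrow> c \<in> A \<Longrightarrow> d \<in> A \<Longrightarrow> smooth_on (snd c ` (fst c \<inter> fst d)) (chart_rep c d id)"
  unfolding smooth_atlas_def by blast

lemma riemannian_metric_pos_def:
  "riemannian_metric A g \<Longrightarrow> c \<in> A \<Longrightarrow> p \<in> fst c \<Longrightarrow> pos_def_mat (g c p)"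
  unfolding riemannian_metric_def pos_def_mat_def by blast

lemma riemannian_metric_transform:
  "riemannian_metric A g \<Longrightarrow> c \<in> A \<Longrightarrow> d \<in> A \<Longrightarrow> p \<in> fst c \<Longrightarrow> p \<in> fst d \<Longrightarrow>
    g c p = transpose (jacobian c d id p) ** g d p ** jacobian c d id p"
  unfolding riemannian_metric_def by blast

lemma riemannian_metric_smooth:
  "riemannian_metric A g \<Longrightarrow> c \<in> A \<Longrightarrow> smooth_on (snd c ` fst c) (\<lambda>x. g c (chart_inv c x))"
  unfolding riemannian_metric_def smooth_components_def o_def by blast

lemma riemannian_manifold_atlas: "riemannian_manifold A g \<Longrightarrow> smooth_atlas A"
  and riemannian_manifold_metric: "riemannian_manifold A g \<Longrightarrow> riemannian_metric A g"
  unfolding riemannian_manifold_def by blast+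

section \<open>Existence and uniqueness of the Riemannian volume\<close>

definition chart_density where
  "chart_density g c x = sqrt (det (g c (chart_inv c x) :: real^'m^'m))"

definition chart_volume where
  "chart_volume g c S = (\<integral>\<^sup>+x. ennreal (chart_density g c x) * indicator (snd c ` S) x \<partial>lborel)"

lemma chart_density_pos:
  assumes "riemannian_manifold A g" "c \<in> A" "x \<in> snd c ` fst c"
  shows "chart_density g c x > 0"
  using assms pos_def_mat_det_pos riemannian_metric_pos_def chart_inv_mem is_chart_atlas
  unfolding chart_density_def riemannian_manifold_def by (metis real_sqrt_gt_0_iff)

lemma continuous_on_chart_density:
  assumes "riemannian_manifold A g" "c \<in> A"
  shows "continuous_on (snd c ` fst c) (chart_density g c)"
  unfolding chart_density_def
  using smooth_on_imp_continuous_on[OF riemannian_metric_smooth[OF riemannian_manifold_metric[OF assms(1)] assms(2)]]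
  by (intro continuous_intros continuous_on_det)

lemma measurable_chart_density:
  assumes "riemannian_manifold A g" "c \<in> A" "S \<in> sets borel" "S \<subseteq> fst c"
  shows "(\<lambda>x. ennreal (chart_density g c x) * indicator (snd c ` S) x) \<in> borel_measurable borel"
proof -
  have "(\<lambda>x. indicator (snd c ` S) x *\<^sub>R chart_density g c x) \<in> borel_measurable borel"
    using assms
    by (intro borel_measurable_continuous_on_indicator sets_borel_chart_image is_chart_atlas
        continuous_on_subset[OF continuous_on_chart_density[OF assms(1,2)]])
       (auto dest: riemannian_manifold_atlas)
  moreover have "ennreal (chart_density g c x) * indicator (snd c ` S) x =
      ennreal (indicator (snd c ` S) x *\<^sub>R chart_density g c x)" for x
    by (simp add: indicator_def)
  ultimately show ?thesis by simp
qed

lemma chart_rep_chart: "is_chart c \<Longrightarrow> p \<in> fst c \<Longrightarrow> chart_rep c d f (snd c p) = snd d (f p)"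
  by (simp add: chart_rep_def chart_inv_chart)

text \<open>From g = K^T g' K it follows that sqrt (det g) = |det K| sqrt (det g'), and |det K| is
  exactly the factor that the change of variables produces.\<close>

lemma chart_volume_change:
  assumes M: "riemannian_manifold A g" and c: "c \<in> A" and d: "d \<in> A"
    and S: "S \<in> sets borel" "S \<subseteq> fst c" "S \<subseteq> fst d"
  shows "chart_volume g c S = chart_volume g d S"
proof -
  note At = riemannian_manifold_atlas[OF M] and Me = riemannian_manifold_metric[OF M]
  note ch = is_chart_atlas[OF At c] is_chart_atlas[OF At d]
  let ?T = "chart_rep c d id"
  let ?T' = "\<lambda>x. frechet_derivative ?T (at x)"
  have im: "?T ` (snd c ` S) = snd d ` S"
    using S chart_rep_chart[OF ch(1), of _ d id] by (force simp: image_iff)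
  have dens: "\<bar>det (matrix (?T' x))\<bar> * chart_density g d (?T x) = chart_density g c x"
    if "x \<in> snd c ` S" for x
  proof -
    obtain p where p: "p \<in> S" "x = snd c p" using \<open>x \<in> snd c ` S\<close> by auto
    have "matrix (?T' x) = jacobian c d id p" by (simp add: jacobian_def p)
    moreover have "det (g c p) = (det (jacobian c d id p))\<^sup>2 * det (g d p)"
      using p S by (subst riemannian_metric_transform[OF Me c d, of p])
        (auto simp: det_mul det_transpose power2_eq_square)
    moreover have "chart_inv c x = p" "chart_inv d (?T x) = p"
      using p S chart_inv_chart[OF ch(1)] chart_inv_chart[OF ch(2)] chart_rep_chart[OF ch(1), of _ d id]
      by (auto simp: subset_iff)
    ultimately show ?thesis
      by (simp add: chart_density_def real_sqrt_mult)
  qed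
  then have e: "ennreal (\<bar>det (matrix (?T' x))\<bar> * chart_density g d (?T x)) * indicator (snd c ` S) x =
      ennreal (chart_density g c x) * indicator (snd c ` S) x" for x
    by (simp add: indicator_def)
  have "(\<integral>\<^sup>+x. ennreal (\<bar>det (matrix (?T' x))\<bar> * chart_density g d (?T x)) * indicator (snd c ` S) x \<partial>lborel) =
    (\<integral>\<^sup>+y. ennreal (chart_density g d y) * indicator (?T ` (snd c ` S)) y \<partial>lborel)"
  proof (rule nn_integral_change_of_variables)
    show "snd c ` S \<in> sets borel" by (rule sets_borel_chart_image[OF ch(1) S(1,2)])
    show "(?T has_derivative ?T' x) (at x)" if "x \<in> snd c ` S" for x
      using smooth_on_has_derivative[OF smooth_on_transition[OF At c d]] that S by blast
    show "inj_on ?T (snd c ` S)"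
    proof (rule inj_onI)
      fix x y assume "x \<in> snd c ` S" "y \<in> snd c ` S" and eq: "?T x = ?T y"
      then obtain p q where pq: "p \<in> S" "q \<in> S" "x = snd c p" "y = snd c q" by auto
      then have "snd d p = snd d q"
        using eq S(2) chart_rep_chart[OF ch(1), of _ d id] by (simp add: subset_iff)
      then show "x = y" using pq S(3) inj_onD[OF inj_on_chart[OF ch(2)], of p q] by (simp add: subset_iff)
    qed
    show "0 \<le> chart_density g d y" if "y \<in> ?T ` snd c ` S" for y
      using that S chart_density_pos[OF M d] unfolding im by (meson image_mono less_imp_le subsetD)
    show "(\<lambda>y. ennreal (chart_density g d y) * indicator (?T ` snd c ` S) y) \<in> borel_measurable borel"
      unfolding im by (rule measurable_chart_density[OF M d S(1,3)])
    show "(\<lambda>x. ennreal (\<bar>det (matrix (?T' x))\<bar> * chart_density g d (?T x)) * indicator (snd c ` S) x)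
        \<in> borel_measurable borel"
      unfolding e by (rule measurable_chart_density[OF M c S(1,2)])
  qed
  then show ?thesis unfolding e im chart_volume_def .
qed

lemma chart_volume_suminf:
  assumes M: "riemannian_manifold A g" and c: "c \<in> A"
    and F: "range F \<subseteq> sets borel" "disjoint_family F" "\<And>n. F n \<subseteq> fst c"
  shows "(\<Sum>n. chart_volume g c (F n)) = chart_volume g c (\<Union>n. F n)"
proof -
  have ch: "is_chart c" using is_chart_atlas riemannian_manifold_atlas M c by blast
  have "disjoint_family (\<lambda>n. snd c ` F n)"
    unfolding disjoint_family_on_def
  proof (intro ballI impI)
    fix m n :: nat assume "m \<noteq> n"
    then have "F m \<inter> F n = {}" using F(2) by (simp add: disjoint_family_on_def)
    then show "snd c ` F m \<inter> snd c ` F n = {}"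
      using inj_on_image_Int[OF inj_on_chart[OF ch] F(3)[of m] F(3)[of n]] by simp
  qed
  then have "(\<Sum>n. ennreal (chart_density g c x) * indicator (snd c ` F n) x) =
      ennreal (chart_density g c x) * indicator (snd c ` (\<Union>n. F n)) x" for x
    by (simp add: image_UN suminf_indicator)
  then show ?thesis
    unfolding chart_volume_def
    using nn_integral_suminf[of "\<lambda>n x. ennreal (chart_density g c x) * indicator (snd c ` F n) x" lborel]
      measurable_chart_density[OF M c _ F(3)] F(1)
    by (simp add: range_subsetD)
qed

lemma finite_chart_cover:
  fixes A :: "('p::topological_space, 'e::euclidean_space) chart set"
  assumes "smooth_atlas A" "compact (UNIV :: 'p set)"
  obtains C where "finite C" "C \<subseteq> A" "\<Union> (fst ` C) = UNIV"
proof -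
  have "\<And>U. U \<in> fst ` A \<Longrightarrow> open U"
    using assms(1) is_chart_atlas open_chart_domain by blast
  moreover have "UNIV \<subseteq> \<Union> (fst ` A)" using assms(1) unfolding smooth_atlas_def by blast
  ultimately obtain D where "D \<subseteq> fst ` A" "finite D" "UNIV \<subseteq> \<Union> D"
    using compactE[OF assms(2)] by metis
  moreover from this obtain C where "C \<subseteq> A" "finite C" "D = fst ` C"
    using finite_subset_image by metis
  ultimately show ?thesis using that[of C] by blast
qed

text \<open>Disjoint Borel pieces, each inside one chart, let additivity reduce statements on the
  volume of an arbitrary set to a single chart.\<close>

lemma borel_chart_partition:
  fixes A :: "('p::topological_space, 'e::euclidean_space) chart set"
  assumes "smooth_atlas A" "compact (UNIV :: 'p set)"
  obtains I :: "nat set" and c E where "finite I"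
    "\<forall>i\<in>I. c i \<in> A \<and> E i \<subseteq> fst (c i) \<and> E i \<in> sets borel" "disjoint_family_on E I" "(\<Union>i\<in>I. E i) = UNIV"
proof -
  obtain C where C: "finite C" "C \<subseteq> A" "\<Union> (fst ` C) = UNIV" using finite_chart_cover[OF assms] .
  obtain c where c: "bij_betw c {0..<card C} C" using ex_bij_betw_nat_finite[OF C(1)] by blast
  define U where "U i = (if i < card C then fst (c i) else {})" for i
  have cA: "c i \<in> A" if "i < card C" for i
    using bij_betwE[OF c] that C(2) by auto
  have "open (U i)" for i
    using open_chart_domain[OF is_chart_atlas[OF assms(1) cA]] by (simp add: U_def)
  then have "range U \<subseteq> sets borel" by auto
  then have b: "disjointed U i \<in> sets borel" for i
    using sets.range_disjointed_sets by blast
  have sub: "disjointed U i \<subseteq> U i" for i by (rule disjointed_subset)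
  have "(\<Union>i. U i) = UNIV"
  proof -
    have "p \<in> (\<Union>i. U i)" for p
    proof -
      obtain d where "d \<in> C" "p \<in> fst d" using C(3) by blast
      moreover obtain i where "i < card C" "c i = d"
        using bij_betw_imp_surj_on[OF c] \<open>d \<in> C\<close> by (metis atLeastLessThan_iff imageE)
      ultimately show ?thesis by (auto simp: U_def)
    qed
    then show ?thesis by blast
  qed
  then have "(\<Union>i. disjointed U i) = UNIV" by (simp add: UN_disjointed_eq)
  moreover have "disjointed U i = {}" if "\<not> i < card C" for i using sub[of i] that by (auto simp: U_def)
  ultimately have un: "(\<Union>i\<in>{..<card C}. disjointed U i) = UNIV" by blast
  show ?thesis
  proof (rule that[of "{..<card C}" c "disjointed U"])
    show "disjoint_family_on (disjointed U) {..<card C}"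
      by (rule disjoint_family_on_mono[OF _ disjoint_family_disjointed]) simp
    show "\<forall>i\<in>{..<card C}. c i \<in> A \<and> disjointed U i \<subseteq> fst (c i) \<and> disjointed U i \<in> sets borel"
    proof
      fix i assume "i \<in> {..<card C}"
      then show "c i \<in> A \<and> disjointed U i \<subseteq> fst (c i) \<and> disjointed U i \<in> sets borel"
        using sub[of i] cA b by (simp add: U_def)
    qed
  qed (use un in auto)
qed

lemma riemannian_volume_exists:
  fixes A :: "('p::{t2_space, second_countable_topology}, real^'m) chart set"
  assumes M: "riemannian_manifold A g" and K: "compact (UNIV :: 'p set)"
  shows "\<exists>V. is_riemannian_volume A g V"
proof -
  obtain I :: "nat set" and c E where "finite I"
    "\<forall>i\<in>I. c i \<in> A \<and> E i \<subseteq> fst (c i) \<and> E i \<in> sets borel" "disjoint_family_on E I"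
    "(\<Union>i\<in>I. E i) = (UNIV :: 'p set)"
    using borel_chart_partition[OF riemannian_manifold_atlas[OF M] K] .
  then have I: "finite I" "\<And>i. i \<in> I \<Longrightarrow> c i \<in> A" "\<And>i. i \<in> I \<Longrightarrow> E i \<subseteq> fst (c i)"
    "\<And>i. i \<in> I \<Longrightarrow> E i \<in> sets borel" "disjoint_family_on E I" "(\<Union>i\<in>I. E i) = UNIV"
    by blast+
  \<comment> \<open>Each piece is measured in its own chart; that the chart does not matter is what
    yields the defining property in every other chart \<open>d\<close>.\<close>
  define \<mu> where "\<mu> S = (\<Sum>i\<in>I. chart_volume g (c i) (S \<inter> E i))" for S
  define V where "V = measure_of UNIV (sets (borel :: 'p measure)) \<mu>"
  have sV: "sets V = sets borel"
    unfolding V_def by (simp add: sigma_algebra.sets_measure_of_eq[OF sets.sigma_algebra_axioms[of borel, simplified]])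
  have V: "emeasure V S = \<mu> S" if "S \<in> sets borel" for S
    unfolding V_def
  proof (rule emeasure_measure_of_sigma[OF _ _ _ that])
    show "sigma_algebra UNIV (sets (borel :: 'p measure))"
      using sets.sigma_algebra_axioms[of "borel :: 'p measure"] by simp
    show "positive (sets borel) \<mu>" by (simp add: positive_def \<mu>_def chart_volume_def)
    show "countably_additive (sets borel) \<mu>"
      unfolding countably_additive_def
    proof (intro allI impI)
      fix F :: "nat \<Rightarrow> 'p set" assume F: "range F \<subseteq> sets borel" "disjoint_family F"
      have "(\<Sum>n. \<mu> (F n)) = (\<Sum>i\<in>I. \<Sum>n. chart_volume g (c i) (F n \<inter> E i))"
        unfolding \<mu>_def by (rule suminf_sum) simp
      also have "\<dots> = (\<Sum>i\<in>I. chart_volume g (c i) (\<Union>n. F n \<inter> E i))"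
      proof (rule sum.cong[OF refl chart_volume_suminf[OF M]])
        fix i assume i: "i \<in> I"
        show "c i \<in> A" using I i by blast
        show "range (\<lambda>n. F n \<inter> E i) \<subseteq> sets borel" using F(1) I(4)[OF i] by auto
        show "disjoint_family (\<lambda>n. F n \<inter> E i)" using F(2) unfolding disjoint_family_on_def by blast
        show "F n \<inter> E i \<subseteq> fst (c i)" for n using I(3)[OF i] by blast
      qed
      also have "\<dots> = \<mu> (\<Union>n. F n)" unfolding \<mu>_def by simp
      finally show "(\<Sum>n. \<mu> (F n)) = \<mu> (\<Union> (range F))" .
    qed
  qed
  have "emeasure V S = chart_volume g d S" if d: "d \<in> A" and S: "S \<in> sets borel" "S \<subseteq> fst d" for d S
  proof -
    have "emeasure V S = (\<Sum>i\<in>I. chart_volume g d (S \<inter> E i))"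
      unfolding V[OF S(1)] \<mu>_def
      by (rule sum.cong[OF refl chart_volume_change[OF M _ d]]) (use I S in auto)
    \<comment> \<open>The finite sum is padded with empty sets to a series, the form in which
      additivity of \<open>chart_volume\<close> is stated.\<close>
    also have "\<dots> = (\<Sum>n. if n \<in> I then chart_volume g d (S \<inter> E n) else 0)"
      using suminf_finite[of I "\<lambda>n. if n \<in> I then chart_volume g d (S \<inter> E n) else 0"] I(1) by simp
    also have "\<dots> = (\<Sum>n. chart_volume g d (if n \<in> I then S \<inter> E n else {}))"
      by (intro suminf_cong) (simp add: chart_volume_def)
    also have "\<dots> = chart_volume g d (\<Union>n. if n \<in> I then S \<inter> E n else {})"
    proof (rule chart_volume_suminf[OF M d])
      show "range (\<lambda>n. if n \<in> I then S \<inter> E n else {}) \<subseteq> sets borel" using S I(4) by auto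
      show "disjoint_family (\<lambda>n. if n \<in> I then S \<inter> E n else {})"
        using I(5) unfolding disjoint_family_on_def by auto
    qed (use S in auto)
    also have "(\<Union>n. if n \<in> I then S \<inter> E n else {}) = S" using I(6) by auto
    finally show ?thesis .
  qed
  then show ?thesis
    using sV unfolding is_riemannian_volume_def chart_volume_def chart_density_def by blast
qed

text \<open>On each piece the value is prescribed by a chart, and the pieces exhaust the manifold.
  Together with existence this gives the description in \<open>riemannian_volume\<close> a
  meaning.\<close>

lemma riemannian_volume_unique:
  fixes A :: "('p::{t2_space, second_countable_topology}, real^'m) chart set"
  assumes M: "riemannian_manifold A g" and K: "compact (UNIV :: 'p set)"
    and V: "is_riemannian_volume A g V" and W: "is_riemannian_volume A g W"
  shows "V = W"
proof (rule measure_eqI)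
  show "sets V = sets W" using V W by (simp add: is_riemannian_volume_def)
  obtain I :: "nat set" and c E where "finite I"
    "\<forall>i\<in>I. c i \<in> A \<and> E i \<subseteq> fst (c i) \<and> E i \<in> sets borel" "disjoint_family_on E I"
    "(\<Union>i\<in>I. E i) = (UNIV :: 'p set)"
    using borel_chart_partition[OF riemannian_manifold_atlas[OF M] K] .
  then have I: "finite I" "\<And>i. i \<in> I \<Longrightarrow> c i \<in> A" "\<And>i. i \<in> I \<Longrightarrow> E i \<subseteq> fst (c i)"
    "\<And>i. i \<in> I \<Longrightarrow> E i \<in> sets borel" "disjoint_family_on E I" "(\<Union>i\<in>I. E i) = UNIV"
    by blast+
  fix S assume "S \<in> sets V"
  then have S: "S \<in> sets borel" using V by (simp add: is_riemannian_volume_def)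
  have "emeasure U S = (\<Sum>i\<in>I. chart_volume g (c i) (S \<inter> E i))" if U: "is_riemannian_volume A g U" for U
  proof -
    have sU: "sets U = sets borel" using U by (simp add: is_riemannian_volume_def)
    have "(\<Sum>i\<in>I. emeasure U (S \<inter> E i)) = emeasure U (\<Union>i\<in>I. S \<inter> E i)"
    proof (intro sum_emeasure)
      show "disjoint_family_on (\<lambda>i. S \<inter> E i) I"
        using I(5) unfolding disjoint_family_on_def by blast
    qed (use I S in \<open>auto simp: sU\<close>)
    also have "(\<Union>i\<in>I. S \<inter> E i) = S" using I(6) by blast
    finally have "emeasure U S = (\<Sum>i\<in>I. emeasure U (S \<inter> E i))" ..
    moreover have "emeasure U (S \<inter> E i) = chart_volume g (c i) (S \<inter> E i)" if "i \<in> I" for i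
    proof -
      have "S \<inter> E i \<in> sets borel" "S \<inter> E i \<subseteq> fst (c i)" using I(3,4)[OF that] S by auto
      then show ?thesis
        using U I(2)[OF that] unfolding is_riemannian_volume_def chart_volume_def chart_density_def by blast
    qed
    ultimately show ?thesis by simp
  qed
  then show "emeasure V S = emeasure W S" using V W by metis
qed

lemma is_riemannian_volume_riemannian_volume:
  fixes A :: "('p::{t2_space, second_countable_topology}, real^'m) chart set"
  assumes "riemannian_manifold A g" "compact (UNIV :: 'p set)"
  shows "is_riemannian_volume A g (riemannian_volume A g)"
  unfolding riemannian_volume_def
  using riemannian_volume_exists[OF assms] riemannian_volume_unique[OF assms] by (metis theI')

lemma sets_riemannian_volume:
  fixes A :: "('p::{t2_space, second_countable_topology}, real^'m) chart set"
  assumes "riemannian_manifold A g" "compact (UNIV :: 'p set)"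
  shows "sets (riemannian_volume A g) = sets borel"
  using is_riemannian_volume_riemannian_volume[OF assms] by (simp add: is_riemannian_volume_def)

lemma emeasure_riemannian_volume:
  fixes A :: "('p::{t2_space, second_countable_topology}, real^'m) chart set"
  assumes "riemannian_manifold A g" "compact (UNIV :: 'p set)" "c \<in> A" "S \<in> sets borel" "S \<subseteq> fst c"
  shows "emeasure (riemannian_volume A g) S = chart_volume g c S"
  using is_riemannian_volume_riemannian_volume[OF assms(1,2)] assms(3-)
  by (simp add: is_riemannian_volume_def chart_volume_def chart_density_def)

section \<open>Finiteness of the volume and positivity on open sets\<close>

text \<open>Local-to-global principle for properties stable under finite unions. It serves for the
  finiteness of the volume and for the uniform Lipschitz bound on the energy density.\<close>

lemma compact_induct_open:
  assumes "compact K" and "\<And>x. x \<in> K \<Longrightarrow> \<exists>U. open U \<and> x \<in> U \<and> P U"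
    and "P {}" "\<And>U V. open U \<Longrightarrow> open V \<Longrightarrow> P U \<Longrightarrow> P V \<Longrightarrow> P (U \<union> V)"
  shows "\<exists>U. open U \<and> K \<subseteq> U \<and> P U"
proof -
  let ?C = "{U. open U \<and> P U}"
  have "K \<subseteq> \<Union> ?C"
  proof
    fix x assume "x \<in> K"
    from assms(2)[OF this] show "x \<in> \<Union> ?C" by auto
  qed
  then obtain D where D: "D \<subseteq> ?C" "finite D" "K \<subseteq> \<Union> D"
    by (rule compactE[OF assms(1)]) auto
  have "open (\<Union>D) \<and> P (\<Union>D)"
    using D(2,1) by (induction rule: finite_induct) (auto simp: assms(3,4))
  then show ?thesis using D(3) by blast
qed

lemma finite_riemannian_volume:
  fixes A :: "('p::{t2_space, second_countable_topology}, real^'m) chart set"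
  assumes M: "riemannian_manifold A g" and K: "compact (UNIV :: 'p set)"
  shows "finite_measure (riemannian_volume A g)"
proof
  let ?V = "riemannian_volume A g"
  note sV = sets_riemannian_volume[OF M K]
  have "\<exists>U. open U \<and> p \<in> U \<and> emeasure ?V U < \<infinity>" for p
  proof -
    obtain c where c: "c \<in> A" "p \<in> fst c" using smooth_atlas_cover riemannian_manifold_atlas M by metis
    have ch: "is_chart c" using is_chart_atlas riemannian_manifold_atlas M c by blast
    \<comment> \<open>The closed ball is compact inside the chart range, so the continuous density
      is bounded on it.\<close>
    obtain r where r: "r > 0" "cball (snd c p) r \<subseteq> snd c ` fst c"
      using open_chart_range[OF ch] c(2) by (metis image_eqI open_contains_cball)
    let ?B = "ball (snd c p) r" and ?U = "chart_inv c ` ball (snd c p) r"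
    have Bsub: "?B \<subseteq> snd c ` fst c" using r(2) ball_subset_cball by blast
    have oU: "open ?U" using open_chart_inv_image[OF ch open_ball Bsub] .
    have U: "?U \<subseteq> fst c" "snd c ` ?U = ?B"
      using Bsub chart_inv_mem[OF ch] chart_chart_inv[OF ch] by (force simp: image_image)+
    have "continuous_on (cball (snd c p) r) (chart_density g c)"
      using continuous_on_subset[OF continuous_on_chart_density[OF M c(1)] r(2)] .
    then have "bounded (chart_density g c ` cball (snd c p) r)"
      by (simp add: compact_continuous_image compact_imp_bounded)
    then obtain C where C: "\<And>x. x \<in> cball (snd c p) r \<Longrightarrow> norm (chart_density g c x) \<le> C"
      unfolding bounded_iff by blast
    have C': "chart_density g c x \<le> C" if "x \<in> ?B" for x
      using C[of x] that by auto
    have "emeasure ?V ?U = chart_volume g c ?U"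
      using oU U by (intro emeasure_riemannian_volume[OF M K c(1)]) auto
    also have "\<dots> \<le> (\<integral>\<^sup>+x. ennreal C * indicator ?B x \<partial>lborel)"
      unfolding chart_volume_def U(2)
      using C' by (intro nn_integral_mono) (auto simp: indicator_def intro: ennreal_leI)
    also have "\<dots> = ennreal C * emeasure lborel ?B" by (simp add: nn_integral_cmult_indicator)
    also have "\<dots> < \<infinity>" using emeasure_lborel_ball_finite[of "snd c p" r] by (simp add: ennreal_mult_less_top)
    finally have "emeasure ?V ?U < \<infinity>" .
    moreover have "p \<in> ?U" using chart_inv_chart[OF ch c(2)] r(1) by (metis centre_in_ball image_eqI)
    ultimately show ?thesis using oU by blast
  qed
  then have "\<exists>U. open U \<and> UNIV \<subseteq> U \<and> emeasure ?V U < \<infinity>"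
  proof (intro compact_induct_open[OF K])
    fix U W :: "'p set" assume "open U" "open W" "emeasure ?V U < \<infinity>" "emeasure ?V W < \<infinity>"
    then show "emeasure ?V (U \<union> W) < \<infinity>"
      using emeasure_subadditive[of U ?V W] by (auto simp: sV intro: le_less_trans)
  qed auto
  moreover have "space ?V = UNIV" using sets_eq_imp_space_eq[OF sV] by simp
  ultimately show "emeasure ?V (space ?V) \<noteq> \<infinity>"
    by (metis less_irrefl top.extremum_uniqueI)
qed

text \<open>A set of volume zero would have a Lebesgue null image in a chart, because the density is
  positive there; but this image is open and nonempty.\<close>

lemma riemannian_volume_pos_open:
  fixes A :: "('p::{t2_space, second_countable_topology}, real^'m) chart set"
  assumes M: "riemannian_manifold A g" and K: "compact (UNIV :: 'p set)" and U: "open U" "U \<noteq> {}"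
  shows "emeasure (riemannian_volume A g) U \<noteq> 0"
proof
  let ?V = "riemannian_volume A g"
  assume 0: "emeasure ?V U = 0"
  obtain p where p: "p \<in> U" using U by blast
  obtain c where c: "c \<in> A" "p \<in> fst c" using smooth_atlas_cover riemannian_manifold_atlas M by metis
  have ch: "is_chart c" using is_chart_atlas riemannian_manifold_atlas M c by blast
  let ?W = "U \<inter> fst c"
  have W: "open ?W" using U open_chart_domain[OF ch] by blast
  have "emeasure ?V ?W \<le> emeasure ?V U"
    using U by (intro emeasure_mono) (auto simp: sets_riemannian_volume[OF M K])
  then have "chart_volume g c ?W = 0"
    using 0 W emeasure_riemannian_volume[OF M K c(1), of ?W] by simp
  then have "AE x in lborel. ennreal (chart_density g c x) * indicator (snd c ` ?W) x = 0"
    unfolding chart_volume_def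
    using measurable_chart_density[OF M c(1), of ?W] W by (subst (asm) nn_integral_0_iff_AE) auto
  then have "AE x in lborel. x \<notin> snd c ` ?W"
  proof (rule AE_mp, intro AE_I2 impI notI)
    fix x assume "ennreal (chart_density g c x) * indicator (snd c ` ?W) x = 0" "x \<in> snd c ` ?W"
    moreover have "chart_density g c x > 0"
      using chart_density_pos[OF M c(1), of x] \<open>x \<in> snd c ` ?W\<close> by blast
    ultimately show False by (simp add: ennreal_eq_0_iff)
  qed
  moreover have o: "open (snd c ` ?W)" using open_chart_image[OF ch W] by blast
  ultimately have "snd c ` ?W \<in> null_sets lborel"
    by (subst AE_iff_null_sets) auto
  then have "negligible (snd c ` ?W)"
    using negligible_iff_null_sets null_sets_completionI by blast
  then show False using open_not_negligible[OF o] p c by blast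
qed

section \<open>Smooth maps in charts\<close>

lemma frechet_derivative_cong_open:
  assumes "open S" "x \<in> S" "\<And>y. y \<in> S \<Longrightarrow> f y = g y" "(g has_derivative g') (at x)"
  shows "frechet_derivative f (at x) = g'"
proof -
  have "(f has_derivative g') (at x)"
    using has_derivative_transform_within_open[OF assms(4,1,2)] assms(3) by metis
  then show ?thesis using frechet_derivative_at by metis
qed

text \<open>On the neighbourhood \<open>W\<close>, which \<open>f\<close> maps into the domain of
  \<open>d\<close>, the representative of the composite is the composite of the representatives, so
  the chain rule applies.\<close>

lemma jacobian_compose:
  fixes c :: "('p::topological_space, real^'m) chart" and d :: "('q::topological_space, real^'n) chart"
    and e :: "('r, real^'k) chart"
  assumes c: "is_chart c" and d: "is_chart d" and p: "p \<in> fst c" "p \<in> W" and W: "open W" "f ` W \<subseteq> fst d"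
    and f: "chart_rep c d f differentiable (at (snd c p))"
    and k: "chart_rep d e k differentiable (at (snd d (f p)))"
  shows "jacobian c e (k \<circ> f) p = jacobian d e k (f p) ** jacobian c d f p"
proof -
  let ?S = "snd c ` (W \<inter> fst c)"
  let ?D = "frechet_derivative (chart_rep c d f) (at (snd c p))"
  let ?E = "frechet_derivative (chart_rep d e k) (at (snd d (f p)))"
  have o: "open ?S" using open_chart_image[OF c] W(1) open_chart_domain[OF c] by blast
  have fD: "(chart_rep c d f has_derivative ?D) (at (snd c p))"
    using f frechet_derivative_works by blast
  have kE: "(chart_rep d e k has_derivative ?E) (at (snd d (f p)))"
    using k frechet_derivative_works by blast
  have "((\<lambda>x. chart_rep d e k (chart_rep c d f x)) has_derivative (\<lambda>v. ?E (?D v))) (at (snd c p))"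
    by (rule has_derivative_compose[OF fD]) (use kE chart_rep_chart[OF c p(1)] in metis)
  moreover have "chart_rep c e (k \<circ> f) x = chart_rep d e k (chart_rep c d f x)" if "x \<in> ?S" for x
    using that W(2) chart_inv_chart[OF d] by (auto simp: chart_rep_def chart_inv_chart[OF c] image_subset_iff)
  ultimately have "frechet_derivative (chart_rep c e (k \<circ> f)) (at (snd c p)) = ?E \<circ> ?D"
    unfolding comp_def[of ?E] using p by (intro frechet_derivative_cong_open[OF o]) auto
  then show ?thesis
    using matrix_compose[OF has_derivative_linear[OF fD] has_derivative_linear[OF kE]]
    by (simp add: jacobian_def)
qed

lemma smooth_mapD:
  "smooth_map A B f \<Longrightarrow> c \<in> A \<Longrightarrow> d \<in> B \<Longrightarrow> smooth_on (snd c ` (fst c \<inter> f -` fst d)) (chart_rep c d f)"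
  unfolding smooth_map_def by blast

lemma smooth_map_continuous:
  assumes "smooth_map A B f" "smooth_atlas A"
  shows "continuous_on UNIV f"
  using assms unfolding smooth_map_def smooth_atlas_def by simp

lemma smooth_map_open_preimage:
  assumes "smooth_map A B f" "smooth_atlas A" "open U"
  shows "open (f -` U)"
  using smooth_map_continuous[OF assms(1,2)] assms(3) by (simp add: continuous_on_open_vimage)

lemma smooth_map_differentiable:
  assumes "smooth_map A B f" "c \<in> A" "d \<in> B" "p \<in> fst c" "f p \<in> fst d"
  shows "chart_rep c d f differentiable (at (snd c p))"
  using smooth_on_has_derivative[OF smooth_mapD[OF assms(1-3)], of "snd c p"] assms(4,5)
  by (auto simp: differentiable_def)

lemma transition_differentiable:
  assumes "smooth_atlas A" "c \<in> A" "d \<in> A" "p \<in> fst c" "p \<in> fst d"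
  shows "chart_rep c d id differentiable (at (snd c p))"
  using smooth_on_has_derivative[OF smooth_on_transition[OF assms(1-3)], of "snd c p"] assms(4,5)
  by (auto simp: differentiable_def)

lemma jacobian_change_source:
  fixes A :: "('p::topological_space, real^'m) chart set" and B :: "('q::topological_space, real^'n) chart set"
  assumes "smooth_atlas A" "smooth_map A B f" "c \<in> A" "c' \<in> A" "d \<in> B"
    "p \<in> fst c" "p \<in> fst c'" "f p \<in> fst d"
  shows "jacobian c d f p = jacobian c' d f p ** jacobian c c' id p"
  using jacobian_compose[of c c' p "fst c'" id d f] assms
    transition_differentiable[OF assms(1,3,4,6,7)] smooth_map_differentiable[OF assms(2,4,5,7,8)]
  by (auto simp: is_chart_atlas open_chart_domain)

lemma jacobian_change_target:
  fixes A :: "('p::topological_space, real^'m) chart set" and B :: "('q::topological_space, real^'n) chart set"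
  assumes A: "smooth_atlas A" and B: "smooth_atlas B" and f: "smooth_map A B f"
    and "c \<in> A" "d \<in> B" "d' \<in> B" "p \<in> fst c" "f p \<in> fst d" "f p \<in> fst d'"
  shows "jacobian c d' f p = jacobian d d' id (f p) ** jacobian c d f p"
proof -
  have "open (f -` fst d)"
    using smooth_map_open_preimage[OF f A] open_chart_domain is_chart_atlas B assms by blast
  then show ?thesis
    using jacobian_compose[of c d p "f -` fst d" f d' id] assms
      transition_differentiable[OF B assms(5,6,8,9)] smooth_map_differentiable[OF f assms(4,5,7,8)]
    by (auto simp: is_chart_atlas)
qed

section \<open>Coordinate invariance and continuity of |df|^2\<close>

text \<open>The invariance of a metric trace under change of coordinates: the inverse metric
  transforms by the inverse of \<open>K\<close>, and the remaining factors cancel by cyclicity of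
  the trace.\<close>

lemma trace_matrix_inv_congruence:
  fixes G G' K Q :: "real^'m^'m"
  assumes G: "G = transpose K ** G' ** K" and inv: "invertible G"
  shows "trace (matrix_inv G ** (transpose K ** Q ** K)) = trace (matrix_inv G' ** Q)"
proof -
  have "det G \<noteq> 0" using inv invertible_det_nz by blast
  then have "det K \<noteq> 0" "det G' \<noteq> 0" by (auto simp: G det_mul det_transpose)
  then have iK: "invertible K" "invertible G'" by (auto simp: invertible_det_nz)
  let ?L = "matrix_inv K"
  have KL: "K ** ?L = mat 1" "?L ** K = mat 1" using matrix_inv_right matrix_inv_left iK by blast+
  then have LK: "transpose ?L ** transpose K = mat 1" "transpose K ** transpose ?L = mat 1"
    by (metis matrix_transpose_mul transpose_mat)+
  have "G ** (?L ** matrix_inv G' ** transpose ?L) =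
      transpose K ** (G' ** (K ** ?L) ** matrix_inv G') ** transpose ?L"
    unfolding G by (simp add: matrix_mul_assoc)
  also have "\<dots> = mat 1" using KL LK matrix_inv_right[OF iK(2)] by simp
  finally have "matrix_inv G = ?L ** matrix_inv G' ** transpose ?L" by (rule matrix_inv_unique)
  then have "trace (matrix_inv G ** (transpose K ** Q ** K)) =
      trace (?L ** (matrix_inv G' ** (transpose ?L ** transpose K) ** Q ** K))"
    by (simp add: matrix_mul_assoc)
  also have "\<dots> = trace (?L ** (matrix_inv G' ** Q ** K))" using LK by simp
  also have "\<dots> = trace (matrix_inv G' ** Q ** K ** ?L)" by (rule trace_mul_sym)
  also have "\<dots> = trace (matrix_inv G' ** Q ** (K ** ?L))" by (simp add: matrix_mul_assoc)
  finally show ?thesis using KL by simp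
qed

text \<open>|df|^2 as a function of bare matrices, free of chart choices, so that it can be
  differentiated along a curve of matrices.\<close>

definition energy_density where
  "energy_density G H J = trace (matrix_inv G ** (transpose J ** H ** J))"

text \<open>The charts picked by \<open>chart_at\<close> may jump from point to point. Passing to
  one fixed pair of charts is the prerequisite for every local statement about |df|^2.\<close>

lemma diff_norm_sq_eq:
  fixes A :: "('p::{t2_space, second_countable_topology}, real^'m) chart set"
    and B :: "('q::{t2_space, second_countable_topology}, real^'n) chart set"
  assumes M: "riemannian_manifold A g" and N: "riemannian_manifold B h" and f: "smooth_map A B f"
    and c: "c \<in> A" "p \<in> fst c" and d: "d \<in> B" "f p \<in> fst d"
  shows "diff_norm_sq A g B h f p = energy_density (g c p) (h d (f p)) (jacobian c d f p)"
proof -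
  note at = riemannian_manifold_atlas[OF M] riemannian_manifold_atlas[OF N]
  note me = riemannian_manifold_metric[OF M] riemannian_manifold_metric[OF N]
  define c' where "c' = chart_at A p"
  define d' where "d' = chart_at B (f p)"
  have c': "c' \<in> A" "p \<in> fst c'" using chart_at_works[OF at(1)] by (auto simp: c'_def)
  have d': "d' \<in> B" "f p \<in> fst d'" using chart_at_works[OF at(2)] by (auto simp: d'_def)
  let ?K = "jacobian c c' id p" and ?L = "jacobian d d' id (f p)"
  let ?J = "jacobian c d f p" and ?J' = "jacobian c' d' f p"
  have J: "?L ** ?J = ?J' ** ?K"
    using jacobian_change_source[OF at(1) f c(1) c'(1) d'(1) c(2) c'(2) d'(2)]
      jacobian_change_target[OF at f c(1) d(1) d'(1) c(2) d(2) d'(2)] by simp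
  have "transpose ?J ** h d (f p) ** ?J = transpose (?L ** ?J) ** h d' (f p) ** (?L ** ?J)"
    unfolding riemannian_metric_transform[OF me(2) d(1) d'(1) d(2) d'(2)]
    by (simp add: matrix_transpose_mul matrix_mul_assoc)
  also have "\<dots> = transpose ?K ** (transpose ?J' ** h d' (f p) ** ?J') ** ?K"
    unfolding J by (simp add: matrix_transpose_mul matrix_mul_assoc)
  finally show ?thesis
    unfolding diff_norm_sq_def energy_density_def Let_def
    using trace_matrix_inv_congruence[OF riemannian_metric_transform[OF me(1) c(1) c'(1) c(2) c'(2)]
        pos_def_mat_invertible[OF riemannian_metric_pos_def[OF me(1) c]]]
    by (simp add: c'_def d'_def)
qed

lemma continuous_on_matrix_frechet_derivative:
  fixes f :: "real^'m \<Rightarrow> real^'n"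
  assumes "smooth_on S f" "continuous_on T y" "y ` T \<subseteq> S"
  shows "continuous_on T (\<lambda>t. matrix (frechet_derivative f (at (y t))))"
proof -
  have "continuous_on T (\<lambda>t. \<chi> i j. frechet_derivative f (at (y t)) (axis j 1) $ i)"
    by (intro continuous_on_vec_lambda continuous_on_component
        continuous_on_frechet_derivative[OF assms] continuous_on_const)
  then show ?thesis by (simp add: matrix_def)
qed

lemma continuous_on_energy_density:
  assumes "continuous_on S G" "continuous_on S H" "continuous_on S J" "\<And>x. x \<in> S \<Longrightarrow> pos_def_mat (G x)"
  shows "continuous_on S (\<lambda>x. energy_density (G x) (H x) (J x))"
  unfolding energy_density_def
  using assms pos_def_mat_invertible
  by (intro continuous_on_trace continuous_on_matrix_mult continuous_on_matrix_inv continuous_on_transpose) auto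

lemma continuous_on_metric:
  assumes M: "riemannian_manifold A g" and c: "c \<in> A"
  shows "continuous_on (fst c) (g c)"
proof -
  have ch: "is_chart c" using is_chart_atlas[OF riemannian_manifold_atlas[OF M] c] .
  have "continuous_on (fst c) (\<lambda>p. g c (chart_inv c (snd c p)))"
    using smooth_on_imp_continuous_on[OF riemannian_metric_smooth[OF riemannian_manifold_metric[OF M] c]]
      continuous_on_chart[OF ch]
    by (rule continuous_on_compose2) auto
  then show ?thesis using chart_inv_chart[OF ch] by (simp cong: continuous_on_cong)
qed

lemma continuous_on_diff_norm_sq:
  fixes A :: "('p::{t2_space, second_countable_topology}, real^'m) chart set"
    and B :: "('q::{t2_space, second_countable_topology}, real^'n) chart set"
  assumes M: "riemannian_manifold A g" and N: "riemannian_manifold B h" and f: "smooth_map A B f"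
  shows "continuous_on UNIV (diff_norm_sq A g B h f)"
proof (rule continuous_at_imp_continuous_on, rule ballI)
  fix p
  note at = riemannian_manifold_atlas[OF M] riemannian_manifold_atlas[OF N]
  note me = riemannian_manifold_metric[OF M] riemannian_manifold_metric[OF N]
  obtain c where c: "c \<in> A" "p \<in> fst c" using smooth_atlas_cover[OF at(1)] by blast
  obtain d where d: "d \<in> B" "f p \<in> fst d" using smooth_atlas_cover[OF at(2)] by blast
  note ch = is_chart_atlas[OF at(1) c(1)] is_chart_atlas[OF at(2) d(1)]
  let ?W = "fst c \<inter> f -` fst d"
  have o: "open ?W"
    using open_chart_domain[OF ch(1)] smooth_map_open_preimage[OF f at(1) open_chart_domain[OF ch(2)]] by blast
  have fc: "continuous_on ?W f" using smooth_map_continuous[OF f at(1)] continuous_on_subset by blast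
  have "continuous_on ?W (\<lambda>p. energy_density (g c p) (h d (f p)) (jacobian c d f p))"
  proof (rule continuous_on_energy_density)
    show "continuous_on ?W (g c)" using continuous_on_metric[OF M c(1)] continuous_on_subset by blast
    show "continuous_on ?W (\<lambda>p. h d (f p))"
      using continuous_on_metric[OF N d(1)] fc by (rule continuous_on_compose2) auto
    show "continuous_on ?W (jacobian c d f)"
      unfolding jacobian_def
      by (rule continuous_on_matrix_frechet_derivative[OF smooth_mapD[OF f c(1) d(1)]])
         (auto intro: continuous_on_subset[OF continuous_on_chart[OF ch(1)]])
  qed (use riemannian_metric_pos_def[OF me(1) c(1)] in auto)
  then have "continuous_on ?W (diff_norm_sq A g B h f)"
    by (rule continuous_on_eq) (use diff_norm_sq_eq[OF M N f c(1) _ d(1)] in simp)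
  then show "continuous (at p) (diff_norm_sq A g B h f)"
    using o c d by (simp add: continuous_on_eq_continuous_at)
qed

lemma diff_norm_sq_nonneg:
  fixes A :: "('p::{t2_space, second_countable_topology}, real^'m) chart set"
    and B :: "('q::{t2_space, second_countable_topology}, real^'n) chart set"
  assumes M: "riemannian_manifold A g" and N: "riemannian_manifold B h"
  shows "diff_norm_sq A g B h f p \<ge> 0"
  using chart_at_works[OF riemannian_manifold_atlas[OF M], of p]
    chart_at_works[OF riemannian_manifold_atlas[OF N], of "f p"]
    pos_def_mat_inv[OF riemannian_metric_pos_def[OF riemannian_manifold_metric[OF M]]]
    riemannian_metric_pos_def[OF riemannian_manifold_metric[OF N]]
  unfolding diff_norm_sq_def Let_def by (intro trace_pullback_nonneg) blast+

text \<open>A vanishing norm means a vanishing Jacobian, so the map is constant on small coordinate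
  balls and hence locally constant; connectedness does the rest.\<close>

lemma smooth_map_constant:
  fixes A :: "('p::{t2_space, second_countable_topology}, real^'m) chart set"
    and B :: "('q::{t2_space, second_countable_topology}, real^'n) chart set"
  assumes M: "riemannian_manifold A g" and N: "riemannian_manifold B h" and f: "smooth_map A B f"
    and conn: "connected (UNIV :: 'p set)" and e: "\<And>p. diff_norm_sq A g B h f p = 0"
  shows "\<exists>q. \<forall>p. f p = q"
proof -
  note at = riemannian_manifold_atlas[OF M] riemannian_manifold_atlas[OF N]
  note me = riemannian_manifold_metric[OF M] riemannian_manifold_metric[OF N]
  have loc: "\<exists>U. open U \<and> p \<in> U \<and> (\<forall>x\<in>U. f x = f p)" for p
  proof -
    obtain c where c: "c \<in> A" "p \<in> fst c" using smooth_atlas_cover[OF at(1)] by blast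
    obtain d where d: "d \<in> B" "f p \<in> fst d" using smooth_atlas_cover[OF at(2)] by blast
    note ch = is_chart_atlas[OF at(1) c(1)] is_chart_atlas[OF at(2) d(1)]
    let ?W = "fst c \<inter> f -` fst d" and ?u = "chart_rep c d f"
    have o: "open ?W"
      using open_chart_domain[OF ch(1)] smooth_map_open_preimage[OF f at(1) open_chart_domain[OF ch(2)]] by blast
    have oS: "open (snd c ` ?W)" by (rule open_chart_image[OF ch(1) o]) blast
    have der: "(?u has_derivative (\<lambda>v. 0)) (at x)" if "x \<in> snd c ` ?W" for x
    proof -
      obtain a where a: "a \<in> ?W" "x = snd c a" using \<open>x \<in> snd c ` ?W\<close> by auto
      have "jacobian c d f a = 0"
        using trace_pullback_eq_0[OF pos_def_mat_inv[OF riemannian_metric_pos_def[OF me(1) c(1), of a]]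
            riemannian_metric_pos_def[OF me(2) d(1), of "f a"], of "jacobian c d f a"]
          diff_norm_sq_eq[OF M N f c(1) _ d(1), of a] e[of a] a by (simp add: energy_density_def)
      moreover have D: "(?u has_derivative frechet_derivative ?u (at x)) (at x)"
        using smooth_on_has_derivative[OF smooth_mapD[OF f c(1) d(1)] that] .
      moreover have "frechet_derivative ?u (at x) v = jacobian c d f a *v v" for v
        using matrix_vector_mul(2)[OF has_derivative_linear[OF D]]
        by (metis jacobian_def a(2))
      ultimately have "frechet_derivative ?u (at x) = (\<lambda>v. 0)" by auto
      then show ?thesis using D by metis
    qed
    obtain r where r: "r > 0" "ball (snd c p) r \<subseteq> snd c ` ?W"
    proof -
      have "snd c p \<in> snd c ` ?W" using c d by blast
      with oS obtain r where "r > 0" "ball (snd c p) r \<subseteq> snd c ` ?W" by (rule openE)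
      then show ?thesis using that by simp
    qed
    let ?B = "ball (snd c p) r"
    have const: "?u x = ?u (snd c p)" if "x \<in> ?B" for x
    proof -
      have "\<exists>k. \<forall>x\<in>?B. ?u x = k"
        by (rule has_derivative_zero_constant[OF convex_ball])
           (rule has_derivative_at_withinI[OF der[OF subsetD[OF r(2)]]])
      then show ?thesis using that r(1) by (metis centre_in_ball)
    qed
    have "open (chart_inv c ` ?B)" using open_chart_inv_image[OF ch(1) open_ball] r(2) by blast
    moreover have "p \<in> chart_inv c ` ?B"
      using chart_inv_chart[OF ch(1) c(2)] r(1) by (metis centre_in_ball image_eqI)
    moreover have "f q = f p" if q: "q \<in> chart_inv c ` ?B" for q
    proof -
      obtain x where x: "x \<in> ?B" "q = chart_inv c x" using q by blast
      obtain b where b: "b \<in> ?W" "x = snd c b" using x(1) r(2) by blast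
      have qb: "q = b" using x(2) b chart_inv_chart[OF ch(1)] by simp
      have "snd d (f q) = snd d (f p)"
        using const[OF x(1)] b c(2) by (simp add: chart_rep_chart[OF ch(1)] qb)
      then show ?thesis using b qb d(2) inj_onD[OF inj_on_chart[OF ch(2)], of "f q" "f p"] by simp
    qed
    ultimately show ?thesis by blast
  qed
  have "f constant_on UNIV"
  proof (rule locally_constant_imp_constant[OF conn])
    fix a :: 'p
    show "\<exists>T. openin (top_of_set UNIV) T \<and> a \<in> T \<and> (\<forall>x\<in>T. f x = f a)"
      using loc[of a] by simp
  qed
  then show ?thesis unfolding constant_on_def by blast
qed

section \<open>Variations supported in a chart of the target\<close>

lemma bounded_bilinear_matrix_mult:
  "bounded_bilinear (\<lambda>(P :: real^'n^'m) (Q :: real^'k^'n). P ** Q)"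
  unfolding bilinear_conv_bounded_bilinear[symmetric] bilinear_def linear_iff
  by (simp add: matrix_matrix_mult_def vec_eq_iff sum_distrib_left sum.distrib distrib_left distrib_right mult_ac)

lemma bounded_linear_transpose: "bounded_linear (transpose :: real^'n^'m \<Rightarrow> real^'m^'n)"
  unfolding linear_conv_bounded_linear[symmetric] linear_iff by (simp add: transpose_def vec_eq_iff)

lemma bounded_linear_trace: "bounded_linear (trace :: real^'n^'n \<Rightarrow> real)"
  unfolding linear_conv_bounded_linear[symmetric] linear_iff
  by (simp add: trace_def sum.distrib sum_distrib_left)

text \<open>The product rule for \<open>energy_density\<close> with \<open>G\<close> held fixed: a
  variation moves \<open>H\<close> and \<open>J\<close>, but not the metric of the domain.\<close>

definition energy_rate where
  "energy_rate G H H' J J' =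
    trace (matrix_inv G ** (transpose J' ** H ** J + transpose J ** H' ** J + transpose J ** H ** J'))"

lemma energy_density_has_derivative:
  fixes u z :: "real^'n" and J J' :: "real^'m^'n"
  assumes H: "(H has_derivative D) (at (u + t *\<^sub>R z))"
  shows "((\<lambda>t. energy_density G (H (u + t *\<^sub>R z)) (J + t *\<^sub>R J')) has_real_derivative
    energy_rate G (H (u + t *\<^sub>R z)) (D z) (J + t *\<^sub>R J') J') (at t)"
proof -
  note bb = bounded_bilinear.has_vector_derivative[OF bounded_bilinear_matrix_mult]
  have J: "((\<lambda>t. J + t *\<^sub>R J') has_vector_derivative J') (at t)"
    by (auto intro!: derivative_eq_intros)
  have JT: "((\<lambda>t. transpose (J + t *\<^sub>R J')) has_vector_derivative transpose J') (at t)"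
    using bounded_linear.has_vector_derivative[OF bounded_linear_transpose J] .
  have "((\<lambda>t. u + t *\<^sub>R z) has_derivative (\<lambda>s. s *\<^sub>R z)) (at t)"
    by (auto intro!: derivative_eq_intros)
  from has_derivative_compose[OF this H]
  have HH: "((\<lambda>t. H (u + t *\<^sub>R z)) has_vector_derivative D z) (at t)"
    unfolding has_vector_derivative_def using linear_scale[OF has_derivative_linear[OF H]] by simp
  have "((\<lambda>t. trace (matrix_inv G ** (transpose (J + t *\<^sub>R J') ** H (u + t *\<^sub>R z) ** (J + t *\<^sub>R J')))) has_vector_derivative
      energy_rate G (H (u + t *\<^sub>R z)) (D z) (J + t *\<^sub>R J') J') (at t)"
    using bounded_linear.has_vector_derivative[OF bounded_linear_trace bb[OF has_vector_derivative_const bb[OF bb[OF JT HH] J]]]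
    by (simp add: energy_rate_def matrix_add_rdistrib add_ac)
  then show ?thesis
    by (simp add: energy_density_def has_real_derivative_iff_has_vector_derivative)
qed

lemma continuous_on_energy_rate:
  assumes "continuous_on S G" "continuous_on S H" "continuous_on S H'" "continuous_on S J" "continuous_on S J'"
    "\<And>x. x \<in> S \<Longrightarrow> pos_def_mat (G x)"
  shows "continuous_on S (\<lambda>x. energy_rate (G x) (H x) (H' x) (J x) (J' x))"
  unfolding energy_rate_def
  using assms pos_def_mat_invertible
  by (intro continuous_on_trace continuous_on_matrix_mult continuous_on_matrix_inv continuous_on_transpose
      continuous_on_add) auto

section \<open>Cylinder charts and time slices\<close>

abbreviation cylinder_chart :: "real \<Rightarrow> ('p, 'e) chart \<Rightarrow> (real \<times> 'p, real \<times> 'e) chart" where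
  "cylinder_chart \<epsilon> c \<equiv> ({-\<epsilon><..<\<epsilon>} \<times> fst c, \<lambda>(t, p). (t, snd c p))"

lemma cylinder_chart_range: "snd (cylinder_chart \<epsilon> c) ` fst (cylinder_chart \<epsilon> c) = {-\<epsilon><..<\<epsilon>} \<times> snd c ` fst c"
  by (auto simp: image_iff)

lemma chart_inv_cylinder:
  assumes c: "is_chart c" and t: "t \<in> {-\<epsilon><..<\<epsilon>}" and x: "x \<in> snd c ` fst c"
  shows "chart_inv (cylinder_chart \<epsilon> c) (t, x) = (t, chart_inv c x)"
proof -
  have "inj_on (\<lambda>(t, p). (t, snd c p)) ({-\<epsilon><..<\<epsilon>} \<times> fst c)"
    using inj_on_chart[OF c] by (auto simp: inj_on_def)
  then show ?thesis
    unfolding chart_inv_def[of "cylinder_chart \<epsilon> c"]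
    using t chart_inv_mem[OF c x] chart_chart_inv[OF c x] by (auto intro!: inv_into_f_eq)
qed

lemma is_chart_cylinder:
  assumes c: "is_chart c"
  shows "is_chart (cylinder_chart \<epsilon> c)"
  unfolding is_chart_def cylinder_chart_range
proof (intro conjI)
  let ?I = "{-\<epsilon><..<\<epsilon>}"
  show "open (fst (cylinder_chart \<epsilon> c))" "open (?I \<times> snd c ` fst c)"
    using open_chart_domain[OF c] open_chart_range[OF c] by (auto intro: open_Times)
  show "homeomorphism (fst (cylinder_chart \<epsilon> c)) (?I \<times> snd c ` fst c) (snd (cylinder_chart \<epsilon> c))
      (chart_inv (cylinder_chart \<epsilon> c))"
  proof (rule homeomorphismI)
    show "continuous_on (fst (cylinder_chart \<epsilon> c)) (snd (cylinder_chart \<epsilon> c))"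
      unfolding fst_conv snd_conv case_prod_unfold
      by (intro continuous_intros continuous_on_compose2[OF continuous_on_chart[OF c]]) auto
    have "continuous_on (?I \<times> snd c ` fst c) (\<lambda>y. (fst y, chart_inv c (snd y)))"
      by (intro continuous_intros continuous_on_compose2[OF continuous_on_chart_inv[OF c]]) auto
    then show "continuous_on (?I \<times> snd c ` fst c) (chart_inv (cylinder_chart \<epsilon> c))"
      by (rule continuous_on_eq) (auto simp: chart_inv_cylinder[OF c])
    show "snd (cylinder_chart \<epsilon> c) ` fst (cylinder_chart \<epsilon> c) \<subseteq> ?I \<times> snd c ` fst c"
      unfolding cylinder_chart_range by simp
    show "chart_inv (cylinder_chart \<epsilon> c) ` (?I \<times> snd c ` fst c) \<subseteq> fst (cylinder_chart \<epsilon> c)"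
      using chart_inv_mem[OF c] by (auto simp: chart_inv_cylinder[OF c])
    show "chart_inv (cylinder_chart \<epsilon> c) (snd (cylinder_chart \<epsilon> c) y) = y" if "y \<in> fst (cylinder_chart \<epsilon> c)" for y
      using that chart_inv_chart[OF c] by (auto simp: chart_inv_cylinder[OF c])
    show "snd (cylinder_chart \<epsilon> c) (chart_inv (cylinder_chart \<epsilon> c) y) = y" if "y \<in> ?I \<times> snd c ` fst c" for y
      using that chart_chart_inv[OF c] by (auto simp: chart_inv_cylinder[OF c])
  qed
qed

lemma cylinder_atlas_cover:
  assumes "smooth_atlas A"
  shows "\<Union> (fst ` cylinder_atlas \<epsilon> A) = {-\<epsilon><..<\<epsilon>} \<times> UNIV"
proof -
  have "\<Union> (fst ` cylinder_atlas \<epsilon> A) = {-\<epsilon><..<\<epsilon>} \<times> \<Union> (fst ` A)"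
    by (auto simp: cylinder_atlas_def image_image)
  then show ?thesis using assms by (simp add: smooth_atlas_def)
qed

text \<open>The slice is the composite with x \<mapsto> (t, x). It makes each map of a variation
  smooth, so that its energy density can be computed in any charts.\<close>

lemma smooth_map_slice:
  assumes A: "smooth_atlas A" and B: "smooth_atlas B" and F: "smooth_map (cylinder_atlas \<epsilon> A) B (\<lambda>(t, p). F t p)"
    and t: "\<bar>t\<bar> < \<epsilon>"
  shows "smooth_map A B (F t)"
  unfolding smooth_map_def
proof (intro conjI ballI)
  let ?F = "\<lambda>(t, p). F t p"
  have tI: "t \<in> {-\<epsilon><..<\<epsilon>}" using t by auto
  have cF: "continuous_on ({-\<epsilon><..<\<epsilon>} \<times> UNIV) ?F"
    using F unfolding smooth_map_def cylinder_atlas_cover[OF A] by blast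
  have "continuous_on UNIV (\<lambda>p. ?F (t, p))"
    using tI by (intro continuous_on_compose2[OF cF] continuous_intros) auto
  then have c1: "continuous_on UNIV (F t)" by simp
  then show "continuous_on (\<Union> (fst ` A)) (F t)" using continuous_on_subset by blast
  fix c d assume c: "c \<in> A" and d: "d \<in> B"
  note ch = is_chart_atlas[OF A c] is_chart_atlas[OF B d]
  let ?C = "cylinder_chart \<epsilon> c"
  let ?S = "snd c ` (fst c \<inter> F t -` fst d)" and ?T = "snd ?C ` (fst ?C \<inter> ?F -` fst d)"
  have "open (F t -` fst d)" using c1 open_chart_domain[OF ch(2)] by (simp add: continuous_on_open_vimage)
  then have oS: "open ?S" using open_chart_domain[OF ch(1)] by (intro open_chart_image[OF ch(1)]) auto
  have "open (({-\<epsilon><..<\<epsilon>} \<times> UNIV) \<inter> ?F -` fst d)"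
    using continuous_on_open_vimage[of "{-\<epsilon><..<\<epsilon>} \<times> UNIV" ?F] cF open_chart_domain[OF ch(2)]
    by (simp add: open_Times inf_commute)
  moreover have "fst ?C \<inter> ?F -` fst d = fst ?C \<inter> (({-\<epsilon><..<\<epsilon>} \<times> UNIV) \<inter> ?F -` fst d)" by auto
  ultimately have oT: "open ?T"
    using open_chart_domain[OF is_chart_cylinder[OF ch(1)], of \<epsilon>]
    by (intro open_chart_image[OF is_chart_cylinder[OF ch(1)]]) auto
  have sub: "(\<lambda>x. (t, x)) ` ?S \<subseteq> ?T" using tI by (force simp: image_iff)
  have "?C \<in> cylinder_atlas \<epsilon> A" using c by (simp add: cylinder_atlas_def)
  then have "smooth_on ?T (chart_rep ?C d ?F)" using smooth_mapD[OF F _ d] by blast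
  moreover have "smooth_on ?S (\<lambda>x. (t, x))" by (intro smooth_on_Pair smooth_on_const smooth_on_ident oS)
  ultimately have "smooth_on ?S (\<lambda>x. chart_rep ?C d ?F (t, x))"
    using smooth_on_compose[OF oS oT sub] by blast
  moreover have "chart_rep ?C d ?F (t, x) = chart_rep c d (F t) x" if "x \<in> ?S" for x
    unfolding chart_rep_def using that chart_inv_cylinder[OF ch(1) tI, of x] by auto
  ultimately show "smooth_on ?S (chart_rep c d (F t))"
    by (rule smooth_on_transform[OF oS])
qed

section \<open>Straight-line variations in one target chart\<close>

text \<open>The data of one member of the partition of unity: \<rho> is supported in a compact
  \<open>K\<close> which \<psi> maps into the domain of the single chart \<open>d\<close>.\<close>

locale target_variation =
  fixes A :: "('p::{t2_space, second_countable_topology}, real^'m) chart set"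
    and g :: "('p, real^'m) chart \<Rightarrow> 'p \<Rightarrow> real^'m^'m"
    and B :: "('q::{t2_space, second_countable_topology}, real^'n) chart set"
    and h :: "('q, real^'n) chart \<Rightarrow> 'q \<Rightarrow> real^'n^'n"
    and \<psi> :: "'p \<Rightarrow> 'q"
    and X :: "('q, real^'n) chart \<Rightarrow> 'q \<Rightarrow> real^'n"
    and l :: "'q \<Rightarrow> real"
    and d :: "('q, real^'n) chart"
    and \<rho> :: "'p \<Rightarrow> real"
    and K :: "'p set"
  assumes M: "riemannian_manifold A g" and N: "riemannian_manifold B h"
    and \<psi>: "smooth_map A B \<psi>" and X: "conformal_field B h X l" and d: "d \<in> B"
    and K: "compact K" "K \<subseteq> \<psi> -` fst d"
    and \<rho>: "smooth_components A (\<lambda>_. \<rho>)" "\<And>p. p \<notin> K \<Longrightarrow> \<rho> p = 0"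
begin

lemmas at = riemannian_manifold_atlas[OF M] riemannian_manifold_atlas[OF N]
lemmas me = riemannian_manifold_metric[OF M] riemannian_manifold_metric[OF N]
lemmas chd = is_chart_atlas[OF at(2) d]

text \<open>The variation field in the coordinates of \<open>d\<close>. Where \<psi> leaves the
  domain of \<open>d\<close> the components of \<open>X\<close> carry no meaning, but there \<rho>
  vanishes.\<close>

definition push :: "'p \<Rightarrow> real^'n" where
  "push p = \<rho> p *\<^sub>R X d (\<psi> p)"

text \<open>\<open>chart_inv d\<close> is arbitrary outside the chart range, so \<open>var t\<close>
  is meaningful only while the line stays in that range, which holds for small
  \<open>t\<close>.\<close>

definition var :: "real \<Rightarrow> 'p \<Rightarrow> 'q" where
  "var t p = (if \<psi> p \<in> fst d then chart_inv d (snd d (\<psi> p) + t *\<^sub>R push p) else \<psi> p)"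

definition src :: "('p, real^'m) chart \<Rightarrow> (real^'m) set" where
  "src c = snd c ` (fst c \<inter> \<psi> -` fst d)"

abbreviation "rep c \<equiv> chart_rep c d \<psi>"

abbreviation "prep c \<equiv> push \<circ> chart_inv c"

lemma open_preimage: "open (\<psi> -` fst d)"
  by (rule smooth_map_open_preimage[OF \<psi> at(1) open_chart_domain[OF chd]])

lemma open_src: "c \<in> A \<Longrightarrow> open (src c)"
  unfolding src_def using open_preimage open_chart_domain[OF is_chart_atlas[OF at(1)]]
  by (intro open_chart_image[OF is_chart_atlas[OF at(1)]] open_Int) auto

lemma smooth_rep: "c \<in> A \<Longrightarrow> smooth_on (src c) (rep c)"
  unfolding src_def by (rule smooth_mapD[OF \<psi> _ d])

lemma src_mem: "p \<in> fst c \<Longrightarrow> \<psi> p \<in> fst d \<Longrightarrow> snd c p \<in> src c"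
  by (auto simp: src_def)

lemma srcE:
  assumes "c \<in> A" "x \<in> src c"
  obtains p where "p \<in> fst c" "\<psi> p \<in> fst d" "x = snd c p" "chart_inv c x = p" "rep c x = snd d (\<psi> p)"
  using assms chart_inv_chart[OF is_chart_atlas[OF at(1) assms(1)]] by (auto simp: src_def chart_rep_def)

lemma rep_mem: "c \<in> A \<Longrightarrow> x \<in> src c \<Longrightarrow> rep c x \<in> snd d ` fst d"
  by (auto elim!: srcE)

lemma vector_field_smooth: "smooth_on (snd d ` fst d) (X d \<circ> chart_inv d)"
  using X d unfolding conformal_field_def vector_field_def smooth_components_def by blast

lemma smooth_cutoff: "c \<in> A \<Longrightarrow> smooth_on (src c) (\<rho> \<circ> chart_inv c)"
  using \<rho>(1) unfolding smooth_components_def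
  by (auto intro: smooth_on_subset[of "snd c ` fst c"] simp: src_def)

lemma prep_eq:
  "c \<in> A \<Longrightarrow> x \<in> src c \<Longrightarrow> prep c x = (\<rho> \<circ> chart_inv c) x *\<^sub>R (X d \<circ> chart_inv d) (rep c x)"
  using chart_inv_chart[OF chd] by (auto elim!: srcE simp: push_def)

lemma smooth_prep:
  assumes "c \<in> A"
  shows "smooth_on (src c) (prep c)"
proof -
  have "smooth_on (src c) (\<lambda>x. (X d \<circ> chart_inv d) (rep c x))"
    using rep_mem[OF assms]
    by (intro smooth_on_compose[OF open_src[OF assms] open_chart_range[OF chd] _ vector_field_smooth
          smooth_rep[OF assms]]) auto
  then have "smooth_on (src c) (\<lambda>x. (\<rho> \<circ> chart_inv c) x *\<^sub>R (X d \<circ> chart_inv d) (rep c x))"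
    by (rule smooth_on_bilinear[OF open_src[OF assms] bounded_bilinear_scaleR smooth_cutoff[OF assms]])
  then show ?thesis
    by (rule smooth_on_transform[OF open_src[OF assms]]) (simp add: prep_eq[OF assms, unfolded o_def])
qed

lemma continuous_on_push: "continuous_on (\<psi> -` fst d) push"
proof (rule continuous_at_imp_continuous_on, rule ballI)
  fix p assume p: "p \<in> \<psi> -` fst d"
  obtain c where c: "c \<in> A" "p \<in> fst c" using smooth_atlas_cover[OF at(1)] by blast
  note ch = is_chart_atlas[OF at(1) c(1)]
  let ?W = "fst c \<inter> \<psi> -` fst d"
  have o: "open ?W" using open_preimage open_chart_domain[OF ch] by blast
  have "continuous_on ?W (\<lambda>p. prep c (snd c p))"
    by (rule continuous_on_compose2[OF smooth_on_imp_continuous_on[OF smooth_prep[OF c(1)]]])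
       (auto intro: continuous_on_subset[OF continuous_on_chart[OF ch]] src_mem)
  then have "continuous_on ?W push"
    by (rule continuous_on_eq) (simp add: chart_inv_chart[OF ch])
  then show "isCont push p" using o c p by (simp add: continuous_on_eq_continuous_at)
qed

lemma push_outside: "p \<notin> K \<Longrightarrow> push p = 0"
  by (simp add: push_def \<rho>(2))

text \<open>The image of \<open>K\<close> keeps a distance \<eta> from the complement of the chart
  range, and the field is bounded by \<open>C\<close> on \<open>K\<close>, so \<eta> / C works. Off
  \<open>K\<close> the line does not move.\<close>

lemma push_small:
  "\<exists>\<epsilon>>0. \<forall>p t. \<psi> p \<in> fst d \<and> \<bar>t\<bar> < \<epsilon> \<longrightarrow> snd d (\<psi> p) + t *\<^sub>R push p \<in> snd d ` fst d"
proof -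
  have "continuous_on (\<psi> -` fst d) (\<lambda>p. snd d (\<psi> p))"
    using smooth_map_continuous[OF \<psi> at(1)] continuous_on_subset
    by (intro continuous_on_compose2[OF continuous_on_chart[OF chd], of _ \<psi>]) auto
  then have "compact ((\<lambda>p. snd d (\<psi> p)) ` K)"
    using K continuous_on_subset by (intro compact_continuous_image) auto
  moreover have "(\<lambda>p. snd d (\<psi> p)) ` K \<subseteq> snd d ` fst d" using K(2) by auto
  ultimately obtain \<eta> where \<eta>: "\<eta> > 0" "(\<Union>y\<in>(\<lambda>p. snd d (\<psi> p)) ` K. ball y \<eta>) \<subseteq> snd d ` fst d"
    using compact_subset_open_imp_ball_epsilon_subset[OF _ open_chart_range[OF chd]] by metis
  have "bounded (push ` K)"
    using K continuous_on_subset[OF continuous_on_push K(2)]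
    by (intro compact_imp_bounded compact_continuous_image)
  then obtain C where C: "C > 0" "\<And>p. p \<in> K \<Longrightarrow> norm (push p) \<le> C"
    unfolding bounded_pos by auto
  show ?thesis
  proof (intro exI[of _ "\<eta> / C"] conjI allI impI)
    show "\<eta> / C > 0" using \<eta>(1) C(1) by simp
    fix p and t :: real assume pt: "\<psi> p \<in> fst d \<and> \<bar>t\<bar> < \<eta> / C"
    show "snd d (\<psi> p) + t *\<^sub>R push p \<in> snd d ` fst d"
    proof (cases "p \<in> K")
      case True
      have "norm (t *\<^sub>R push p) \<le> \<bar>t\<bar> * C" using C(2)[OF True] by (simp add: mult_left_mono)
      also have "\<dots> < \<eta>" using pt C(1) by (simp add: field_simps)
      finally have "snd d (\<psi> p) + t *\<^sub>R push p \<in> ball (snd d (\<psi> p)) \<eta>" by (simp add: dist_norm)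
      then show ?thesis using \<eta>(2) True by blast
    next
      case False
      then show ?thesis using pt by (simp add: push_outside)
    qed
  qed
qed

lemma var_0 [simp]: "var 0 = \<psi>"
  by (auto simp: var_def fun_eq_iff chart_inv_chart[OF chd])

lemma var_outside: "p \<notin> K \<Longrightarrow> var t p = \<psi> p"
  by (simp add: var_def push_outside chart_inv_chart[OF chd])

text \<open>An open set in time and space jointly, so that compact balls around (0, x) fit in and
  give bounds uniform in both variables.\<close>

definition path_dom :: "('p, real^'m) chart \<Rightarrow> (real \<times> (real^'m)) set" where
  "path_dom c = {(t, x). x \<in> src c \<and> rep c x + t *\<^sub>R prep c x \<in> snd d ` fst d}"

lemma continuous_on_path: "c \<in> A \<Longrightarrow> continuous_on (UNIV \<times> src c) (\<lambda>(t, x). rep c x + t *\<^sub>R prep c x)"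
  unfolding case_prod_unfold
  by (intro continuous_on_add continuous_on_scaleR continuous_on_fst continuous_on_id
      continuous_on_compose2[OF smooth_on_imp_continuous_on[OF smooth_rep], of c]
      continuous_on_compose2[OF smooth_on_imp_continuous_on[OF smooth_prep], of c] continuous_on_snd) auto

lemma open_path_dom:
  assumes "c \<in> A" "open Y" "Y \<subseteq> snd d ` fst d"
  shows "open {(t, x). x \<in> src c \<and> rep c x + t *\<^sub>R prep c x \<in> Y}"
proof -
  have "open ((\<lambda>(t, x). rep c x + t *\<^sub>R prep c x) -` Y \<inter> (UNIV \<times> src c))"
    using continuous_on_path[OF assms(1)] assms(2)
    unfolding continuous_on_open_vimage[OF open_Times[OF open_UNIV open_src[OF assms(1)]]] by blast
  moreover have "(\<lambda>(t, x). rep c x + t *\<^sub>R prep c x) -` Y \<inter> (UNIV \<times> src c) =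
      {(t, x). x \<in> src c \<and> rep c x + t *\<^sub>R prep c x \<in> Y}" by auto
  ultimately show ?thesis by simp
qed

lemma smooth_path:
  assumes c: "c \<in> A" and S: "open S" "S \<subseteq> UNIV \<times> src c"
  shows "smooth_on S (\<lambda>(t, x). rep c x + t *\<^sub>R prep c x)"
proof -
  have s: "smooth_on S (\<lambda>y. f (snd y))" if "smooth_on (src c) f" for f :: "real^'m \<Rightarrow> real^'n"
    using S that
    by (intro smooth_on_compose[OF S(1) open_src[OF c] _ that])
       (auto intro: smooth_on_bounded_linear[OF _ bounded_linear_snd] smooth_on_ident)
  show ?thesis
    unfolding case_prod_unfold
    by (intro smooth_on_add[OF S(1)] smooth_on_bilinear[OF S(1) bounded_bilinear_scaleR] s smooth_rep[OF c]
        smooth_prep[OF c] smooth_on_bounded_linear[OF S(1) bounded_linear_fst] smooth_on_ident[OF S(1)])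
qed

end

text \<open>A second stage, because the bound \<epsilon> speaks of \<open>push\<close>, which is
  defined in the first one; \<open>push_small\<close> supplies it.\<close>

locale chart_variation = target_variation A g B h \<psi> X l d \<rho> K
  for A :: "('p::{t2_space, second_countable_topology}, real^'m) chart set"
    and g B h \<psi> X l
    and d :: "('q::{t2_space, second_countable_topology}, real^'n) chart"
    and \<rho> K +
  fixes \<epsilon> :: real
  assumes \<epsilon>: "\<epsilon> > 0"
    and small: "\<And>p t. \<psi> p \<in> fst d \<Longrightarrow> \<bar>t\<bar> < \<epsilon> \<Longrightarrow> snd d (\<psi> p) + t *\<^sub>R push p \<in> snd d ` fst d"
begin

lemma var_mem: "\<psi> p \<in> fst d \<Longrightarrow> \<bar>t\<bar> < \<epsilon> \<Longrightarrow> var t p \<in> fst d"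
  using small chart_inv_mem[OF chd] by (simp add: var_def)

lemma snd_var: "\<psi> p \<in> fst d \<Longrightarrow> \<bar>t\<bar> < \<epsilon> \<Longrightarrow> snd d (var t p) = snd d (\<psi> p) + t *\<^sub>R push p"
  using small chart_chart_inv[OF chd] by (simp add: var_def)

lemma continuous_on_var: "continuous_on ({-\<epsilon><..<\<epsilon>} \<times> UNIV) (\<lambda>(t, p). var t p)"
proof -
  let ?I = "{-\<epsilon><..<\<epsilon>}"
  have c\<psi>: "continuous_on S \<psi>" for S using smooth_map_continuous[OF \<psi> at(1)] continuous_on_subset by blast
  have "continuous_on (?I \<times> \<psi> -` fst d) (\<lambda>y. chart_inv d (snd d (\<psi> (snd y)) + fst y *\<^sub>R push (snd y)))"
  proof (rule continuous_on_compose2[OF continuous_on_chart_inv[OF chd]])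
    show "continuous_on (?I \<times> \<psi> -` fst d) (\<lambda>y. snd d (\<psi> (snd y)) + fst y *\<^sub>R push (snd y))"
      by (intro continuous_intros continuous_on_compose2[OF continuous_on_chart[OF chd]]
          continuous_on_compose2[OF c\<psi>[of UNIV]] continuous_on_compose2[OF continuous_on_push]) auto
  qed (use small in \<open>auto simp: abs_less_iff\<close>)
  \<comment> \<open>Two open sets cover the cylinder: over the preimage of the chart domain the line
    formula applies, over the complement of \<open>K\<close> the variation is stationary.
    \<open>K\<close> is closed because the manifold is Hausdorff.\<close>
  then have 1: "continuous_on (?I \<times> \<psi> -` fst d) (\<lambda>(t, p). var t p)"
    by (rule continuous_on_eq) (auto simp: var_def)
  have "continuous_on (?I \<times> - K) (\<lambda>y. \<psi> (snd y))"
    by (intro continuous_on_compose2[OF c\<psi>[of UNIV]] continuous_intros) auto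
  then have 2: "continuous_on (?I \<times> - K) (\<lambda>(t, p). var t p)"
    by (rule continuous_on_eq) (auto simp: var_outside)
  have "open (- K)" using compact_imp_closed[OF K(1)] by blast
  then have "continuous_on (?I \<times> \<psi> -` fst d \<union> ?I \<times> - K) (\<lambda>(t, p). var t p)"
    using open_preimage by (intro continuous_on_open_Un 1 2 open_Times) auto
  moreover have "?I \<times> \<psi> -` fst d \<union> ?I \<times> - K = ?I \<times> UNIV" using K(2) by auto
  ultimately show ?thesis by simp
qed

lemma smooth_map_variation: "smooth_map (cylinder_atlas \<epsilon> A) B (\<lambda>(t, p). var t p)"
  unfolding smooth_map_def cylinder_atlas_cover[OF at(1)]
proof (intro conjI ballI continuous_on_var)
  let ?I = "{-\<epsilon><..<\<epsilon>}" and ?F = "\<lambda>(t, p). var t p"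
  fix C e assume "C \<in> cylinder_atlas \<epsilon> A" and e: "e \<in> B"
  then obtain c where c: "c \<in> A" and C: "C = cylinder_chart \<epsilon> c" by (auto simp: cylinder_atlas_def)
  note chc = is_chart_atlas[OF at(1) c] and che = is_chart_atlas[OF at(2) e]
  let ?S = "snd C ` (fst C \<inter> ?F -` fst e)"
  show "smooth_on ?S (chart_rep C e ?F)"
  proof (rule smooth_on_local)
    fix y assume "y \<in> ?S"
    then obtain t p where y: "y = (t, snd c p)" "t \<in> ?I" "p \<in> fst c" "var t p \<in> fst e"
      by (auto simp: C)
    show "\<exists>T. open T \<and> y \<in> T \<and> smooth_on T (chart_rep C e ?F)"
    proof (cases "\<psi> p \<in> fst d")
      case True
      \<comment> \<open>The line is smooth in the coordinates of \<open>d\<close>; composing with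
        the transition map from \<open>d\<close> to \<open>e\<close> gives smoothness in the
        arbitrary chart \<open>e\<close>, on the part where the line lies in both domains.\<close>
      let ?Y = "snd d ` (fst d \<inter> fst e)"
      let ?P = "{(t, x). x \<in> src c \<and> rep c x + t *\<^sub>R prep c x \<in> ?Y}"
      let ?T = "(?I \<times> UNIV) \<inter> ?P"
      have oY: "open ?Y"
        using open_chart_domain[OF chd] open_chart_domain[OF che] by (intro open_chart_image[OF chd]) auto
      have o: "open ?T" using open_path_dom[OF c oY] by (auto intro!: open_Int open_Times)
      have "smooth_on ?T (\<lambda>y. chart_rep d e id ((\<lambda>(t, x). rep c x + t *\<^sub>R prep c x) y))"
        by (rule smooth_on_compose[OF o oY _ smooth_on_transition[OF at(2) d e] smooth_path[OF c o]]) auto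
      moreover have "chart_rep d e id ((\<lambda>(t, x). rep c x + t *\<^sub>R prep c x) z) = chart_rep C e ?F z"
        if z: "z \<in> ?T" for z
      proof -
        obtain s x where sx: "z = (s, x)" "s \<in> ?I" "x \<in> src c" using z by auto
        obtain q where q: "q \<in> fst c" "\<psi> q \<in> fst d" "x = snd c q" "chart_inv c x = q" "rep c x = snd d (\<psi> q)"
          using srcE[OF c sx(3)] .
        have "chart_inv C z = (s, q)"
          using chart_inv_cylinder[OF chc sx(2), of x] q by (simp add: C sx(1))
        then show ?thesis by (simp add: chart_rep_def sx(1) q(4) var_def q(2) q(5)[unfolded chart_rep_def, simplified])
      qed
      ultimately have "smooth_on ?T (chart_rep C e ?F)" by (rule smooth_on_transform[OF o])
      moreover have "y \<in> ?T"
      proof -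
        have "\<bar>t\<bar> < \<epsilon>" using y(2) by auto
        from snd_var[OF True this] var_mem[OF True this]
        have "snd d (\<psi> p) + t *\<^sub>R push p \<in> ?Y" using y(4) by (metis IntI image_eqI)
        then show ?thesis
          using y True src_mem[OF y(3) True] by (simp add: chart_rep_chart[OF chc] chart_inv_chart[OF chc])
      qed
      ultimately show ?thesis using o by blast
    next
      case False
      then have pK: "p \<notin> K" using K(2) by blast
      \<comment> \<open>Away from \<open>K\<close> the variation is \<psi> at all times, so the
        smoothness of \<psi> suffices.\<close>
      let ?W = "fst c \<inter> \<psi> -` fst e \<inter> - K"
      have "open (\<psi> -` fst e)"
        by (rule smooth_map_open_preimage[OF \<psi> at(1) open_chart_domain[OF che]])
      then have oW: "open ?W"
        using open_chart_domain[OF chc] compact_imp_closed[OF K(1)] by (intro open_Int) auto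
      let ?T = "?I \<times> snd c ` ?W"
      have oS: "open (snd c ` (fst c \<inter> \<psi> -` fst e))"
        using \<open>open (\<psi> -` fst e)\<close> open_chart_domain[OF chc] by (intro open_chart_image[OF chc]) auto
      have o: "open ?T"
        by (intro open_Times open_chart_image[OF chc oW]) auto
      have "smooth_on ?T (\<lambda>y. chart_rep c e \<psi> (snd y))"
        by (rule smooth_on_compose[OF o oS _ smooth_mapD[OF \<psi> c e]])
           (auto intro: smooth_on_bounded_linear[OF o bounded_linear_snd] smooth_on_ident[OF o])
      moreover have "chart_rep c e \<psi> (snd z) = chart_rep C e ?F z" if z: "z \<in> ?T" for z
      proof -
        obtain s q where sq: "z = (s, snd c q)" "s \<in> ?I" "q \<in> ?W" using z by auto
        have "chart_inv C z = (s, q)"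
          using chart_inv_cylinder[OF chc sq(2), of "snd c q"] sq chart_inv_chart[OF chc]
          by (auto simp: C)
        then show ?thesis using sq by (simp add: chart_rep_def chart_inv_chart[OF chc] var_outside)
      qed
      ultimately have "smooth_on ?T (chart_rep C e ?F)" by (rule smooth_on_transform[OF o])
      moreover have "y \<in> ?T" using y pK var_outside[OF pK] by auto
      ultimately show ?thesis using o by blast
    qed
  qed
qed

lemma smooth_map_var: "\<bar>t\<bar> < \<epsilon> \<Longrightarrow> smooth_map A B (var t)"
  by (rule smooth_map_slice[OF at smooth_map_variation])

end

section \<open>The first variation of the energy\<close>

text \<open>For symmetric \<open>G\<close> this is twice the inner product of the covectors
  \<open>b\<close> and \<open>w\<close> in the dual metric. It is kept as the two summands in which
  the trace delivers it; linearity in \<open>w\<close> is what matters.\<close>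

definition gradient_pairing :: "real^'m^'m \<Rightarrow> real^'m \<Rightarrow> real^'m \<Rightarrow> real" where
  "gradient_pairing G b w = (matrix_inv G *v w) \<bullet> b + (matrix_inv G *v b) \<bullet> w"

lemma gradient_pairing_sum:
  "gradient_pairing G b (\<Sum>i\<in>I. w i) = (\<Sum>i\<in>I. gradient_pairing G b (w i))"
  unfolding gradient_pairing_def
  by (induction I rule: infinite_finite_induct)
     (auto simp: matrix_vector_right_distrib inner_add_left inner_add_right)

lemma gradient_pairing_0 [simp]: "gradient_pairing G b 0 = 0"
  by (simp add: gradient_pairing_def)

lemmas matrix_mult_scaleR_left = bounded_bilinear.scaleR_left[OF bounded_bilinear_matrix_mult]
lemmas matrix_mult_scaleR_right = bounded_bilinear.scaleR_right[OF bounded_bilinear_matrix_mult]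

text \<open>The algebraic core. When \<open>H1\<close> is the derivative of the target metric along
  \<open>Y\<close>, and \<open>D\<close> the derivative of \<open>Y\<close>, the terms without
  \<open>w\<close> assemble to the pullback of the Lie derivative, while the two rank-one terms give
  a pairing with \<open>w\<close>, the differential of the cutoff.\<close>

lemma energy_rate_product:
  fixes J :: "real^'m^'n"
  assumes H: "transpose H = H"
  shows "energy_rate G H (r *\<^sub>R H1) J (r *\<^sub>R (D ** J) + outer Y w) =
    r * energy_density G (H1 + transpose D ** H + H ** D) J
      + gradient_pairing G (transpose J *v (H *v Y)) w"
proof -
  let ?b = "transpose J *v (H *v Y)" and ?L = "H1 + transpose D ** H + H ** D"
  let ?J' = "r *\<^sub>R (D ** J) + outer Y w"
  have 1: "transpose ?J' ** H ** J = r *\<^sub>R (transpose J ** transpose D ** H ** J) + outer w ?b"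
  proof -
    have "transpose ?J' = r *\<^sub>R (transpose J ** transpose D) + outer w Y"
      by (simp add: linear_add[OF bounded_linear.linear[OF bounded_linear_transpose]]
          linear_scale[OF bounded_linear.linear[OF bounded_linear_transpose]] matrix_transpose_mul transpose_outer)
    then show ?thesis
      by (simp add: matrix_add_rdistrib matrix_mult_scaleR_left outer_matrix_mult H)
  qed
  have 2: "transpose J ** H ** ?J' = r *\<^sub>R (transpose J ** H ** D ** J) + outer ?b w"
    by (simp add: matrix_add_ldistrib matrix_mult_scaleR_right matrix_mult_outer matrix_mul_assoc
        matrix_vector_mul_assoc)
  have 3: "transpose J ** (r *\<^sub>R H1) ** J = r *\<^sub>R (transpose J ** H1 ** J)"
    by (simp add: matrix_mult_scaleR_left matrix_mult_scaleR_right)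
  have "transpose ?J' ** H ** J + transpose J ** (r *\<^sub>R H1) ** J + transpose J ** H ** ?J' =
      r *\<^sub>R (transpose J ** ?L ** J) + (outer w ?b + outer ?b w)"
    unfolding 1 2 3
    by (simp add: matrix_add_ldistrib matrix_add_rdistrib matrix_mul_assoc scaleR_add_right)
  then show ?thesis
    unfolding energy_rate_def energy_density_def gradient_pairing_def
    by (simp add: matrix_add_ldistrib matrix_mult_scaleR_right matrix_mult_outer trace_outer
        linear_add[OF bounded_linear.linear[OF bounded_linear_trace]]
        linear_scale[OF bounded_linear.linear[OF bounded_linear_trace]])
qed

lemma energy_density_scaleR: "energy_density G (k *\<^sub>R H) J = k * energy_density G H J"
  by (simp add: energy_density_def matrix_mult_scaleR_left matrix_mult_scaleR_right
      linear_scale[OF bounded_linear.linear[OF bounded_linear_trace]])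

lemma matrix_add_scaleR: "matrix (\<lambda>v. D v + t *\<^sub>R E v) = matrix D + t *\<^sub>R matrix E"
  by (simp add: matrix_def vec_eq_iff)

text \<open>The components in \<open>c\<close> of the pullback under \<open>f\<close> of the 1-form
  dual to X, that is v \<mapsto> h(X, df v).\<close>

definition pulled_covector where
  "pulled_covector h X f c d p = transpose (jacobian c d f p) *v (h d (f p) *v X d (f p))"

text \<open>The transition Jacobians in \<open>X\<close>, in the metric and in df cancel. This
  independence of \<open>d\<close> permits adding rates of variations carried by different
  charts.\<close>

lemma pulled_covector_change:
  fixes A :: "('p::{t2_space, second_countable_topology}, real^'m) chart set"
    and B :: "('q::{t2_space, second_countable_topology}, real^'n) chart set"
  assumes A: "smooth_atlas A" and N: "riemannian_manifold B h" and f: "smooth_map A B f"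
    and X: "vector_field B X" and c: "c \<in> A" "p \<in> fst c"
    and d: "d \<in> B" "f p \<in> fst d" and d': "d' \<in> B" "f p \<in> fst d'"
  shows "pulled_covector h X f c d p = pulled_covector h X f c d' p"
proof -
  let ?L = "jacobian d d' id (f p)"
  have "X d' (f p) = ?L *v X d (f p)" using X d d' unfolding vector_field_def by blast
  moreover have "jacobian c d' f p = ?L ** jacobian c d f p"
    using jacobian_change_target[OF A riemannian_manifold_atlas[OF N] f c(1) d(1) d'(1) c(2) d(2) d'(2)] .
  moreover have "h d (f p) = transpose ?L ** h d' (f p) ** ?L"
    using riemannian_metric_transform[OF riemannian_manifold_metric[OF N] d(1) d'(1) d(2) d'(2)] .
  ultimately show ?thesis
    by (simp add: pulled_covector_def matrix_transpose_mul matrix_vector_mul_assoc matrix_mul_assoc)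
qed

text \<open>The partial derivatives of \<open>f\<close>, hence the components of the covector df; no
  metric is involved.\<close>

definition chart_gradient :: "('p, real^'m) chart \<Rightarrow> ('p \<Rightarrow> real) \<Rightarrow> 'p \<Rightarrow> real^'m" where
  "chart_gradient c f p = (\<chi> j. frechet_derivative (f \<circ> chart_inv c) (at (snd c p)) (axis j 1))"

context target_variation
begin

abbreviation "drep c x \<equiv> matrix (frechet_derivative (rep c) (at x))"
abbreviation "dprep c x \<equiv> matrix (frechet_derivative (prep c) (at x))"
abbreviation "hrep \<equiv> h d \<circ> chart_inv d"
abbreviation "curve c t x \<equiv> rep c x + t *\<^sub>R prep c x"

text \<open>The energy density of the straight line in fixed coordinates. As an explicit expression
  in (t, x), it is available on all of \<open>path_dom\<close> and not only for times below
  \<epsilon>.\<close>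

definition path_energy where
  "path_energy c t x = energy_density (g c (chart_inv c x)) (hrep (curve c t x)) (drep c x + t *\<^sub>R dprep c x)"

definition path_rate where
  "path_rate c t x = energy_rate (g c (chart_inv c x)) (hrep (curve c t x))
    (frechet_derivative hrep (at (curve c t x)) (prep c x)) (drep c x + t *\<^sub>R dprep c x) (dprep c x)"

lemma smooth_hrep: "smooth_on (snd d ` fst d) hrep"
  using riemannian_metric_smooth[OF me(2) d] by (simp add: o_def)

lemma path_energy_has_derivative:
  assumes "curve c t x \<in> snd d ` fst d"
  shows "((\<lambda>t. path_energy c t x) has_real_derivative path_rate c t x) (at t)"
  unfolding path_energy_def path_rate_def
  by (rule energy_density_has_derivative[OF smooth_on_has_derivative[OF smooth_hrep assms]])

lemma path_domD: "y \<in> path_dom c \<Longrightarrow> snd y \<in> src c" "y \<in> path_dom c \<Longrightarrow> curve c (fst y) (snd y) \<in> snd d ` fst d"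
  by (auto simp: path_dom_def)

lemma
  assumes c: "c \<in> A"
  shows continuous_on_path_energy: "continuous_on (path_dom c) (\<lambda>(t, x). path_energy c t x)"
    and continuous_on_path_rate: "continuous_on (path_dom c) (\<lambda>(t, x). path_rate c t x)"
proof -
  let ?S = "path_dom c"
  note ch = is_chart_atlas[OF at(1) c]
  have snd: "continuous_on ?S snd" and im: "snd ` ?S \<subseteq> src c" by (auto simp: path_dom_def intro: continuous_intros)
  have sub: "src c \<subseteq> snd c ` fst c" by (auto simp: src_def)
  have G: "continuous_on ?S (\<lambda>y. g c (chart_inv c (snd y)))"
    using smooth_on_imp_continuous_on[OF riemannian_metric_smooth[OF me(1) c]] snd
    by (rule continuous_on_compose2) (use im sub in blast)
  have pos: "pos_def_mat (g c (chart_inv c (snd y)))" if "y \<in> ?S" for y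
    using riemannian_metric_pos_def[OF me(1) c] chart_inv_mem[OF ch] im sub that by blast
  have z: "continuous_on ?S (\<lambda>y. prep c (snd y))"
    by (rule continuous_on_compose2[OF smooth_on_imp_continuous_on[OF smooth_prep[OF c]] snd im])
  have "continuous_on ?S (\<lambda>(t, x). curve c t x)"
    by (rule continuous_on_subset[OF continuous_on_path[OF c]]) (auto simp: path_dom_def)
  then have p: "continuous_on ?S (\<lambda>y. curve c (fst y) (snd y))" by (simp add: case_prod_unfold)
  have pim: "(\<lambda>y. curve c (fst y) (snd y)) ` ?S \<subseteq> snd d ` fst d" using path_domD by blast
  have H: "continuous_on ?S (\<lambda>y. hrep (curve c (fst y) (snd y)))"
    by (rule continuous_on_compose2[OF smooth_on_imp_continuous_on[OF smooth_hrep] p pim])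
  have DH: "continuous_on ?S (\<lambda>y. frechet_derivative hrep (at (curve c (fst y) (snd y))) (prep c (snd y)))"
    by (rule continuous_on_frechet_derivative[OF smooth_hrep p pim z])
  have Jz: "continuous_on ?S (\<lambda>y. dprep c (snd y))"
    by (rule continuous_on_matrix_frechet_derivative[OF smooth_prep[OF c] snd im])
  have J: "continuous_on ?S (\<lambda>y. drep c (snd y) + fst y *\<^sub>R dprep c (snd y))"
    by (intro continuous_on_add continuous_on_scaleR Jz continuous_on_fst continuous_on_id
        continuous_on_matrix_frechet_derivative[OF smooth_rep[OF c] snd im])
  show "continuous_on ?S (\<lambda>(t, x). path_energy c t x)"
    unfolding case_prod_unfold path_energy_def by (rule continuous_on_energy_density[OF G H J pos])
  show "continuous_on ?S (\<lambda>(t, x). path_rate c t x)"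
    unfolding case_prod_unfold path_rate_def by (rule continuous_on_energy_rate[OF G H DH J Jz pos])
qed

lemma path_energy_nonneg:
  assumes c: "c \<in> A" and x: "x \<in> src c" and t: "curve c t x \<in> snd d ` fst d"
  shows "path_energy c t x \<ge> 0"
proof -
  have "chart_inv c x \<in> fst c" using srcE[OF c x] by metis
  moreover have "chart_inv d (curve c t x) \<in> fst d" by (rule chart_inv_mem[OF chd t])
  ultimately show ?thesis
    unfolding path_energy_def energy_density_def o_def
    using pos_def_mat_inv[OF riemannian_metric_pos_def[OF me(1) c]] riemannian_metric_pos_def[OF me(2) d]
    by (intro trace_pullback_nonneg) blast+
qed

text \<open>The product and chain rules for \<rho> (X o \<psi>): a multiple of \<rho> plus the
  rank-one matrix of X and d\<rho>, precisely the shape that \<open>energy_rate_product\<close>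
  expects.\<close>

lemma dprep_eq:
  assumes c: "c \<in> A" and p: "p \<in> fst c" "\<psi> p \<in> fst d"
  shows "dprep c (snd c p) = \<rho> p *\<^sub>R (matrix (frechet_derivative (X d \<circ> chart_inv d) (at (snd d (\<psi> p)))) ** jacobian c d \<psi> p)
      + outer (X d (\<psi> p)) (chart_gradient c \<rho> p)"
proof -
  let ?x = "snd c p" and ?r = "\<rho> \<circ> chart_inv c" and ?Y = "X d \<circ> chart_inv d"
  note ch = is_chart_atlas[OF at(1) c]
  have x: "?x \<in> src c" using p by (rule src_mem)
  have rx: "rep c ?x = snd d (\<psi> p)" by (rule chart_rep_chart[OF ch p(1)])
  have Dr: "(?r has_derivative frechet_derivative ?r (at ?x)) (at ?x)"
    by (rule smooth_on_has_derivative[OF smooth_cutoff[OF c] x])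
  have Du: "(rep c has_derivative frechet_derivative (rep c) (at ?x)) (at ?x)"
    by (rule smooth_on_has_derivative[OF smooth_rep[OF c] x])
  have DY: "(?Y has_derivative frechet_derivative ?Y (at (rep c ?x))) (at (rep c ?x))"
    by (rule smooth_on_has_derivative[OF vector_field_smooth rep_mem[OF c x]])
  have "((\<lambda>x. ?r x *\<^sub>R ?Y (rep c x)) has_derivative
      (\<lambda>v. ?r ?x *\<^sub>R frechet_derivative ?Y (at (rep c ?x)) (frechet_derivative (rep c) (at ?x) v)
        + frechet_derivative ?r (at ?x) v *\<^sub>R ?Y (rep c ?x))) (at ?x)"
    by (rule has_derivative_scaleR[OF Dr has_derivative_compose[OF Du DY]])
  from frechet_derivative_cong_open[OF open_src[OF c] x prep_eq[OF c] this]
  have "frechet_derivative (prep c) (at ?x) =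
      (\<lambda>v. ?r ?x *\<^sub>R frechet_derivative ?Y (at (rep c ?x)) (frechet_derivative (rep c) (at ?x) v)
        + frechet_derivative ?r (at ?x) v *\<^sub>R ?Y (rep c ?x))" .
  then have "dprep c ?x = ?r ?x *\<^sub>R matrix (frechet_derivative ?Y (at (rep c ?x)) \<circ> frechet_derivative (rep c) (at ?x))
      + outer (?Y (rep c ?x)) (chart_gradient c \<rho> p)"
    by (simp add: matrix_def vec_eq_iff outer_def chart_gradient_def mult.commute)
  also have "matrix (frechet_derivative ?Y (at (rep c ?x)) \<circ> frechet_derivative (rep c) (at ?x)) =
      matrix (frechet_derivative ?Y (at (rep c ?x))) ** drep c ?x"
    by (rule matrix_compose[OF has_derivative_linear[OF Du] has_derivative_linear[OF DY]])
  finally show ?thesis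
    using p by (simp add: rx jacobian_def chart_inv_chart[OF ch] chart_inv_chart[OF chd] o_def)
qed

lemma path_rate_0:
  assumes c: "c \<in> A" and p: "p \<in> fst c" "\<psi> p \<in> fst d"
  shows "path_rate c 0 (snd c p) = 2 * l (\<psi> p) * \<rho> p * diff_norm_sq A g B h \<psi> p
    + gradient_pairing (g c p) (pulled_covector h X \<psi> c d p) (chart_gradient c \<rho> p)"
proof -
  let ?x = "snd c p" and ?J = "jacobian c d \<psi> p" and ?y = "snd d (\<psi> p)"
  let ?D = "matrix (frechet_derivative (X d \<circ> chart_inv d) (at ?y))"
  let ?H = "h d (\<psi> p)"
  note ch = is_chart_atlas[OF at(1) c]
  have rx: "rep c ?x = ?y" by (rule chart_rep_chart[OF ch p(1)])
  have inv: "chart_inv c ?x = p" "chart_inv d ?y = \<psi> p"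
    using chart_inv_chart[OF ch p(1)] chart_inv_chart[OF chd p(2)] .
  have y: "?y \<in> snd d ` fst d" using p by blast
  have lin: "linear (frechet_derivative hrep (at ?y))"
    using has_derivative_linear[OF smooth_on_has_derivative[OF smooth_hrep y]] .
  have sym: "transpose ?H = ?H"
    using riemannian_metric_pos_def[OF me(2) d p(2)] by (simp add: pos_def_mat_def)
  \<comment> \<open>Here conformality enters: the bracket produced by the product rule is the Lie
    derivative of \<open>h\<close> along \<open>X\<close>.\<close>
  have lie: "frechet_derivative hrep (at ?y) (X d (\<psi> p)) + transpose ?D ** ?H + ?H ** ?D = (2 * l (\<psi> p)) *\<^sub>R ?H"
    using X d p(2) unfolding conformal_field_def lie_derivative_def Let_def by blast
  have "path_rate c 0 ?x = energy_rate (g c p) ?H (\<rho> p *\<^sub>R frechet_derivative hrep (at ?y) (X d (\<psi> p))) ?J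
      (\<rho> p *\<^sub>R (?D ** ?J) + outer (X d (\<psi> p)) (chart_gradient c \<rho> p))"
    unfolding path_rate_def dprep_eq[OF c p]
    by (simp add: rx inv push_def linear_scale[OF lin] jacobian_def)
  also have "\<dots> = \<rho> p * energy_density (g c p) ((2 * l (\<psi> p)) *\<^sub>R ?H) ?J
      + gradient_pairing (g c p) (pulled_covector h X \<psi> c d p) (chart_gradient c \<rho> p)"
    unfolding energy_rate_product[OF sym] lie pulled_covector_def ..
  finally show ?thesis
    unfolding energy_density_scaleR diff_norm_sq_eq[OF M N \<psi> c p(1) d p(2)] by simp
qed

end

context chart_variation
begin

lemma diff_norm_sq_var:
  assumes c: "c \<in> A" and p: "p \<in> fst c" "\<psi> p \<in> fst d" and t: "\<bar>t\<bar> < \<epsilon>"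
  shows "diff_norm_sq A g B h (var t) p = path_energy c t (snd c p)"
proof -
  let ?x = "snd c p"
  note ch = is_chart_atlas[OF at(1) c]
  have x: "?x \<in> src c" using p by (rule src_mem)
  have inv: "chart_inv c ?x = p" by (rule chart_inv_chart[OF ch p(1)])
  have rx: "rep c ?x = snd d (\<psi> p)" by (rule chart_rep_chart[OF ch p(1)])
  have "((\<lambda>x. curve c t x) has_derivative
      (\<lambda>v. frechet_derivative (rep c) (at ?x) v + t *\<^sub>R frechet_derivative (prep c) (at ?x) v)) (at ?x)"
    by (intro has_derivative_add has_derivative_scaleR_right
        smooth_on_has_derivative[OF smooth_rep[OF c] x] smooth_on_has_derivative[OF smooth_prep[OF c] x])
  moreover have "chart_rep c d (var t) y = curve c t y" if "y \<in> src c" for y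
  proof -
    obtain q where q: "q \<in> fst c" "\<psi> q \<in> fst d" "y = snd c q" "chart_inv c y = q" "rep c y = snd d (\<psi> q)"
      using srcE[OF c \<open>y \<in> src c\<close>] .
    show ?thesis using q(4,5) snd_var[OF q(2) t] unfolding chart_rep_def by simp
  qed
  ultimately have "frechet_derivative (chart_rep c d (var t)) (at ?x) =
      (\<lambda>v. frechet_derivative (rep c) (at ?x) v + t *\<^sub>R frechet_derivative (prep c) (at ?x) v)"
    by (intro frechet_derivative_cong_open[OF open_src[OF c] x]) auto
  then have "jacobian c d (var t) p = drep c ?x + t *\<^sub>R dprep c ?x"
    by (simp add: jacobian_def matrix_add_scaleR)
  moreover have "h d (var t p) = hrep (curve c t ?x)"
    using p(2) by (simp add: var_def rx inv)
  ultimately show ?thesis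
    unfolding path_energy_def inv
    using diff_norm_sq_eq[OF M N smooth_map_var[OF t] c p(1) d var_mem[OF p(2) t]] by simp
qed

text \<open>The complement of \<open>K\<close> is open, so the two maps agree near \<open>p\<close>
  and their derivatives there coincide as well.\<close>

lemma diff_norm_sq_var_outside:
  assumes p: "p \<notin> K" and t: "\<bar>t\<bar> < \<epsilon>"
  shows "diff_norm_sq A g B h (var t) p = diff_norm_sq A g B h \<psi> p"
proof -
  obtain c where c: "c \<in> A" "p \<in> fst c" using smooth_atlas_cover[OF at(1)] by blast
  obtain e where e: "e \<in> B" "\<psi> p \<in> fst e" using smooth_atlas_cover[OF at(2)] by blast
  note ch = is_chart_atlas[OF at(1) c(1)]
  let ?S = "snd c ` (fst c \<inter> \<psi> -` fst e \<inter> - K)"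
  have o: "open ?S"
    using open_chart_domain[OF ch] compact_imp_closed[OF K(1)]
      smooth_map_open_preimage[OF \<psi> at(1) open_chart_domain[OF is_chart_atlas[OF at(2) e(1)]]]
    by (intro open_chart_image[OF ch]) auto
  have x: "snd c p \<in> ?S" using c e p by blast
  have "chart_rep c e (var t) y = chart_rep c e \<psi> y" if "y \<in> ?S" for y
    using that by (auto simp: chart_rep_chart[OF ch] var_outside)
  moreover have "(chart_rep c e \<psi> has_derivative frechet_derivative (chart_rep c e \<psi>) (at (snd c p))) (at (snd c p))"
    using smooth_map_differentiable[OF \<psi> c(1) e(1) c(2) e(2)] frechet_derivative_works by blast
  ultimately have "frechet_derivative (chart_rep c e (var t)) (at (snd c p)) =
      frechet_derivative (chart_rep c e \<psi>) (at (snd c p))"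
    by (rule frechet_derivative_cong_open[OF o x])
  then have "jacobian c e (var t) p = jacobian c e \<psi> p" by (simp add: jacobian_def)
  then show ?thesis
    using diff_norm_sq_eq[OF M N smooth_map_var[OF t] c e(1)] diff_norm_sq_eq[OF M N \<psi> c e]
      var_outside[OF p] e(2) by simp
qed

end

context chart_variation
begin

text \<open>The charts \<open>c\<close> and \<open>e\<close> are free: \<open>e\<close> need not be the chart \<open>d\<close> carrying the variation, so
  that the rates of variations carried by different charts can be added.\<close>

definition rate :: "('p, real^'m) chart \<Rightarrow> ('q, real^'n) chart \<Rightarrow> 'p \<Rightarrow> real" where
  "rate c e p = 2 * l (\<psi> p) * \<rho> p * diff_norm_sq A g B h \<psi> p
    + gradient_pairing (g c p) (pulled_covector h X \<psi> c e p) (chart_gradient c \<rho> p)"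

lemma powr_energy_has_derivative:
  assumes c: "c \<in> A" "p \<in> fst c" and e: "e \<in> B" "\<psi> p \<in> fst e"
  shows "((\<lambda>t. (1 + diff_norm_sq A g B h (var t) p) powr \<alpha>) has_real_derivative
    \<alpha> * (1 + diff_norm_sq A g B h \<psi> p) powr (\<alpha> - 1) * rate c e p) (at 0)"
proof (cases "\<psi> p \<in> fst d")
  case True
  note ch = is_chart_atlas[OF at(1) c(1)]
  have Xf: "vector_field B X" using X unfolding conformal_field_def by blast
  have E0: "path_energy c 0 (snd c p) = diff_norm_sq A g B h \<psi> p"
    using diff_norm_sq_var[OF c True, of 0] \<epsilon> by simp
  have "curve c 0 (snd c p) \<in> snd d ` fst d" using rep_mem[OF c(1) src_mem[OF c(2) True]] by simp
  note path_energy_has_derivative[OF this]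
  moreover have "path_rate c 0 (snd c p) = rate c e p"
    unfolding rate_def path_rate_0[OF c True] pulled_covector_change[OF at(1) N \<psi> Xf c d True e] ..
  ultimately have "((\<lambda>t. 1 + path_energy c t (snd c p)) has_real_derivative rate c e p) (at 0)"
    by (auto intro!: derivative_eq_intros)
  moreover have "1 + path_energy c 0 (snd c p) > 0"
    using diff_norm_sq_nonneg[OF M N, of \<psi> p] E0 by simp
  ultimately have "((\<lambda>t. (1 + path_energy c t (snd c p)) powr \<alpha>) has_real_derivative
      \<alpha> * (1 + path_energy c 0 (snd c p)) powr (\<alpha> - 1) * rate c e p) (at 0)"
    by (rule DERIV_fun_powr[where r = \<alpha>, simplified])
  then show ?thesis
    unfolding E0
    by (rule has_field_derivative_transform_within_open[where S = "{-\<epsilon><..<\<epsilon>}"])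
       (use \<epsilon> diff_norm_sq_var[OF c True] in auto)
next
  case False
  then have p: "p \<notin> K" using K(2) by blast
  note ch = is_chart_atlas[OF at(1) c(1)]
  have "((\<lambda>t. (1 + diff_norm_sq A g B h \<psi> p) powr \<alpha>) has_real_derivative 0) (at 0)" by simp
  then have D: "((\<lambda>t. (1 + diff_norm_sq A g B h (var t) p) powr \<alpha>) has_real_derivative 0) (at 0)"
    by (rule has_field_derivative_transform_within_open[where S = "{-\<epsilon><..<\<epsilon>}"])
       (use \<epsilon> diff_norm_sq_var_outside[OF p] in auto)
  \<comment> \<open>\<rho> vanishes on the whole open complement of \<open>K\<close>, so its
    differential vanishes too, and the formula for \<open>rate\<close> gives the required 0.\<close>
  let ?S = "snd c ` (fst c \<inter> - K)"
  have "frechet_derivative (\<rho> \<circ> chart_inv c) (at (snd c p)) = (\<lambda>v. 0)"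
  proof (rule frechet_derivative_cong_open)
    show "open ?S"
      using open_chart_domain[OF ch] compact_imp_closed[OF K(1)] by (intro open_chart_image[OF ch]) auto
    show "snd c p \<in> ?S" using c p by blast
    show "(\<rho> \<circ> chart_inv c) y = 0" if "y \<in> ?S" for y
      using that \<rho>(2) chart_inv_chart[OF ch] by auto
  qed simp
  then have "chart_gradient c \<rho> p = 0" by (simp add: chart_gradient_def vec_eq_iff)
  then have "rate c e p = 0" by (simp add: rate_def \<rho>(2)[OF p])
  then show ?thesis using D by simp
qed

text \<open>The time derivative is continuous in (t, x) jointly, hence bounded on a small compact
  ball, and the mean value inequality in \<open>t\<close> gives a constant independent of the point.
  This supplies the dominating function for the integral.\<close>

lemma powr_energy_Lipschitz_local:
  "\<exists>U. open U \<and> p \<in> U \<and> (\<exists>\<delta>>0. \<exists>C. \<forall>q\<in>U. \<forall>t. \<bar>t\<bar> < \<delta> \<longrightarrow>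
    \<bar>(1 + diff_norm_sq A g B h (var t) q) powr \<alpha> - (1 + diff_norm_sq A g B h \<psi> q) powr \<alpha>\<bar> \<le> C * \<bar>t\<bar>)"
proof (cases "p \<in> K")
  case False
  have "open (- K)" using compact_imp_closed[OF K(1)] by blast
  then show ?thesis
    using False \<epsilon> diff_norm_sq_var_outside by (intro exI[of _ "- K"] conjI exI[of _ \<epsilon>] exI[of _ 0]) auto
next
  case True
  then have p: "\<psi> p \<in> fst d" using K(2) by blast
  obtain c where c: "c \<in> A" "p \<in> fst c" using smooth_atlas_cover[OF at(1)] by blast
  note ch = is_chart_atlas[OF at(1) c(1)]
  let ?x = "snd c p"
  have "(0, ?x) \<in> path_dom c"
    using src_mem[OF c(2) p] rep_mem[OF c(1) src_mem[OF c(2) p]] by (simp add: path_dom_def)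
  moreover have "open (path_dom c)"
    unfolding path_dom_def by (rule open_path_dom[OF c(1) open_chart_range[OF chd] order_refl])
  ultimately obtain r where r: "r > 0" "cball (0, ?x) r \<subseteq> path_dom c"
    by (metis open_contains_cball)
  define D where "D t x = \<alpha> * (1 + path_energy c t x) powr (\<alpha> - 1) * path_rate c t x" for t x
  have nn: "path_energy c t x \<ge> 0" if "(t, x) \<in> path_dom c" for t x
    using that by (intro path_energy_nonneg[OF c(1)]) (auto simp: path_dom_def)
  have "continuous_on (path_dom c) (\<lambda>y. D (fst y) (snd y))"
    unfolding D_def
    by (intro continuous_on_mult continuous_on_powr continuous_on_add continuous_on_const
        continuous_on_path_energy[OF c(1), unfolded case_prod_unfold]
        continuous_on_path_rate[OF c(1), unfolded case_prod_unfold])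
       (use nn in fastforce)
  then have "bounded ((\<lambda>y. D (fst y) (snd y)) ` cball (0, ?x) r)"
    using continuous_on_subset[OF _ r(2)] by (intro compact_imp_bounded compact_continuous_image) auto
  then obtain C where C: "\<And>y. y \<in> cball (0, ?x) r \<Longrightarrow> norm (D (fst y) (snd y)) \<le> C"
    unfolding bounded_iff by blast
  let ?B = "ball ?x (r / 2)"
  define \<delta> where "\<delta> = min (r / 2) \<epsilon>"
  \<comment> \<open>The product distance is at most |t| plus the distance of \<open>y\<close> from
    the centre, so half of \<open>r\<close> is granted to each.\<close>
  have ins: "(t, y) \<in> cball (0, ?x) r" if "\<bar>t\<bar> < \<delta>" "y \<in> ?B" for t y
  proof -
    have "dist (0, ?x) (t, y) \<le> \<bar>t\<bar> + dist ?x y"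
      unfolding dist_Pair_Pair by (rule order_trans[OF sqrt_sum_squares_le_sum_abs]) (simp add: dist_real_def)
    then show ?thesis using that by (simp add: \<delta>_def)
  qed
  have Bsub: "?B \<subseteq> src c"
  proof
    fix y assume "y \<in> ?B"
    then have "(0, y) \<in> path_dom c" using ins[of 0 y] r \<epsilon> by (auto simp: \<delta>_def)
    then show "y \<in> src c" by (simp add: path_dom_def)
  qed
  have bd: "\<bar>(1 + path_energy c t y) powr \<alpha> - (1 + path_energy c 0 y) powr \<alpha>\<bar> \<le> C * \<bar>t\<bar>"
    if t: "\<bar>t\<bar> < \<delta>" and y: "y \<in> ?B" for t y
  proof -
    let ?I = "{-\<delta><..<\<delta>}"
    have "norm ((1 + path_energy c t y) powr \<alpha> - (1 + path_energy c 0 y) powr \<alpha>) \<le> C * norm (t - 0)"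
    proof (rule field_differentiable_bound[of ?I])
      fix s assume s: "s \<in> ?I"
      then have sy: "(s, y) \<in> cball (0, ?x) r" using ins y by auto
      then have sp: "(s, y) \<in> path_dom c" using r(2) by blast
      have "((\<lambda>s. 1 + path_energy c s y) has_real_derivative path_rate c s y) (at s)"
        using path_energy_has_derivative[of c y s] sp by (auto simp: path_dom_def intro!: derivative_eq_intros)
      moreover have "1 + path_energy c s y > 0" using nn[OF sp] by simp
      ultimately have "((\<lambda>s. (1 + path_energy c s y) powr \<alpha>) has_real_derivative D s y) (at s)"
        unfolding D_def by (rule DERIV_fun_powr[where r = \<alpha>, simplified])
      then show "((\<lambda>s. (1 + path_energy c s y) powr \<alpha>) has_real_derivative D s y) (at s within ?I)"
        by (rule has_field_derivative_at_within)
      show "norm (D s y) \<le> C" using C[OF sy] by simp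
    qed (use t in auto)
    then show ?thesis by simp
  qed
  have U: "open (chart_inv c ` ?B)"
    using Bsub by (intro open_chart_inv_image[OF ch open_ball]) (auto simp: src_def)
  moreover have "p \<in> chart_inv c ` ?B"
    using chart_inv_chart[OF ch c(2)] r(1) by (intro image_eqI[of _ _ ?x]) auto
  moreover have "\<delta> > 0" using r(1) \<epsilon> by (simp add: \<delta>_def)
  moreover have "\<bar>(1 + diff_norm_sq A g B h (var t) q) powr \<alpha> - (1 + diff_norm_sq A g B h \<psi> q) powr \<alpha>\<bar> \<le> C * \<bar>t\<bar>"
    if q: "q \<in> chart_inv c ` ?B" and t: "\<bar>t\<bar> < \<delta>" for q t
  proof -
    obtain y where y: "y \<in> ?B" "q = chart_inv c y" using q by blast
    have ys: "y \<in> src c" using y(1) Bsub by blast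
    obtain b where b: "b \<in> fst c" "\<psi> b \<in> fst d" "y = snd c b" "chart_inv c y = b" using srcE[OF c(1) ys] .
    have e: "diff_norm_sq A g B h (var s) q = path_energy c s y" if "\<bar>s\<bar> < \<epsilon>" for s
      using diff_norm_sq_var[OF c(1) b(1,2) that] b y by simp
    show ?thesis using bd[OF t y(1)] e[of t] e[of 0] t \<epsilon> by (simp add: \<delta>_def)
  qed
  ultimately show ?thesis by blast
qed

lemma powr_energy_Lipschitz:
  assumes "compact (UNIV :: 'p set)"
  shows "\<exists>\<delta>>0. \<exists>C. \<forall>q. \<forall>t. \<bar>t\<bar> < \<delta> \<longrightarrow>
    \<bar>(1 + diff_norm_sq A g B h (var t) q) powr \<alpha> - (1 + diff_norm_sq A g B h \<psi> q) powr \<alpha>\<bar> \<le> C * \<bar>t\<bar>"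
proof -
  let ?\<Phi> = "\<lambda>t q. \<bar>(1 + diff_norm_sq A g B h (var t) q) powr \<alpha> - (1 + diff_norm_sq A g B h \<psi> q) powr \<alpha>\<bar>"
  have "\<exists>U. open U \<and> UNIV \<subseteq> U \<and> (\<exists>\<delta>>0. \<exists>C. \<forall>q\<in>U. \<forall>t. \<bar>t\<bar> < \<delta> \<longrightarrow> ?\<Phi> t q \<le> C * \<bar>t\<bar>)"
  proof (rule compact_induct_open[OF assms powr_energy_Lipschitz_local])
    show "\<exists>\<delta>>0. \<exists>C. \<forall>q\<in>{}. \<forall>t. \<bar>t\<bar> < \<delta> \<longrightarrow> ?\<Phi> t q \<le> C * \<bar>t\<bar>" by (intro exI[of _ 1]) auto
    fix U V :: "'p set"
    assume "\<exists>\<delta>>0. \<exists>C. \<forall>q\<in>U. \<forall>t. \<bar>t\<bar> < \<delta> \<longrightarrow> ?\<Phi> t q \<le> C * \<bar>t\<bar>"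
      and "\<exists>\<delta>>0. \<exists>C. \<forall>q\<in>V. \<forall>t. \<bar>t\<bar> < \<delta> \<longrightarrow> ?\<Phi> t q \<le> C * \<bar>t\<bar>"
    then obtain \<delta>1 C1 \<delta>2 C2 where 1: "\<delta>1 > 0" "\<And>q t. q \<in> U \<Longrightarrow> \<bar>t\<bar> < \<delta>1 \<Longrightarrow> ?\<Phi> t q \<le> C1 * \<bar>t\<bar>"
      and 2: "\<delta>2 > 0" "\<And>q t. q \<in> V \<Longrightarrow> \<bar>t\<bar> < \<delta>2 \<Longrightarrow> ?\<Phi> t q \<le> C2 * \<bar>t\<bar>" by metis
    \<comment> \<open>A union of two neighbourhoods takes the smaller time bound and the larger
      constant.\<close>
    have m: "C1 * \<bar>t\<bar> \<le> max C1 C2 * \<bar>t\<bar>" "C2 * \<bar>t\<bar> \<le> max C1 C2 * \<bar>t\<bar>" for t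
      by (auto intro: mult_right_mono)
    have "?\<Phi> t q \<le> max C1 C2 * \<bar>t\<bar>" if "q \<in> U \<union> V" "\<bar>t\<bar> < min \<delta>1 \<delta>2" for t q
    proof (cases "q \<in> U")
      case True
      then show ?thesis using 1(2)[of q t] m(1)[of t] that by linarith
    next
      case False
      then show ?thesis using 2(2)[of q t] m(2)[of t] that by force
    qed
    then show "\<exists>\<delta>>0. \<exists>C. \<forall>q\<in>U \<union> V. \<forall>t. \<bar>t\<bar> < \<delta> \<longrightarrow> ?\<Phi> t q \<le> C * \<bar>t\<bar>"
      using 1(1) 2(1) by (intro exI[of _ "min \<delta>1 \<delta>2"] conjI exI[of _ "max C1 C2"]) auto
  qed
  then show ?thesis by (metis UNIV_I subset_UNIV subset_antisym)
qed

end

section \<open>Differentiation under the integral sign\<close>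

text \<open>The derivative \<open>L\<close> of the integral is a hypothesis, to be supplied by
  criticality, so one sequence of difference quotients suffices to identify it. The quotients are
  dominated by the constant \<open>C\<close>, integrable for a finite measure, and \<open>D\<close>
  is measurable as their limit.\<close>

lemma has_derivative_under_integral:
  fixes \<Phi> :: "real \<Rightarrow> 'a \<Rightarrow> real"
  assumes fin: "finite_measure V" and \<epsilon>: "\<epsilon> > 0"
    and int: "\<And>t. \<bar>t\<bar> < \<epsilon> \<Longrightarrow> integrable V (\<Phi> t)"
    and bd: "\<And>t p. \<bar>t\<bar> < \<epsilon> \<Longrightarrow> \<bar>\<Phi> t p - \<Phi> 0 p\<bar> \<le> C * \<bar>t\<bar>"
    and D: "\<And>p. ((\<lambda>t. \<Phi> t p) has_real_derivative D p) (at 0)"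
    and L: "((\<lambda>t. \<integral>p. \<Phi> t p \<partial>V) has_real_derivative L) (at 0)"
  shows "integrable V D \<and> integral\<^sup>L V D = L"
proof -
  \<comment> \<open>The summand 2 keeps already the first term strictly below \<epsilon>.\<close>
  define t where "t n = \<epsilon> / (real n + 2)" for n :: nat
  have t: "t n > 0" "\<bar>t n\<bar> < \<epsilon>" for n using \<epsilon> by (auto simp: t_def field_simps intro: add_pos_nonneg)
  have "t \<longlonglongrightarrow> 0" unfolding t_def
    by (intro real_tendsto_divide_at_top tendsto_const filterlim_at_top_add_at_top
        filterlim_tendsto_add_at_top[OF tendsto_const] filterlim_real_sequentially
        filterlim_at_top_mono[OF filterlim_real_sequentially]) auto
  then have t0: "filterlim t (at 0) sequentially"
    unfolding filterlim_at using t(1) by (auto simp: less_imp_neq[symmetric] intro!: always_eventually)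
  define s where "s n p = (\<Phi> (t n) p - \<Phi> 0 p) / t n" for n p
  have quot: "(\<lambda>n. (f (t n) - f 0) / t n) \<longlonglongrightarrow> f'" if "(f has_real_derivative f') (at 0)" for f f'
    using filterlim_compose[OF that[unfolded has_field_derivative_iff] t0] by simp
  have int0: "integrable V (\<Phi> 0)" using int[of 0] \<epsilon> by simp
  have si: "integrable V (s n)" for n
    unfolding s_def using int[OF t(2)] int0 by simp
  have sl: "(\<lambda>n. s n p) \<longlonglongrightarrow> D p" for p unfolding s_def by (rule quot[OF D])
  have Dm: "D \<in> borel_measurable V"
    by (rule borel_measurable_LIMSEQ_real[OF sl]) (use si in auto)
  have sb: "norm (s n p) \<le> C" for n p
    using bd[OF t(2)[of n], of p] t(1)[of n] by (simp add: s_def abs_divide divide_le_eq)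
  have ci: "integrable V (\<lambda>_. C)" using fin by (simp add: finite_measure.integrable_const)
  have lim: "(\<lambda>n. integral\<^sup>L V (s n)) \<longlonglongrightarrow> integral\<^sup>L V D"
    by (rule integral_dominated_convergence[OF Dm _ ci, where s = s]) (use si sl sb in auto)
  have iD: "integrable V D"
    by (rule integrable_dominated_convergence[OF Dm _ ci, where s = s]) (use si sl sb in auto)
  have "integral\<^sup>L V (s n) = ((\<integral>p. \<Phi> (t n) p \<partial>V) - (\<integral>p. \<Phi> 0 p \<partial>V)) / t n" for n
    unfolding s_def using int[OF t(2)] int0 by simp
  then have "(\<lambda>n. integral\<^sup>L V (s n)) \<longlonglongrightarrow> L" using quot[OF L] by simp
  then show ?thesis using lim iD LIMSEQ_unique by blast
qed

text \<open>The charts \<open>c\<close> and \<open>e\<close> may vary with the point in any manner: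
  the derivative is computed pointwise, and the measurability of \<open>D\<close> comes from the
  difference quotients.\<close>

lemma (in chart_variation) first_variation:
  fixes \<alpha> :: real
  assumes comp: "compact (UNIV :: 'p set)" and harm: "alpha_harmonic \<alpha> A g B h \<psi>"
    and c: "\<And>p. c p \<in> A \<and> p \<in> fst (c p)" and e: "\<And>p. e p \<in> B \<and> \<psi> p \<in> fst (e p)"
  defines "D \<equiv> \<lambda>p. \<alpha> * (1 + diff_norm_sq A g B h \<psi> p) powr (\<alpha> - 1) * rate (c p) (e p) p"
  shows "integrable (riemannian_volume A g) D \<and> integral\<^sup>L (riemannian_volume A g) D = 0"
proof -
  let ?V = "riemannian_volume A g"
  let ?\<Phi> = "\<lambda>t p. (1 + diff_norm_sq A g B h (var t) p) powr \<alpha>"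
  note sV = sets_riemannian_volume[OF M comp] and fV = finite_riemannian_volume[OF M comp]
  obtain \<delta> C where \<delta>: "\<delta> > 0" "\<And>q t. \<bar>t\<bar> < \<delta> \<Longrightarrow> \<bar>?\<Phi> t q - (1 + diff_norm_sq A g B h \<psi> q) powr \<alpha>\<bar> \<le> C * \<bar>t\<bar>"
    using powr_energy_Lipschitz[OF comp] by metis
  show ?thesis
  proof (rule has_derivative_under_integral[OF fV, of "min \<delta> \<epsilon>" ?\<Phi> C D 0])
    show "0 < min \<delta> \<epsilon>" using \<delta> \<epsilon> by simp
    show "integrable ?V (?\<Phi> t)" if "\<bar>t\<bar> < min \<delta> \<epsilon>" for t
    proof -
      have pos: "1 + diff_norm_sq A g B h (var t) p \<noteq> 0" for p
        using diff_norm_sq_nonneg[OF M N, of "var t" p] by linarith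
      have "continuous_on UNIV (diff_norm_sq A g B h (var t))"
        using continuous_on_diff_norm_sq[OF M N smooth_map_var] that by simp
      then have cont: "continuous_on UNIV (?\<Phi> t)"
        using pos by (intro continuous_on_powr continuous_on_add continuous_on_const) auto
      then have "bounded (?\<Phi> t ` UNIV)" using comp by (intro compact_imp_bounded compact_continuous_image)
      then obtain b where b: "\<And>p. norm (?\<Phi> t p) \<le> b" unfolding bounded_iff by blast
      have "?\<Phi> t \<in> borel_measurable ?V"
        using borel_measurable_continuous_onI[OF cont] measurable_cong_sets[OF sV refl] by blast
      then show ?thesis
        using b by (intro finite_measure.integrable_const_bound[OF fV, of _ b]) auto
    qed
    show "\<bar>?\<Phi> t p - ?\<Phi> 0 p\<bar> \<le> C * \<bar>t\<bar>" if "\<bar>t\<bar> < min \<delta> \<epsilon>" for t p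
      using \<delta>(2)[of t p] that by simp
    show "((\<lambda>t. ?\<Phi> t p) has_real_derivative D p) (at 0)" for p
      unfolding D_def using c[of p] e[of p] by (intro powr_energy_has_derivative) auto
    show "((\<lambda>t. \<integral>p. ?\<Phi> t p \<partial>?V) has_real_derivative 0) (at 0)"
      using harm \<epsilon> smooth_map_variation var_0 unfolding alpha_harmonic_def alpha_energy_def by blast
  qed
qed

section \<open>Partitions of unity and the theorem\<close>

lemma open_chart_neighbourhood:
  assumes A: "smooth_atlas A" and W: "open W" "p \<in> W"
  obtains c r where "c \<in> A" "p \<in> fst c" "r > 0" "cball (snd c p) r \<subseteq> snd c ` (fst c \<inter> W)"
proof -
  obtain c where c: "c \<in> A" "p \<in> fst c" using smooth_atlas_cover[OF A] by blast
  note ch = is_chart_atlas[OF A c(1)]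
  have "open (snd c ` (fst c \<inter> W))"
    using open_chart_domain[OF ch] W(1) by (intro open_chart_image[OF ch]) auto
  moreover have "snd c p \<in> snd c ` (fst c \<inter> W)" using c W by blast
  ultimately obtain r where "r > 0" "cball (snd c p) r \<subseteq> snd c ` (fst c \<inter> W)"
    using open_contains_cball by blast
  then show ?thesis using that c by blast
qed

text \<open>A radial flat exponential in one chart, extended by zero. Smoothness across the edge of
  the chart holds because the compact \<open>K\<close> is closed in a Hausdorff space, so points
  outside the chart have a neighbourhood where the function is 0.\<close>

lemma bump_function:
  fixes A :: "('p::t2_space, 'e::euclidean_space) chart set"
  assumes A: "smooth_atlas A" and W: "open W" "p \<in> W"
  shows "\<exists>b K U. smooth_components A (\<lambda>_. b) \<and> compact K \<and> K \<subseteq> W \<and> (\<forall>q. q \<notin> K \<longrightarrow> b q = (0 :: real)) \<and>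
    (\<forall>q. b q \<ge> 0) \<and> open U \<and> p \<in> U \<and> (\<forall>q\<in>U. b q > 0)"
proof -
  obtain c r where c: "c \<in> A" "p \<in> fst c" and r: "r > 0" "cball (snd c p) r \<subseteq> snd c ` (fst c \<inter> W)"
    using open_chart_neighbourhood[OF A W] .
  note ch = is_chart_atlas[OF A c(1)]
  let ?x = "snd c p"
  \<comment> \<open>Written with sums and products only, so that the closure rules for smooth
    functions apply; it is \<open>flat_exp\<close> of r^2 minus the squared distance to the
    centre.\<close>
  define \<beta> where "\<beta> y = flat_exp 0 (r\<^sup>2 + (- 1) * ((y + - ?x) \<bullet> (y + - ?x)))" for y
  have \<beta>_eq: "\<beta> y = flat_exp 0 (r\<^sup>2 - (dist ?x y)\<^sup>2)" for y
    by (simp add: \<beta>_def dist_norm power2_norm_eq_inner norm_minus_commute[of ?x])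
  define b where "b q = (if q \<in> fst c then \<beta> (snd c q) else 0)" for q
  let ?K = "chart_inv c ` cball ?x r" and ?U = "chart_inv c ` ball ?x r"
  have sub: "cball ?x r \<subseteq> snd c ` fst c" using r(2) by blast
  have K: "compact ?K"
    by (intro compact_continuous_image continuous_on_subset[OF continuous_on_chart_inv[OF ch] sub]) simp
  have "?K \<subseteq> W"
  proof
    fix q assume "q \<in> ?K"
    then obtain y where "y \<in> cball ?x r" "q = chart_inv c y" by blast
    moreover from this obtain a where "a \<in> fst c" "a \<in> W" "y = snd c a" using r(2) by blast
    ultimately show "q \<in> W" by (simp add: chart_inv_chart[OF ch])
  qed
  have outside: "b q = 0" if "q \<notin> ?K" for q
  proof (cases "q \<in> fst c")
    case True
    then have "snd c q \<notin> cball ?x r"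
      using that chart_inv_chart[OF ch True] by (metis image_eqI)
    then have "r < dist ?x (snd c q)" by simp
    then have "r\<^sup>2 \<le> (dist ?x (snd c q))\<^sup>2" using r(1) by (intro power_mono) auto
    then show ?thesis by (simp add: b_def \<beta>_eq flat_exp_def)
  qed (simp add: b_def)
  have "b q > 0" if "q \<in> ?U" for q
  proof -
    obtain y where y: "y \<in> ball ?x r" "q = chart_inv c y" using \<open>q \<in> ?U\<close> by blast
    then have "y \<in> snd c ` fst c" using sub by auto
    then have "q \<in> fst c" "snd c q = y" using y chart_inv_mem[OF ch] chart_chart_inv[OF ch] by auto
    moreover have "(dist ?x y)\<^sup>2 < r\<^sup>2" using y(1) by (intro power_strict_mono) auto
    ultimately show ?thesis by (simp add: b_def \<beta>_eq flat_exp_def)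
  qed
  moreover have "b q \<ge> 0" for q by (simp add: b_def \<beta>_eq flat_exp_def)
  moreover have "open ?U" using sub by (intro open_chart_inv_image[OF ch open_ball]) auto
  moreover have "p \<in> ?U" using chart_inv_chart[OF ch c(2)] r(1) by (intro image_eqI[of _ _ ?x]) auto
  moreover have "smooth_components A (\<lambda>_. b)"
    unfolding smooth_components_def
  proof
    fix c' assume c': "c' \<in> A"
    note ch' = is_chart_atlas[OF A c']
    show "smooth_on (snd c' ` fst c') (b \<circ> chart_inv c')"
    proof (rule smooth_on_local)
      fix x assume "x \<in> snd c' ` fst c'"
      then obtain q where q: "q \<in> fst c'" "x = snd c' q" by blast
      show "\<exists>T. open T \<and> x \<in> T \<and> smooth_on T (b \<circ> chart_inv c')"
      proof (cases "q \<in> fst c")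
        case True
        let ?T = "snd c' ` (fst c' \<inter> fst c)"
        have o: "open ?T"
          using open_chart_domain[OF ch] open_chart_domain[OF ch'] by (intro open_chart_image[OF ch']) auto
        have "smooth_on ?T (\<lambda>y. \<beta> (chart_rep c' c id y))"
          unfolding \<beta>_def using smooth_on_transition[OF A c' c(1)]
          by (intro smooth_on_compose[OF o open_UNIV _ smooth_on_flat_exp] smooth_on_add[OF o] smooth_on_const
              smooth_on_bilinear[OF o bounded_bilinear_mult] smooth_on_bilinear[OF o bounded_bilinear_inner]) auto
        then have "smooth_on ?T (b \<circ> chart_inv c')"
          by (rule smooth_on_transform[OF o]) (auto simp: b_def chart_rep_def chart_inv_chart[OF ch'])
        then show ?thesis using o q True by blast
      next
        case False
        let ?T = "snd c' ` (fst c' \<inter> - ?K)"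
        have o: "open ?T"
          using compact_imp_closed[OF K] open_chart_domain[OF ch'] by (intro open_chart_image[OF ch']) auto
        have "smooth_on ?T (b \<circ> chart_inv c')"
          by (rule smooth_on_transform[OF o smooth_on_const[of _ 0]])
             (auto simp: outside chart_inv_chart[OF ch'])
        moreover have "q \<notin> ?K" using False sub chart_inv_mem[OF ch] by blast
        ultimately show ?thesis using o q by blast
      qed
    qed
  qed
  ultimately show ?thesis
    using K \<open>?K \<subseteq> W\<close> outside
    by (intro exI[of _ b] exI[of _ ?K] exI[of _ ?U] conjI allI impI ballI) assumption+
qed

text \<open>Finitely many bump functions are positive somewhere at every point, so their sum is
  positive and can be divided by. The indices are points of the manifold, each remembering its own
  neighbourhood \<open>W\<close>.\<close>

lemma smooth_partition_of_unity:
  fixes A :: "('p::t2_space, 'e::euclidean_space) chart set" and W :: "'p \<Rightarrow> 'p set"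
  assumes A: "smooth_atlas A" and comp: "compact (UNIV :: 'p set)"
    and W: "\<And>p. open (W p)" "\<And>p. p \<in> W p"
  obtains I :: "'p set" and \<rho> K where "finite I"
    "\<And>i. i \<in> I \<Longrightarrow> smooth_components A (\<lambda>_. \<rho> i :: 'p \<Rightarrow> real)" "\<And>i. i \<in> I \<Longrightarrow> compact (K i)"
    "\<And>i. i \<in> I \<Longrightarrow> K i \<subseteq> W i" "\<And>i p. i \<in> I \<Longrightarrow> p \<notin> K i \<Longrightarrow> \<rho> i p = 0" "\<And>p. (\<Sum>i\<in>I. \<rho> i p) = 1"
proof -
  have "\<forall>p. \<exists>b K U. smooth_components A (\<lambda>_. b) \<and> compact K \<and> K \<subseteq> W p \<and> (\<forall>q. q \<notin> K \<longrightarrow> b q = (0 :: real)) \<and>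
    (\<forall>q. b q \<ge> 0) \<and> open U \<and> p \<in> U \<and> (\<forall>q\<in>U. b q > 0)"
    using bump_function[OF A W] by blast
  then obtain b K U where b: "\<And>p. smooth_components A (\<lambda>_. b p)" and K: "\<And>p. compact (K p)" "\<And>p. K p \<subseteq> W p"
    and out: "\<And>p q. q \<notin> K p \<Longrightarrow> b p q = (0 :: real)" and nn: "\<And>p q. b p q \<ge> 0"
    and U: "\<And>p. open (U p)" "\<And>p. p \<in> U p" and pos: "\<And>p q. q \<in> U p \<Longrightarrow> b p q > 0"
    by metis
  obtain I where I: "finite I" "UNIV \<subseteq> (\<Union>i\<in>I. U i)"
  proof (rule compactE_image[OF comp, of UNIV U])
    show "UNIV \<subseteq> (\<Union>i\<in>UNIV. U i)" using U(2) by auto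
  qed (use U(1) in auto)
  have sum_pos: "(\<Sum>i\<in>I. b i p) > 0" for p
  proof -
    obtain i where "i \<in> I" "p \<in> U i" using I(2) by blast
    then show ?thesis using sum_pos2[OF I(1), of i "\<lambda>i. b i p"] nn pos by blast
  qed
  show ?thesis
  proof (rule that[of I "\<lambda>i p. b i p / (\<Sum>j\<in>I. b j p)" K])
    fix i
    show "smooth_components A (\<lambda>_ p. b i p / (\<Sum>j\<in>I. b j p))"
      unfolding smooth_components_def
    proof
      fix c assume c: "c \<in> A"
      have o: "open (snd c ` fst c)" by (rule open_chart_range[OF is_chart_atlas[OF A c]])
      have s: "smooth_on (snd c ` fst c) (\<lambda>x. b j (chart_inv c x))" for j
        using b c unfolding smooth_components_def o_def by blast
      show "smooth_on (snd c ` fst c) ((\<lambda>p. b i p / (\<Sum>j\<in>I. b j p)) \<circ> chart_inv c)"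
        unfolding o_def using sum_pos
        by (intro smooth_on_divide[OF o s] smooth_on_sum[OF o s]) (metis less_irrefl)
    qed
    show "(\<Sum>i\<in>I. b i p / (\<Sum>j\<in>I. b j p)) = 1" for p
      using sum_pos[of p] by (simp add: sum_divide_distrib[symmetric])
  qed (use I K out in auto)
qed

lemma chart_gradient_sum:
  assumes "is_chart c" "p \<in> fst c" "\<And>i. i \<in> I \<Longrightarrow> smooth_on (snd c ` fst c) (f i \<circ> chart_inv c)"
  shows "chart_gradient c (\<lambda>p. \<Sum>i\<in>I. f i p) p = (\<Sum>i\<in>I. chart_gradient c (f i) p)"
proof -
  have "((\<lambda>x. \<Sum>i\<in>I. (f i \<circ> chart_inv c) x) has_derivative
      (\<lambda>v. \<Sum>i\<in>I. frechet_derivative (f i \<circ> chart_inv c) (at (snd c p)) v)) (at (snd c p))"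
    using assms(2) by (intro has_derivative_sum smooth_on_has_derivative[OF assms(3)]) auto
  from frechet_derivative_at[OF this]
  have "frechet_derivative ((\<lambda>p. \<Sum>i\<in>I. f i p) \<circ> chart_inv c) (at (snd c p)) =
      (\<lambda>v. \<Sum>i\<in>I. frechet_derivative (f i \<circ> chart_inv c) (at (snd c p)) v)"
    by (simp add: o_def)
  then show ?thesis by (simp add: chart_gradient_def vec_eq_iff)
qed

theorem theorem6:
  fixes A :: "('p::{t2_space, second_countable_topology}, real^'m) chart set"
    and g :: "('p, real^'m) chart \<Rightarrow> 'p \<Rightarrow> real^'m^'m"
    and B :: "('q::{t2_space, second_countable_topology}, real^'n) chart set"
    and h :: "('q, real^'n) chart \<Rightarrow> 'q \<Rightarrow> real^'n^'n"
    and \<psi> :: "'p \<Rightarrow> 'q"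
    and X :: "('q, real^'n) chart \<Rightarrow> 'q \<Rightarrow> real^'n"
    and l :: "'q \<Rightarrow> real"
    and \<alpha> :: real
  assumes "\<alpha> > 1"
    and "riemannian_manifold A g"
    and "compact (UNIV :: 'p set)" and "connected (UNIV :: 'p set)" and "orientable A"
    and "riemannian_manifold B h"
    and "alpha_harmonic \<alpha> A g B h \<psi>"
    and "conformal_field B h X l"
    and "\<forall>q. l q > 0"
  shows "\<exists>q. \<forall>p. \<psi> p = q"
proof -
  note M = \<open>riemannian_manifold A g\<close> and N = \<open>riemannian_manifold B h\<close>
    and comp = \<open>compact (UNIV :: 'p set)\<close>
  note at = riemannian_manifold_atlas[OF M] riemannian_manifold_atlas[OF N]
  have \<psi>: "smooth_map A B \<psi>" using \<open>alpha_harmonic \<alpha> A g B h \<psi>\<close> unfolding alpha_harmonic_def by blast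
  let ?V = "riemannian_volume A g"
  let ?e = "diff_norm_sq A g B h \<psi>"
  define c where "c p = chart_at A p" for p
  define d where "d p = chart_at B (\<psi> p)" for p
  have c: "c p \<in> A \<and> p \<in> fst (c p)" for p using chart_at_works[OF at(1)] by (simp add: c_def)
  have dd: "d p \<in> B \<and> \<psi> p \<in> fst (d p)" for p using chart_at_works[OF at(2)] by (simp add: d_def)
  have W: "open (\<psi> -` fst (d p))" "p \<in> \<psi> -` fst (d p)" for p
    using smooth_map_open_preimage[OF \<psi> at(1) open_chart_domain[OF is_chart_atlas[OF at(2)]]] dd by auto
  obtain I \<rho> K where I: "finite I" "\<And>i. i \<in> I \<Longrightarrow> smooth_components A (\<lambda>_. \<rho> i :: 'p \<Rightarrow> real)"
    "\<And>i. i \<in> I \<Longrightarrow> compact (K i)" "\<And>i. i \<in> I \<Longrightarrow> K i \<subseteq> \<psi> -` fst (d i)"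
    "\<And>i p. i \<in> I \<Longrightarrow> p \<notin> K i \<Longrightarrow> \<rho> i p = 0" "\<And>p. (\<Sum>i\<in>I. \<rho> i p) = 1"
    using smooth_partition_of_unity[OF at(1) comp, of "\<lambda>p. \<psi> -` fst (d p)"] W by metis
  \<comment> \<open>For every index \<open>i\<close> the pairing is evaluated in the same target
    chart \<open>d p\<close>, not in the chart \<open>d i\<close> that carries the variation, so
    that at each point only the cutoff depends on \<open>i\<close>.\<close>
  define R where "R i p = 2 * l (\<psi> p) * \<rho> i p * ?e p
      + gradient_pairing (g (c p) p) (pulled_covector h X \<psi> (c p) (d p) p) (chart_gradient (c p) (\<rho> i) p)" for i p
  let ?D = "\<lambda>i p. \<alpha> * (1 + ?e p) powr (\<alpha> - 1) * R i p"
  have int: "integrable ?V (?D i)" "integral\<^sup>L ?V (?D i) = 0" if i: "i \<in> I" for i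
  proof -
    interpret target_variation A g B h \<psi> X l "d i" "\<rho> i" "K i"
      using M N \<psi> \<open>conformal_field B h X l\<close> dd I i by unfold_locales auto
    obtain \<epsilon> where \<epsilon>: "\<epsilon> > 0"
      "\<And>p t. \<psi> p \<in> fst (d i) \<Longrightarrow> \<bar>t\<bar> < \<epsilon> \<Longrightarrow> snd (d i) (\<psi> p) + t *\<^sub>R push p \<in> snd (d i) ` fst (d i)"
      using push_small by blast
    interpret chart_variation A g B h \<psi> X l "d i" "\<rho> i" "K i" \<epsilon>
      using \<epsilon> by unfold_locales auto
    have r: "rate (c p) (d p) p = R i p" for p by (simp add: rate_def R_def)
    show "integrable ?V (?D i)" "integral\<^sup>L ?V (?D i) = 0"
      using first_variation[OF comp \<open>alpha_harmonic \<alpha> A g B h \<psi>\<close> c dd] unfolding r by blast+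
  qed
  have R_sum: "(\<Sum>i\<in>I. R i p) = 2 * l (\<psi> p) * ?e p" for p
  proof -
    note ch = is_chart_atlas[OF at(1)] and cp = c[of p]
    \<comment> \<open>The differentials of a partition of unity add up to the differential of the
      constant 1.\<close>
    have "(\<Sum>i\<in>I. chart_gradient (c p) (\<rho> i) p) = chart_gradient (c p) (\<lambda>p. \<Sum>i\<in>I. \<rho> i p) p"
      using I(2) cp ch by (intro chart_gradient_sum[symmetric]) (auto simp: smooth_components_def)
    also have "\<dots> = 0" by (simp add: I(6) chart_gradient_def o_def vec_eq_iff)
    finally have 0: "(\<Sum>i\<in>I. chart_gradient (c p) (\<rho> i) p) = 0" .
    have "(\<Sum>i\<in>I. R i p) = 2 * l (\<psi> p) * (\<Sum>i\<in>I. \<rho> i p) * ?e p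
        + gradient_pairing (g (c p) p) (pulled_covector h X \<psi> (c p) (d p) p) (\<Sum>i\<in>I. chart_gradient (c p) (\<rho> i) p)"
      by (simp add: R_def sum.distrib gradient_pairing_sum sum_distrib_left sum_distrib_right)
    then show ?thesis by (simp add: 0 I(6))
  qed
  let ?F = "\<lambda>p. \<alpha> * (1 + ?e p) powr (\<alpha> - 1) * (2 * l (\<psi> p) * ?e p)"
  have F: "?F p = (\<Sum>i\<in>I. ?D i p)" for p by (simp add: R_sum[symmetric] sum_distrib_left)
  have "integrable ?V ?F" "integral\<^sup>L ?V ?F = 0"
    unfolding F using int by (simp_all add: Bochner_Integration.integral_sum)
  moreover have e: "?e p \<ge> 0" for p by (rule diff_norm_sq_nonneg[OF M N])
  moreover have "?F p \<ge> 0" for p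
    using e[of p] \<open>\<alpha> > 1\<close> \<open>\<forall>q. l q > 0\<close> by (intro mult_nonneg_nonneg) (auto simp: less_imp_le)
  ultimately have "AE p in ?V. ?F p = 0" by (simp add: integral_nonneg_eq_0_iff_AE)
  \<comment> \<open>All other factors are positive, in particular the potential; its sign thus
    decides the argument.\<close>
  moreover have "?e p = 0" if "?F p = 0" for p
    using that e[of p] \<open>\<alpha> > 1\<close> \<open>\<forall>q. l q > 0\<close> by (auto simp: less_le)
  ultimately have ae: "AE p in ?V. ?e p = 0" by (auto elim: eventually_mono)
  \<comment> \<open>By continuity the set where the differential is nonzero is open; having volume
    zero, it must be empty.\<close>
  let ?U = "{p. ?e p \<noteq> 0}"
  have oU: "open ?U"
    using continuous_on_diff_norm_sq[OF M N \<psi>] by (intro open_Collect_neq continuous_on_const)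
  have sU: "?U \<in> sets ?V" using oU by (simp add: sets_riemannian_volume[OF M comp])
  have "space ?V = UNIV" using sets_eq_imp_space_eq[OF sets_riemannian_volume[OF M comp]] by simp
  then have "emeasure ?V ?U = 0" using ae sU by (subst (asm) AE_iff_measurable[OF sU]) auto
  then have "?U = {}" using riemannian_volume_pos_open[OF M comp oU] by blast
  then show ?thesis using smooth_map_constant[OF M N \<psi> \<open>connected (UNIV :: 'p set)\<close>] by blast
qed

end
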